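(* Let $\mathcal C=(C_1,\dots,C_m)$ be a collection of $m\geq 3$ pinhole cameras with distinct centers and assume that no three centers are collinear. Then the singular locus of the line multiview variety $\mathcal L_{\mathcal C}$ is $$\mathcal{L}_{\mathcal{C}}^\mathrm{sing}= \{\ell \in \mathcal{L}_{\mathcal{C}} \mid \mathrm{rank}\, M(\ell) = 1\}.$$
   Context: All projective spaces are complex. A pinhole camera is a full-rank matrix $C\in\mathbb C^{3\times 4}$; its center is the point $c=\ker(C)\in\mathbb P^3$. Let $\mathbb G$ be the Grassmannian of lines in $\mathbb P^3$. A line in $\mathbb P^2$ is identified with its linear equation $\ell\in\mathbb P^2$: a point $x$ is on the line if and only if $x^T\ell=0$. For a line $L\subset\mathbb P^3$ through points $x,y$ and not through the center of $C$, $C\cdot L$ denotes the line in $\mathbb P^2$ through $Cx$ and $Cy$. The joint camera map is the rational map $\Upsilon_{\mathcal C}:\mathbb G\dashrightarrow(\mathbb P^2)^m$, $L\mapsto (C_1\cdot L,\dots,C_m\cdot L)$, defined at the lines that pass through no camera center $c_i=\ker(C_i)$; $\Upsilon_{\mathcal C}(\mathbb G)$ denotes its image. The line multiview variety is the Zariski closure $\mathcal L_{\mathcal C}:=\overline{\Upsilon_{\mathcal C}(\mathbb G)}\subseteq(\mathbb P^2)^m$, and $\mathcal L_{\mathcal C}^{\mathrm{sing}}$ is the set of its non-smooth points. For $\ell=(\ell_1,\dots,\ell_m)\in(\mathbb P^2)^m$, $M(\ell)=\begin{bmatrix}C_1^T\ell_1&\cdots&C_m^T\ell_m\end{bmatrix}\in\mathbb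 C^{4\times m}$ (its rank does not depend on the choice of representatives). Three centers are collinear if they lie on a common line in $\mathbb P^3$. *)

theory Defs
  imports "HOL-Analysis.Analysis" "HOL-Library.Extended_Nat"
begin

section \<open>Complex projective spaces\<close>

definition proj_rel :: "complex^'n::finite \<Rightarrow> complex^'n \<Rightarrow> bool" where
  "proj_rel x y \<longleftrightarrow> x \<noteq> 0 \<and> y \<noteq> 0 \<and> (\<exists>c. c \<noteq> 0 \<and> y = c *s x)"

text \<open>\<open>'n proj\<close> is the projective space of \<open>complex^'n\<close>, so \<open>3 proj\<close> is the projective plane.\<close>

quotient_type (overloaded) 'n proj = "complex^'n::finite" / partial: proj_rel
proof (rule part_equivpI)
  show "\<exists>x :: complex^'n. proj_rel x x"
    by (rule exI[of _ 1]) (auto simp: proj_rel_def vec_eq_iff intro!: exI[of _ 1])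
  show "symp (proj_rel :: complex^'n \<Rightarrow> _)"
  proof (rule sympI)
    fix x y :: "complex^'n"
    assume "proj_rel x y"
    then obtain c where c: "x \<noteq> 0" "y \<noteq> 0" "c \<noteq> 0" "y = c *s x"
      by (auto simp: proj_rel_def)
    then have "x = inverse c *s y"
      by (simp add: vec_eq_iff)
    with c show "proj_rel y x"
      unfolding proj_rel_def by (metis nonzero_imp_inverse_nonzero)
  qed
  show "transp (proj_rel :: complex^'n \<Rightarrow> _)"
  proof (rule transpI)
    fix x y z :: "complex^'n"
    assume "proj_rel x y" "proj_rel y z"
    then obtain c d where "x \<noteq> 0" "z \<noteq> 0" "c \<noteq> 0" "d \<noteq> 0" "z = (d * c) *s x"
      by (auto simp: proj_rel_def vector_smult_assoc)
    then show "proj_rel x z"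
      unfolding proj_rel_def by (metis no_zero_divisors)
  qed
qed

section \<open>Zariski geometry of products of projective spaces\<close>

text \<open>
  A point of the product of the spaces \<open>'n proj\<close> over the finite index type \<open>'m\<close> is a function
  \<open>'m \<Rightarrow> 'n proj\<close>.  Homogeneous coordinates for it live in \<open>complex^('m \<times> 'n)\<close>, the entries
  \<open>(i, _)\<close> being the coordinates of the \<open>i\<close>-th factor.  The field is infinite, so polynomials are
  identified with the functions they induce.
\<close>

inductive polynomial_fun :: "(complex^'k::finite \<Rightarrow> complex) \<Rightarrow> bool" where
  const: "polynomial_fun (\<lambda>x. c)"
| coordinate: "polynomial_fun (\<lambda>x. x $ k)"
| add: "polynomial_fun f \<Longrightarrow> polynomial_fun g \<Longrightarrow> polynomial_fun (\<lambda>x. f x + g x)"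
| mult: "polynomial_fun f \<Longrightarrow> polynomial_fun g \<Longrightarrow> polynomial_fun (\<lambda>x. f x * g x)"

definition scale_blocks ::
  "('m \<Rightarrow> complex) \<Rightarrow> complex^('m::finite \<times> 'n::finite) \<Rightarrow> complex^('m \<times> 'n)" where
  "scale_blocks t x = (\<chi> k. t (fst k) * x $ k)"

definition multihomogeneous :: "(complex^('m::finite \<times> 'n::finite) \<Rightarrow> complex) \<Rightarrow> bool" where
  "multihomogeneous f \<longleftrightarrow> polynomial_fun f \<and>
     (\<exists>d :: 'm \<Rightarrow> nat. \<forall>t x. f (scale_blocks t x) = (\<Prod>i\<in>UNIV. t i ^ d i) * f x)"

text \<open>
  A choice of homogeneous coordinates; the vanishing of a multihomogeneous polynomial does not
  depend on it.
\<close>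

definition hom_coords :: "('m::finite \<Rightarrow> 'n::finite proj) \<Rightarrow> complex^('m \<times> 'n)" where
  "hom_coords p = (\<chi> k. rep_proj (p (fst k)) $ snd k)"

definition zariski_closed :: "('m::finite \<Rightarrow> 'n::finite proj) set \<Rightarrow> bool" where
  "zariski_closed Z \<longleftrightarrow>
     (\<exists>F. (\<forall>f\<in>F. multihomogeneous f) \<and> Z = {p. \<forall>f\<in>F. f (hom_coords p) = 0})"

abbreviation zariski_closure ::
  "('m::finite \<Rightarrow> 'n::finite proj) set \<Rightarrow> ('m \<Rightarrow> 'n proj) set" where
  "zariski_closure A \<equiv> zariski_closed hull A"

definition irreducible_closed :: "('m::finite \<Rightarrow> 'n::finite proj) set \<Rightarrow> bool" where
  "irreducible_closed Z \<longleftrightarrow> zariski_closed Z \<and> Z \<noteq> {} \<and>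
     (\<forall>A B. zariski_closed A \<longrightarrow> zariski_closed B \<longrightarrow> Z = A \<union> B \<longrightarrow> Z = A \<or> Z = B)"

definition krull_dim :: "('m::finite \<Rightarrow> 'n::finite proj) set \<Rightarrow> enat" where
  "krull_dim X = Sup {enat r | r. \<exists>Z :: nat \<Rightarrow> ('m \<Rightarrow> 'n proj) set.
     (\<forall>i\<le>r. irreducible_closed (Z i) \<and> Z i \<subseteq> X) \<and> (\<forall>i<r. Z i \<subset> Z (Suc i))}"

text \<open>
  The dimension at \<open>p\<close> of a closed set \<open>X\<close>: the largest dimension of an irreducible component of
  \<open>X\<close> through \<open>p\<close>.  For irreducible \<open>X\<close> this is \<open>krull_dim X\<close> at every point of \<open>X\<close>.
\<close>

definition local_dim :: "('m::finite \<Rightarrow> 'n::finite proj) set \<Rightarrow> ('m \<Rightarrow> 'n proj) \<Rightarrow> enat" where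
  "local_dim X p = Sup {krull_dim Z | Z. irreducible_closed Z \<and> Z \<subseteq> X \<and> p \<in> Z}"

text \<open>
  The tangent space at \<open>hom_coords p\<close> of the multicone over \<open>X\<close>: the common kernel of the
  differentials of all multihomogeneous polynomials vanishing on \<open>X\<close>
  (\<open>deriv (\<lambda>t. f (x + t *s v)) 0\<close> is the sum of the \<open>(\<partial>f/\<partial>x\<^sub>k)(x) v\<^sub>k\<close>).  By Euler's
  relations it contains the span of the \<open>CARD('m)\<close> blocks of \<open>hom_coords p\<close>, and its quotient by
  that span is the Zariski tangent space of \<open>X\<close> at \<open>p\<close>.
\<close>

definition cone_tangent_space ::
  "('m::finite \<Rightarrow> 'n::finite proj) set \<Rightarrow> ('m \<Rightarrow> 'n proj) \<Rightarrow> (complex^('m \<times> 'n)) set" where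
  "cone_tangent_space X p =
     {v. \<forall>f. multihomogeneous f \<and> (\<forall>q\<in>X. f (hom_coords q) = 0) \<longrightarrow>
           deriv (\<lambda>t. f (hom_coords p + t *s v)) 0 = 0}"

definition smooth_at :: "('m::finite \<Rightarrow> 'n::finite proj) set \<Rightarrow> ('m \<Rightarrow> 'n proj) \<Rightarrow> bool" where
  "smooth_at X p \<longleftrightarrow> enat (vec.dim (cone_tangent_space X p)) = local_dim X p + enat CARD('m)"

definition singular_locus ::
  "('m::finite \<Rightarrow> 'n::finite proj) set \<Rightarrow> ('m \<Rightarrow> 'n proj) set" where
  "singular_locus X = {p \<in> X. \<not> smooth_at X p}"

section \<open>Cameras and the line multiview variety\<close>

text \<open>
  Points and lines of projective 3-space are linear subspaces of \<open>complex^4\<close> of dimension 1 and 2.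
\<close>

definition pinhole_camera :: "complex^4^3 \<Rightarrow> bool" where
  "pinhole_camera C \<longleftrightarrow> rank C = 3"

definition center :: "complex^4^3 \<Rightarrow> (complex^4) set" where
  "center C = {x. C *v x = 0}"

definition is_line :: "(complex^4) set \<Rightarrow> bool" where
  "is_line L \<longleftrightarrow> vec.subspace L \<and> vec.dim L = 2"

definition collinear_points ::
  "(complex^4) set \<Rightarrow> (complex^4) set \<Rightarrow> (complex^4) set \<Rightarrow> bool" where
  "collinear_points a b c \<longleftrightarrow> (\<exists>L. is_line L \<and> a \<subseteq> L \<and> b \<subseteq> L \<and> c \<subseteq> L)"

text \<open>
  The image line \<open>C\<cdot>L\<close>, as the point of the plane given by its equation.  The bilinear
  \<open>scalar_product\<close> is used; \<open>inner\<close> on \<open>complex^3\<close> would be real-valued.  Only meaningful if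
  \<open>L\<close> does not pass through the center of \<open>C\<close>; then \<open>(*v) C ` L\<close> is the span of \<open>C x\<close> and
  \<open>C y\<close> for any \<open>x\<close>, \<open>y\<close> spanning \<open>L\<close>.
\<close>

definition line_image :: "complex^4^3 \<Rightarrow> (complex^4) set \<Rightarrow> 3 proj" where
  "line_image C L = (THE l. {u. scalar_product u (rep_proj l) = 0} = (*v) C ` L)"

definition joint_camera_map ::
  "('m::finite \<Rightarrow> complex^4^3) \<Rightarrow> (complex^4) set \<Rightarrow> ('m \<Rightarrow> 3 proj)" where
  "joint_camera_map C L = (\<lambda>i. line_image (C i) L)"

definition line_multiview_variety ::
  "('m::finite \<Rightarrow> complex^4^3) \<Rightarrow> ('m \<Rightarrow> 3 proj) set" where
  "line_multiview_variety C =
     zariski_closure (joint_camera_map C ` {L. is_line L \<and> (\<forall>i. \<not> center (C i) \<subseteq> L)})"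

text \<open>The matrix whose \<open>i\<close>-th column is the back-projected plane \<open>C\<^sub>i\<^sup>T l\<^sub>i\<close>.\<close>

definition back_projection_matrix ::
  "('m::finite \<Rightarrow> complex^4^3) \<Rightarrow> ('m \<Rightarrow> 3 proj) \<Rightarrow> complex^'m^4" where
  "back_projection_matrix C l = (\<chi> r i. (transpose (C i) *v rep_proj (l i)) $ r)"

end

theory Submission
  imports Defs "HOL-Library.Function_Algebras"
begin

text \<open>
  Write \<open>X\<close> for the line multiview variety, \<open>m\<close> for the number of cameras, \<open>c\<^sub>k\<close> for the centers, and
  \<open>P\<^sub>k = C\<^sub>k\<^sup>T l\<^sub>k\<close> for the back-projected planes of a point \<open>l\<close>, read as linear forms on
  \<open>complex^4\<close>.  A point of \<open>X\<close> is smooth exactly if its cone tangent space \<open>T\<close> has dimension \<open>m + 4\<close>: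
  \<open>X\<close> is irreducible of dimension 4 because it is the closure of the image of a polynomial map
  defined on \<open>complex^4\<close> (\<open>line_multiview_variety_chart\<close>).  The upper bound
  \<open>krull_dim_param_variety_le\<close> for the dimension of such a closure is a count: from a chain of \<open>r\<close>
  strict inclusions one gets about \<open>N\<^sup>r\<close> linearly independent products of forms, whereas polynomials
  of degree \<open>O(N)\<close> in 4 variables span a space of dimension only \<open>O(N\<^sup>4)\<close>.

  The bound \<open>dim T \<ge> m + 4\<close> holds at every point of \<open>X\<close>.  On the image of the chart it follows by
  differentiating the chart together with the \<open>m\<close> scalings of the blocks, and it extends to the
  closure because the dimension of \<open>T\<close> is upper semicontinuous
  (\<open>tangent_dimension_semicontinuous\<close>).

  The \<open>3 \<times> 3\<close> minors of \<open>M(l)\<close> vanish on \<open>X\<close>, so its rank is 1 or 2 there.  If the rank is 2,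
  let \<open>L\<close> be the line on which all \<open>P\<^sub>k\<close> vanish.  Differentiating the minors shows that a tangent
  vector \<open>v\<close> satisfies, on \<open>L\<close>, the linear relations of the planes: if
  \<open>P\<^sub>k = \<alpha> P\<^sub>i + \<beta> P\<^sub>j\<close> then \<open>C\<^sub>k\<^sup>T v\<^sub>k = \<alpha> C\<^sub>i\<^sup>T v\<^sub>i + \<beta> C\<^sub>j\<^sup>T v\<^sub>j\<close> on \<open>L\<close>.  These relations leave at
  most \<open>m + 4\<close> dimensions (\<open>tangent_dimension_le\<close>): each center on \<open>L\<close> loosens one block by one
  dimension and forces one more equation in return, and at most two centers lie on \<open>L\<close> because no
  three are collinear.

  If the rank is 1, all back-projected planes agree with one plane \<open>P\<close>, which contains every center.
  A line \<open>L\<close> of \<open>P\<close> through \<open>c\<^sub>j\<close> and no other center has a point \<open>C\<^sub>j L\<close> as its \<open>j\<close>-th image, and every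
  line through that point is a limit of the \<open>j\<close>-th images of lines that tend to \<open>L\<close>.  So turning
  \<open>l\<^sub>j\<close> about \<open>C\<^sub>j L\<close> with the other \<open>l\<^sub>k\<close> fixed does not leave \<open>X\<close>.
  Varying \<open>L\<close> and \<open>j\<close> gives \<open>T = complex^('m \<times> 3)\<close>, of dimension \<open>3m > m + 4\<close>
  (\<open>tangent_space_rank_one\<close>).
\<close>

section \<open>Polynomial functions\<close>

lemma polynomial_fun_sum:
  "(\<And>i. i \<in> A \<Longrightarrow> polynomial_fun (f i)) \<Longrightarrow> polynomial_fun (\<lambda>x. \<Sum>i\<in>A. f i x)"
  by (induction A rule: infinite_finite_induct) (auto intro: polynomial_fun.intros)

lemma polynomial_fun_prod:
  "(\<And>i. i \<in> A \<Longrightarrow> polynomial_fun (f i)) \<Longrightarrow> polynomial_fun (\<lambda>x. \<Prod>i\<in>A. f i x)"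
  by (induction A rule: infinite_finite_induct) (auto intro: polynomial_fun.intros)

lemma polynomial_fun_power:
  "polynomial_fun f \<Longrightarrow> polynomial_fun (\<lambda>x. f x ^ n)"
  by (induction n) (auto intro: polynomial_fun.intros)

lemma polynomial_fun_diff:
  assumes "polynomial_fun f" "polynomial_fun g" shows "polynomial_fun (\<lambda>x. f x - g x)"
proof -
  have "polynomial_fun (\<lambda>x. f x + (-1) * g x)"
    using assms by (intro polynomial_fun.intros)
  then show ?thesis by simp
qed

lemmas polynomial_fun_intros =
  polynomial_fun.intros polynomial_fun_sum polynomial_fun_prod polynomial_fun_power
  polynomial_fun_diff

lemma polynomial_fun_compose:
  assumes "polynomial_fun f" and "\<And>k. polynomial_fun (\<lambda>a. \<Phi> a $ k)"
  shows "polynomial_fun (\<lambda>a. f (\<Phi> a))"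
  using assms(1) by induction (auto intro: polynomial_fun.intros assms(2))

lemma polynomial_fun_on_line:
  assumes "polynomial_fun f"
  shows "\<exists>p :: complex poly. \<forall>t. f (a + t *s v) = poly p t"
  using assms
proof induction
  case (const c)
  show ?case by (rule exI[of _ "[:c:]"]) simp
next
  case (coordinate k)
  show ?case by (rule exI[of _ "[:a $ k, v $ k:]"]) simp
next
  case (add f g)
  then obtain p q where "\<forall>t. f (a + t *s v) = poly p t" "\<forall>t. g (a + t *s v) = poly q t" by blast
  then show ?case by (intro exI[of _ "p + q"]) simp
next
  case (mult f g)
  then obtain p q where "\<forall>t. f (a + t *s v) = poly p t" "\<forall>t. g (a + t *s v) = poly q t" by blast
  then show ?case by (intro exI[of _ "p * q"]) simp
qed

text \<open>
  Restricted to the line through \<open>a\<close> and \<open>b\<close>, both functions become nonzero polynomials in one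
  variable, and their product has only finitely many roots.
\<close>

lemma polynomial_fun_no_zero_divisors:
  assumes f: "polynomial_fun f" and g: "polynomial_fun g"
    and a: "f a \<noteq> 0" and b: "g b \<noteq> 0"
  obtains x where "f x \<noteq> 0" "g x \<noteq> 0"
proof -
  obtain p where p: "\<And>t. f (a + t *s (b - a)) = poly p t"
    using polynomial_fun_on_line[OF f] by metis
  obtain q where q: "\<And>t. g (a + t *s (b - a)) = poly q t"
    using polynomial_fun_on_line[OF g] by metis
  have "poly p 0 \<noteq> 0" "poly q 1 \<noteq> 0"
    using p[of 0] q[of 1] a b by auto
  then have "p * q \<noteq> 0" by auto
  then have "finite {t. poly (p * q) t = 0}" by (rule poly_roots_finite)
  then obtain t where "poly (p * q) t \<noteq> 0"
    by (metis (mono_tags, lifting) UNIV_eq_I infinite_UNIV_char_0 mem_Collect_eq)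
  with p q that show ?thesis by (metis mult_zero_left mult_zero_right poly_mult)
qed

lemma polynomial_fun_cancel:
  assumes "polynomial_fun f" "polynomial_fun g" "g b \<noteq> 0" "\<And>x. f x * g x = 0"
  shows "f x = 0"
  using polynomial_fun_no_zero_divisors[OF assms(1,2) _ assms(3)] assms(4)
  by (metis mult_eq_0_iff)

lemma polynomial_fun_common_nonzero:
  assumes "finite A" "\<And>i. i \<in> A \<Longrightarrow> polynomial_fun (f i)" "\<And>i. i \<in> A \<Longrightarrow> \<exists>a. f i a \<noteq> 0"
  shows "\<exists>x. \<forall>i\<in>A. f i x \<noteq> 0"
  using assms
proof (induction A)
  case (insert j A)
  then obtain y a where y: "\<forall>i\<in>A. f i y \<noteq> 0" and a: "f j a \<noteq> 0" by (metis insertCI)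
  obtain x where "f j x \<noteq> 0" "(\<Prod>i\<in>A. f i x) \<noteq> 0"
    by (rule polynomial_fun_no_zero_divisors[of "f j" "\<lambda>x. \<Prod>i\<in>A. f i x" a y])
      (use insert y a in \<open>auto intro: polynomial_fun_prod\<close>)
  with insert(1) show ?case by auto
qed auto

section \<open>Gradients\<close>

text \<open>
  The polynomials \<open>g k\<close> are the partial derivatives; characterising them by the chain rule along
  arbitrary curves lets the induction over \<open>polynomial_fun\<close> go through without computing them.
\<close>

lemma polynomial_fun_chain_rule:
  assumes "polynomial_fun f"
  shows "\<exists>g. (\<forall>k. polynomial_fun (g k)) \<and>
    (\<forall>\<gamma> \<gamma>' z. (\<forall>k. ((\<lambda>t. \<gamma> t $ k) has_field_derivative \<gamma>' $ k) (at z)) \<longrightarrow>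
       ((\<lambda>t. f (\<gamma> t)) has_field_derivative (\<Sum>k\<in>UNIV. g k (\<gamma> z) * \<gamma>' $ k)) (at z))"
  using assms
proof induction
  case (const c)
  show ?case by (rule exI[of _ "\<lambda>k x. 0"]) (auto intro: polynomial_fun.intros)
next
  case (coordinate j)
  have "(\<Sum>k\<in>UNIV. (if k = j then 1 else 0) * y $ k) = y $ j" for y :: "complex^'a"
    by (simp add: if_distrib[of "\<lambda>x. x * _"] cong: if_cong)
  then show ?case
    by (intro exI[of _ "\<lambda>k x. if k = j then 1 else 0"]) (auto intro: polynomial_fun.intros)
next
  case (add f1 f2)
  then obtain g1 g2 where g: "\<forall>k. polynomial_fun (g1 k)" "\<forall>k. polynomial_fun (g2 k)"
    and d: "\<forall>\<gamma> \<gamma>' z. (\<forall>k. ((\<lambda>t. \<gamma> t $ k) has_field_derivative \<gamma>' $ k) (at z)) \<longrightarrow>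
       ((\<lambda>t. f1 (\<gamma> t)) has_field_derivative (\<Sum>k\<in>UNIV. g1 k (\<gamma> z) * \<gamma>' $ k)) (at z)"
      "\<forall>\<gamma> \<gamma>' z. (\<forall>k. ((\<lambda>t. \<gamma> t $ k) has_field_derivative \<gamma>' $ k) (at z)) \<longrightarrow>
       ((\<lambda>t. f2 (\<gamma> t)) has_field_derivative (\<Sum>k\<in>UNIV. g2 k (\<gamma> z) * \<gamma>' $ k)) (at z)"
    by blast
  show ?case
  proof (intro exI[of _ "\<lambda>k x. g1 k x + g2 k x"] conjI allI impI)
    show "polynomial_fun (\<lambda>x. g1 k x + g2 k x)" for k
      using g by (auto intro: polynomial_fun.intros)
    fix \<gamma> :: "complex \<Rightarrow> complex^'a" and \<gamma>' z
    assume "\<forall>k. ((\<lambda>t. \<gamma> t $ k) has_field_derivative \<gamma>' $ k) (at z)"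
    with d have "((\<lambda>t. f1 (\<gamma> t) + f2 (\<gamma> t)) has_field_derivative
        (\<Sum>k\<in>UNIV. g1 k (\<gamma> z) * \<gamma>' $ k) + (\<Sum>k\<in>UNIV. g2 k (\<gamma> z) * \<gamma>' $ k)) (at z)"
      by (intro DERIV_add) blast+
    then show "((\<lambda>t. f1 (\<gamma> t) + f2 (\<gamma> t)) has_field_derivative
        (\<Sum>k\<in>UNIV. (g1 k (\<gamma> z) + g2 k (\<gamma> z)) * \<gamma>' $ k)) (at z)"
      by (simp add: algebra_simps sum.distrib)
  qed
next
  case (mult f1 f2)
  then obtain g1 g2 where g: "\<forall>k. polynomial_fun (g1 k)" "\<forall>k. polynomial_fun (g2 k)"
    and d: "\<forall>\<gamma> \<gamma>' z. (\<forall>k. ((\<lambda>t. \<gamma> t $ k) has_field_derivative \<gamma>' $ k) (at z)) \<longrightarrow>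
       ((\<lambda>t. f1 (\<gamma> t)) has_field_derivative (\<Sum>k\<in>UNIV. g1 k (\<gamma> z) * \<gamma>' $ k)) (at z)"
      "\<forall>\<gamma> \<gamma>' z. (\<forall>k. ((\<lambda>t. \<gamma> t $ k) has_field_derivative \<gamma>' $ k) (at z)) \<longrightarrow>
       ((\<lambda>t. f2 (\<gamma> t)) has_field_derivative (\<Sum>k\<in>UNIV. g2 k (\<gamma> z) * \<gamma>' $ k)) (at z)"
    by blast
  show ?case
  proof (intro exI[of _ "\<lambda>k x. g1 k x * f2 x + f1 x * g2 k x"] conjI allI impI)
    show "polynomial_fun (\<lambda>x. g1 k x * f2 x + f1 x * g2 k x)" for k
      using g mult.hyps by (intro polynomial_fun.add polynomial_fun.mult) auto
    fix \<gamma> :: "complex \<Rightarrow> complex^'a" and \<gamma>' z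
    assume "\<forall>k. ((\<lambda>t. \<gamma> t $ k) has_field_derivative \<gamma>' $ k) (at z)"
    with d have "((\<lambda>t. f1 (\<gamma> t) * f2 (\<gamma> t)) has_field_derivative
        (\<Sum>k\<in>UNIV. g1 k (\<gamma> z) * \<gamma>' $ k) * f2 (\<gamma> z) + (\<Sum>k\<in>UNIV. g2 k (\<gamma> z) * \<gamma>' $ k) * f1 (\<gamma> z)) (at z)"
      by (intro DERIV_mult) blast+
    then show "((\<lambda>t. f1 (\<gamma> t) * f2 (\<gamma> t)) has_field_derivative
        (\<Sum>k\<in>UNIV. (g1 k (\<gamma> z) * f2 (\<gamma> z) + f1 (\<gamma> z) * g2 k (\<gamma> z)) * \<gamma>' $ k)) (at z)"
      by (simp add: algebra_simps sum.distrib sum_distrib_left sum_distrib_right)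
  qed
qed

definition gradient :: "(complex^'k::finite \<Rightarrow> complex) \<Rightarrow> 'k \<Rightarrow> complex^'k \<Rightarrow> complex" where
  "gradient f k x = deriv (\<lambda>t. f (x + t *s axis k 1)) 0"

lemma gradient_props:
  assumes "polynomial_fun f"
  shows polynomial_fun_gradient: "polynomial_fun (gradient f k)"
    and has_field_derivative_gradient:
     "(\<And>k. ((\<lambda>t. \<gamma> t $ k) has_field_derivative \<gamma>' $ k) (at z)) \<Longrightarrow>
       ((\<lambda>t. f (\<gamma> t)) has_field_derivative (\<Sum>k\<in>UNIV. gradient f k (\<gamma> z) * \<gamma>' $ k)) (at z)"
proof -
  obtain g where g: "\<And>k. polynomial_fun (g k)"
    and d: "\<And>\<gamma> \<gamma>' z. (\<And>k. ((\<lambda>t. \<gamma> t $ k) has_field_derivative \<gamma>' $ k) (at z)) \<Longrightarrow>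
       ((\<lambda>t. f (\<gamma> t)) has_field_derivative (\<Sum>k\<in>UNIV. g k (\<gamma> z) * \<gamma>' $ k)) (at z)"
    using polynomial_fun_chain_rule[OF assms] by blast
  have *: "gradient f k x = g k x" for k x
  proof -
    have "((\<lambda>t. f (x + t *s axis k 1)) has_field_derivative
       (\<Sum>j\<in>UNIV. g j (x + 0 *s axis k 1) * axis k 1 $ j)) (at 0)"
      by (rule d) (auto intro!: derivative_eq_intros)
    then have "gradient f k x = (\<Sum>j\<in>UNIV. g j x * axis k 1 $ j)"
      unfolding gradient_def by (auto dest: DERIV_imp_deriv)
    also have "\<dots> = (\<Sum>j\<in>UNIV. if j = k then g j x else 0)"
      by (intro sum.cong) (auto simp: axis_def)
    finally show ?thesis by simp
  qed
  then have **: "gradient f = g" by blast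
  show "polynomial_fun (gradient f k)" using g ** by simp
  show "((\<lambda>t. f (\<gamma> t)) has_field_derivative (\<Sum>k\<in>UNIV. gradient f k (\<gamma> z) * \<gamma>' $ k)) (at z)"
    if "\<And>k. ((\<lambda>t. \<gamma> t $ k) has_field_derivative \<gamma>' $ k) (at z)"
    using d[OF that] ** by simp
qed

lemma deriv_eq_gradient:
  assumes "polynomial_fun f"
  shows "deriv (\<lambda>t. f (x + t *s v)) 0 = (\<Sum>k\<in>UNIV. gradient f k x * v $ k)"
proof -
  have "((\<lambda>t. f (x + t *s v)) has_field_derivative
       (\<Sum>k\<in>UNIV. gradient f k (x + 0 *s v) * v $ k)) (at 0)"
    by (rule has_field_derivative_gradient[OF assms]) (auto intro!: derivative_eq_intros)
  then show ?thesis by (auto dest: DERIV_imp_deriv)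
qed

section \<open>Polynomial functions of bounded degree\<close>

interpretation fun_space: vector_space "\<lambda>c f x. c * f x :: complex"
  by standard (auto simp: fun_eq_iff algebra_simps)

text \<open>
  The degree is bounded in each variable separately, so that the exponent functions form a
  product of intervals and are easy to count.
\<close>

definition bounded_monomials :: "nat \<Rightarrow> (complex^'k::finite \<Rightarrow> complex) set" where
  "bounded_monomials n = (\<lambda>e x. \<Prod>k\<in>UNIV. x $ k ^ e k) ` {e. \<forall>k. e k \<le> n}"

lemma bounded_exponents: "{e :: 'k::finite \<Rightarrow> nat. \<forall>k. e k \<le> n} = PiE UNIV (\<lambda>_. {..n})"
  by (auto simp: PiE_def)

lemma card_bounded_monomials:
  "finite (bounded_monomials n :: (complex^'k::finite \<Rightarrow> complex) set)"
  "card (bounded_monomials n :: (complex^'k::finite \<Rightarrow> complex) set) \<le> (n + 1) ^ CARD('k)"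
proof -
  have *: "finite {e :: 'k \<Rightarrow> nat. \<forall>k. e k \<le> n}" "card {e :: 'k \<Rightarrow> nat. \<forall>k. e k \<le> n} = (n + 1) ^ CARD('k)"
    unfolding bounded_exponents by (auto simp: card_PiE intro: finite_PiE)
  show "finite (bounded_monomials n :: (complex^'k \<Rightarrow> complex) set)"
    unfolding bounded_monomials_def using * by blast
  show "card (bounded_monomials n :: (complex^'k \<Rightarrow> complex) set) \<le> (n + 1) ^ CARD('k)"
    unfolding bounded_monomials_def using card_image_le[OF *(1)] * by metis
qed

definition degree_le :: "nat \<Rightarrow> (complex^'k::finite \<Rightarrow> complex) \<Rightarrow> bool" where
  "degree_le n f \<longleftrightarrow> f \<in> fun_space.span (bounded_monomials n)"

lemma degree_le_add: "degree_le n f \<Longrightarrow> degree_le n g \<Longrightarrow> degree_le n (\<lambda>x. f x + g x)"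
  unfolding degree_le_def using fun_space.span_add[of f _ g] by (simp add: plus_fun_def)

lemma degree_le_mult:
  assumes f: "degree_le m f" and g: "degree_le n g"
  shows "degree_le (m + n) (\<lambda>x. f x * g x)"
proof -
  let ?S = "\<lambda>n. fun_space.span (bounded_monomials n)"
  have mono: "(\<lambda>x. a x * b x) \<in> bounded_monomials (m + n)"
    if a: "a \<in> bounded_monomials m" and b: "b \<in> bounded_monomials n"
    for a b :: "complex^'a \<Rightarrow> complex"
  proof -
    obtain d where d: "a = (\<lambda>x. \<Prod>k\<in>UNIV. x $ k ^ d k)" "\<forall>k. d k \<le> m"
      using a unfolding bounded_monomials_def by blast
    obtain e where e: "b = (\<lambda>x. \<Prod>k\<in>UNIV. x $ k ^ e k)" "\<forall>k. e k \<le> n"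
      using b unfolding bounded_monomials_def by blast
    show ?thesis unfolding bounded_monomials_def
      by (rule image_eqI[of _ _ "\<lambda>k. d k + e k"])
        (use d e in \<open>auto simp: power_add prod.distrib add_mono\<close>)
  qed
  have *: "(\<lambda>x. a x * g x) \<in> ?S (m + n)" if a: "a \<in> bounded_monomials m" for a
    using g unfolding degree_le_def
  proof (induction rule: fun_space.span_induct_alt)
    case base
    show ?case using fun_space.span_zero by (simp add: zero_fun_def)
  next
    case (step c b y)
    have "(\<lambda>x. c * (a x * b x)) + (\<lambda>x. a x * y x) \<in> ?S (m + n)"
      by (rule fun_space.span_add[OF fun_space.span_scale[OF fun_space.span_base[OF mono[OF a step(1)]]] step(2)])
    then show ?case by (simp add: plus_fun_def algebra_simps)
  qed
  show ?thesis
    using f unfolding degree_le_def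
  proof (induction rule: fun_space.span_induct_alt)
    case base
    show ?case using fun_space.span_zero by (simp add: zero_fun_def)
  next
    case (step c a y)
    have "(\<lambda>x. c * (a x * g x)) + (\<lambda>x. y x * g x) \<in> ?S (m + n)"
      by (rule fun_space.span_add[OF fun_space.span_scale[OF *[OF step(1)]] step(2)])
    then show ?case by (simp add: plus_fun_def algebra_simps)
  qed
qed

lemma bounded_monomials_mono: "m \<le> n \<Longrightarrow> bounded_monomials m \<subseteq> bounded_monomials n"
  unfolding bounded_monomials_def by (intro image_mono) (auto intro: order_trans)

lemma degree_le_mono: "degree_le m f \<Longrightarrow> m \<le> n \<Longrightarrow> degree_le n f"
  unfolding degree_le_def using bounded_monomials_mono fun_space.span_mono by blast

lemma degree_le_const: "degree_le n (\<lambda>x. c)"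
proof -
  have "(\<lambda>x. 1) \<in> bounded_monomials n"
    unfolding bounded_monomials_def by (rule image_eqI[of _ _ "\<lambda>_. 0"]) auto
  then show ?thesis
    unfolding degree_le_def using fun_space.span_scale[OF fun_space.span_base, of "\<lambda>x. 1" _ c] by simp
qed

lemma degree_le_power: "degree_le n f \<Longrightarrow> degree_le (j * n) (\<lambda>x. f x ^ j)"
  by (induction j) (auto intro: degree_le_const degree_le_mult)

lemma polynomial_fun_degree_le:
  assumes "polynomial_fun f" obtains n where "degree_le n f"
proof -
  have "\<exists>n. degree_le n f" using assms
  proof induction
    case (coordinate k)
    have "(\<lambda>x. x $ k) \<in> bounded_monomials 1" unfolding bounded_monomials_def
    proof (rule image_eqI[of _ _ "\<lambda>j. if j = k then 1 else 0"])
      have "(\<Prod>j\<in>UNIV. x $ j ^ (if j = k then 1 else 0)) = (\<Prod>j\<in>UNIV. if j = k then x $ j else 1)" for x :: "complex^'a"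
        by (intro prod.cong) auto
      then have P: "(\<Prod>j\<in>UNIV. x $ j ^ (if j = k then 1 else 0)) = x $ k" for x :: "complex^'a"
        using prod.delta[of UNIV k "\<lambda>j. x $ j" for x :: "complex^'a"] by simp
      then show "(\<lambda>x :: complex^'a. x $ k) = (\<lambda>x. \<Prod>j\<in>UNIV. x $ j ^ (if j = k then 1 else 0))"
        by (intro ext) (rule P[symmetric])
    qed auto
    then show ?case unfolding degree_le_def using fun_space.span_base by blast
  next
    case (add f g)
    then obtain m n where "degree_le m f" "degree_le n g" by blast
    then have "degree_le (max m n) f" "degree_le (max m n) g"
      by (auto intro: degree_le_mono)
    then show ?case using degree_le_add by blast
  qed (use degree_le_const degree_le_mult in blast)+
  then show ?thesis using that by blast
qed

text \<open>
  There are at most \<open>(n + 1) ^ CARD('k)\<close> monomials, so a longer family in their span is dependent; a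
  family that repeats a function is dependent for that reason.
\<close>

lemma degree_le_linear_dependence:
  fixes h :: "'i \<Rightarrow> complex^'k::finite \<Rightarrow> complex"
  assumes "finite A" "\<And>a. a \<in> A \<Longrightarrow> degree_le n (h a)" "(n + 1) ^ CARD('k) < card A"
  obtains c where "\<And>x. (\<Sum>a\<in>A. c a * h a x) = 0" "\<exists>a\<in>A. c a \<noteq> 0"
proof (cases "inj_on h A")
  case True
  have "fun_space.dependent (h ` A)"
  proof (rule ccontr)
    assume "fun_space.independent (h ` A)"
    moreover have "h ` A \<subseteq> fun_space.span (bounded_monomials n)"
      using assms(2) by (auto simp: degree_le_def)
    ultimately have "card (h ` A) \<le> card (bounded_monomials n :: (complex^'k \<Rightarrow> complex) set)"
      using fun_space.independent_span_bound card_bounded_monomials(1) by blast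
    also have "\<dots> \<le> (n + 1) ^ CARD('k)" by (rule card_bounded_monomials)
    finally show False using assms(3) card_image[OF True] by simp
  qed
  then obtain u where u: "(\<Sum>v\<in>h ` A. (\<lambda>x. u v * v x)) = 0" "\<exists>v\<in>h ` A. u v \<noteq> 0"
    using assms(1) by (auto simp: fun_space.dependent_finite)
  have "(\<Sum>a\<in>A. u (h a) * h a x) = 0" for x
  proof -
    have app: "(\<Sum>v\<in>B. F v) x = (\<Sum>v\<in>B. F v x)" for B and F :: "(complex^'k \<Rightarrow> complex) \<Rightarrow> complex^'k \<Rightarrow> complex"
      by (induction B rule: infinite_finite_induct) auto
    have "(\<Sum>v\<in>h ` A. u v * v x) = 0"
      using fun_cong[OF u(1), of x] unfolding app by simp
    then show ?thesis using True by (simp add: sum.reindex)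
  qed
  then show ?thesis using that[of "\<lambda>a. u (h a)"] u(2) by auto
next
  case False
  then obtain a b where ab: "a \<in> A" "b \<in> A" "a \<noteq> b" "h a = h b" by (auto simp: inj_on_def)
  define c where "c = (\<lambda>i. if i = a then 1 else if i = b then -1 else 0 :: complex)"
  have "(\<Sum>i\<in>A. c i * h i x) = 0" for x
  proof -
    have "(\<Sum>i\<in>A. c i * h i x) = (\<Sum>i\<in>{a, b}. c i * h i x)"
      using assms(1) ab by (intro sum.mono_neutral_right) (auto simp: c_def)
    also have "\<dots> = 0" using ab by (simp add: c_def)
    finally show ?thesis .
  qed
  moreover have "c a \<noteq> 0" by (simp add: c_def)
  ultimately show ?thesis using that[of c] ab(1) by blast
qed

section \<open>Points, forms and closed sets\<close>

definition block :: "'m \<Rightarrow> complex^('m::finite \<times> 'n::finite) \<Rightarrow> complex^'n" where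
  "block i x = (\<chi> j. x $ (i, j))"

definition point_of :: "complex^('m::finite \<times> 'n::finite) \<Rightarrow> ('m \<Rightarrow> 'n proj)" where
  "point_of x = (\<lambda>i. abs_proj (block i x))"

text \<open>
  A multihomogeneous polynomial with its multidegree made explicit; forms of the same multidegree
  can be added.  The zero polynomial has every multidegree.
\<close>

definition multiform :: "('m \<Rightarrow> nat) \<Rightarrow> (complex^('m::finite \<times> 'n::finite) \<Rightarrow> complex) \<Rightarrow> bool" where
  "multiform d f \<longleftrightarrow> polynomial_fun f \<and> (\<forall>t x. f (scale_blocks t x) = (\<Prod>i\<in>UNIV. t i ^ d i) * f x)"

lemma multihomogeneous_iff: "multihomogeneous f \<longleftrightarrow> (\<exists>d. multiform d f)"
  by (auto simp: multihomogeneous_def multiform_def)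

lemma multiform_polynomial: "multiform d f \<Longrightarrow> polynomial_fun f"
  by (simp add: multiform_def)

lemma multiform_scale: "multiform d f \<Longrightarrow> f (scale_blocks t x) = (\<Prod>i\<in>UNIV. t i ^ d i) * f x"
  by (simp add: multiform_def)

lemma scale_blocks_nth [simp]: "scale_blocks t x $ k = t (fst k) * x $ k"
  by (simp add: scale_blocks_def)

lemma block_nth [simp]: "block i x $ j = x $ (i, j)"
  by (simp add: block_def)

lemma block_scale_blocks: "block i (scale_blocks t x) = t i *s block i x"
  by (simp add: vec_eq_iff)

lemma multiform_const: "multiform (\<lambda>_. 0) (\<lambda>x. c)"
  by (auto simp: multiform_def intro: polynomial_fun.intros)

lemma multiform_add: "multiform d f \<Longrightarrow> multiform d g \<Longrightarrow> multiform d (\<lambda>x. f x + g x)"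
  by (auto simp: multiform_def distrib_left intro: polynomial_fun.add)

lemma multiform_cmult: "multiform d f \<Longrightarrow> multiform d (\<lambda>x. c * f x)"
  by (auto simp: multiform_def intro: polynomial_fun.mult polynomial_fun.const)

lemma multiform_mult:
  assumes "multiform d f" "multiform e g" shows "multiform (\<lambda>i. d i + e i) (\<lambda>x. f x * g x)"
  using assms by (auto simp: multiform_def power_add prod.distrib intro: polynomial_fun.mult)

lemma multiform_zero: "multiform d (\<lambda>x. 0)"
  by (auto simp: multiform_def intro: polynomial_fun.const)

lemma multiform_sum:
  "(\<And>a. a \<in> A \<Longrightarrow> multiform d (f a)) \<Longrightarrow> multiform d (\<lambda>x. \<Sum>a\<in>A. f a x)"
  by (induction A rule: infinite_finite_induct) (auto intro: multiform_zero multiform_add)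

lemma multiform_power: "multiform d f \<Longrightarrow> multiform (\<lambda>i. n * d i) (\<lambda>x. f x ^ n)"
  by (induction n) (auto intro: multiform_const multiform_mult)

lemma multiform_coordinate: "multiform (\<lambda>j. if j = fst k then 1 else 0) (\<lambda>x. x $ k)"
proof -
  have "(\<Prod>i\<in>UNIV. t i ^ (if i = fst k then 1 else 0)) = t (fst k)" for t :: "'a \<Rightarrow> complex"
  proof -
    have "(\<Prod>i\<in>UNIV. t i ^ (if i = fst k then 1 else 0)) = (\<Prod>i\<in>UNIV. if i = fst k then t i else 1)"
      by (intro prod.cong) auto
    then show ?thesis by simp
  qed
  then show ?thesis by (auto simp: multiform_def intro: polynomial_fun.coordinate)
qed

lemma multiform_coordinate_powers:
  fixes \<kappa> :: "'m::finite \<Rightarrow> 'n::finite"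
  shows "multiform e (\<lambda>x. \<Prod>i\<in>UNIV. x $ (i, \<kappa> i) ^ e i)"
  by (auto simp: multiform_def power_mult_distrib prod.distrib intro!: polynomial_fun_intros)

lemma rep_proj_nonzero: "rep_proj l \<noteq> 0"
  using Quotient3_rep_reflp[OF Quotient3_proj, of l] by (auto simp: proj_rel_def)

lemma abs_rep_proj: "abs_proj (rep_proj l) = l"
  by (rule Quotient3_abs_rep[OF Quotient3_proj])

lemma abs_proj_eqI:
  assumes "v \<noteq> 0" "c \<noteq> 0" shows "abs_proj (c *s v) = abs_proj v"
proof -
  have "proj_rel v (c *s v)" using assms by (auto simp: proj_rel_def)
  then show ?thesis by (metis Quotient3_rel Quotient3_proj)
qed

lemma rep_abs_proj:
  assumes "v \<noteq> 0" obtains c where "c \<noteq> 0" "rep_proj (abs_proj v) = c *s v"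
proof -
  have "proj_rel v v" using assms by (auto simp: proj_rel_def intro: exI[of _ 1])
  then have "proj_rel v (rep_proj (abs_proj v))"
    using Quotient3_rel[OF Quotient3_proj, of v "rep_proj (abs_proj v)"]
      Quotient3_rep_reflp[OF Quotient3_proj, of "abs_proj v"] by (simp add: abs_rep_proj)
  then show ?thesis using that by (auto simp: proj_rel_def)
qed

lemma block_hom_coords [simp]: "block i (hom_coords p) = rep_proj (p i)"
  by (simp add: vec_eq_iff hom_coords_def)

lemma hom_coords_point_of:
  assumes "\<And>i. block i x \<noteq> 0"
  obtains s where "\<And>i. s i \<noteq> 0" "hom_coords (point_of x) = scale_blocks s x"
proof -
  have "\<exists>c. c \<noteq> 0 \<and> rep_proj (abs_proj (block i x)) = c *s block i x" for i
    using rep_abs_proj[OF assms] by metis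
  then obtain s where s: "\<And>i. s i \<noteq> 0" "\<And>i. rep_proj (abs_proj (block i x)) = s i *s block i x"
    by metis
  then have "hom_coords (point_of x) = scale_blocks s x"
    by (simp add: vec_eq_iff hom_coords_def point_of_def)
  with s that show ?thesis by blast
qed

lemma multihomogeneous_at_point_of:
  assumes "\<And>i. block i x \<noteq> 0" "multihomogeneous f"
  shows "f (hom_coords (point_of x)) = 0 \<longleftrightarrow> f x = 0"
proof -
  obtain s where s: "\<And>i. s i \<noteq> 0" "hom_coords (point_of x) = scale_blocks s x"
    using hom_coords_point_of[OF assms(1)] by blast
  with assms(2) show ?thesis by (auto simp: multihomogeneous_iff multiform_def)
qed

lemma nonvanishing_coordinates:
  assumes "\<And>i. block i x \<noteq> 0"
  obtains \<kappa> where "\<And>i. x $ (i, \<kappa> i) \<noteq> 0"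
proof -
  have "\<forall>i. \<exists>j. x $ (i, j) \<noteq> 0"
    using assms by (metis block_nth vec_eq_iff zero_index)
  then show ?thesis using that by metis
qed

text \<open>
  The zero set of a single form is closed, and the closure is the zero set of all forms that vanish
  on \<open>A\<close>.
\<close>

lemma mem_zariski_closure:
  "p \<in> zariski_closure A \<longleftrightarrow>
     (\<forall>f. multihomogeneous f \<longrightarrow> (\<forall>q\<in>A. f (hom_coords q) = 0) \<longrightarrow> f (hom_coords p) = 0)"
proof
  assume p: "p \<in> zariski_closure A"
  show "\<forall>f. multihomogeneous f \<longrightarrow> (\<forall>q\<in>A. f (hom_coords q) = 0) \<longrightarrow> f (hom_coords p) = 0"
  proof (intro allI impI)
    fix f assume f: "multihomogeneous f" "\<forall>q\<in>A. f (hom_coords q) = 0"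
    then have "zariski_closed {q. f (hom_coords q) = 0}"
      unfolding zariski_closed_def by (intro exI[of _ "{f}"]) auto
    with f p show "f (hom_coords p) = 0" unfolding hull_def by blast
  qed
qed (auto simp: hull_def zariski_closed_def)

lemma zariski_closed_closure: "zariski_closed (zariski_closure A)"
  by (subst zariski_closed_def,
      rule exI[of _ "{f. multihomogeneous f \<and> (\<forall>q\<in>A. f (hom_coords q) = 0)}"])
    (auto simp: mem_zariski_closure)

lemma zariski_closed_Int_vanishing:
  assumes "zariski_closed Z" "multihomogeneous f"
  shows "zariski_closed {q \<in> Z. f (hom_coords q) = 0}"
proof -
  obtain F where F: "\<forall>f\<in>F. multihomogeneous f" "Z = {p. \<forall>f\<in>F. f (hom_coords p) = 0}"
    using assms(1) unfolding zariski_closed_def by blast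
  with assms(2) show ?thesis
    unfolding zariski_closed_def by (intro exI[of _ "insert f F"]) auto
qed

lemma zariski_closed_separate:
  assumes "zariski_closed Z" "q \<notin> Z"
  obtains f where "multihomogeneous f" "\<And>p. p \<in> Z \<Longrightarrow> f (hom_coords p) = 0" "f (hom_coords q) \<noteq> 0"
  using assms unfolding zariski_closed_def by blast

text \<open>
  The zero loci of \<open>f\<close> and \<open>g\<close> cut \<open>Z\<close> into two closed pieces, one of which must be \<open>Z\<close> itself.
\<close>

lemma irreducible_closed_no_zero_divisors:
  assumes Z: "irreducible_closed Z" and fg: "multihomogeneous f" "multihomogeneous g"
    and 0: "\<And>q. q \<in> Z \<Longrightarrow> f (hom_coords q) * g (hom_coords q) = 0"
    and q: "q \<in> Z" "f (hom_coords q) \<noteq> 0" and p: "p \<in> Z"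
  shows "g (hom_coords p) = 0"
proof -
  have "Z = {q \<in> Z. f (hom_coords q) = 0} \<union> {q \<in> Z. g (hom_coords q) = 0}"
    using 0 by auto
  moreover have "zariski_closed {q \<in> Z. f (hom_coords q) = 0}" "zariski_closed {q \<in> Z. g (hom_coords q) = 0}"
    using Z fg by (auto simp: irreducible_closed_def intro: zariski_closed_Int_vanishing)
  ultimately have "Z = {q \<in> Z. f (hom_coords q) = 0} \<or> Z = {q \<in> Z. g (hom_coords q) = 0}"
    using Z unfolding irreducible_closed_def by blast
  then show ?thesis using p q by blast
qed

section \<open>Closures of polynomially parametrised families\<close>

definition polynomial_map :: "(complex^'p::finite \<Rightarrow> complex^'k::finite) \<Rightarrow> bool" where
  "polynomial_map \<Phi> \<longleftrightarrow> (\<forall>k. polynomial_fun (\<lambda>a. \<Phi> a $ k))"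

lemma polynomial_map_component: "polynomial_map \<Phi> \<Longrightarrow> polynomial_fun (\<lambda>a. \<Phi> a $ k)"
  unfolding polynomial_map_def by blast

text \<open>
  A parameter whose image has a vanishing block does not define a point of the product of projective
  spaces, so such parameters are left out.
\<close>

definition param_variety ::
  "(complex^'p::finite \<Rightarrow> complex^('m::finite \<times> 'n::finite)) \<Rightarrow> ('m \<Rightarrow> 'n proj) set" where
  "param_variety \<Phi> = zariski_closure {point_of (\<Phi> a) | a. \<forall>i. block i (\<Phi> a) \<noteq> 0}"

text \<open>
  The product of one suitable coordinate from each block is a polynomial \<open>u\<close> in the parameter that is
  not identically zero and vanishes wherever some block does.  Hence \<open>f (\<Phi> a) * u a\<close> is zero for all \<open>a\<close>
  as soon as \<open>f\<close> vanishes on the image, and \<open>u\<close> can be cancelled.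
\<close>

lemma vanishing_on_param_variety:
  assumes \<Phi>: "polynomial_map \<Phi>" and a0: "\<And>i. block i (\<Phi> a0) \<noteq> 0" and f: "multihomogeneous f"
  shows "(\<forall>q\<in>param_variety \<Phi>. f (hom_coords q) = 0) \<longleftrightarrow> (\<forall>a. f (\<Phi> a) = 0)"
proof -
  let ?G = "{point_of (\<Phi> a) | a. \<forall>i. block i (\<Phi> a) \<noteq> 0}"
  have "(\<forall>q\<in>param_variety \<Phi>. f (hom_coords q) = 0) \<longleftrightarrow> (\<forall>q\<in>?G. f (hom_coords q) = 0)"
    using f hull_subset[of ?G zariski_closed] unfolding param_variety_def
    by (auto simp: mem_zariski_closure)
  also have "\<dots> \<longleftrightarrow> (\<forall>a. (\<forall>i. block i (\<Phi> a) \<noteq> 0) \<longrightarrow> f (\<Phi> a) = 0)"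
    using multihomogeneous_at_point_of f by blast
  also have "\<dots> \<longleftrightarrow> (\<forall>a. f (\<Phi> a) = 0)"
  proof safe
    fix a assume *: "\<forall>a. (\<forall>i. block i (\<Phi> a) \<noteq> 0) \<longrightarrow> f (\<Phi> a) = 0"
    obtain \<kappa> where \<kappa>: "\<And>i. \<Phi> a0 $ (i, \<kappa> i) \<noteq> 0"
      using nonvanishing_coordinates[OF a0] by blast
    define u where "u = (\<lambda>a. \<Prod>i\<in>UNIV. \<Phi> a $ (i, \<kappa> i))"
    have "f (\<Phi> a) * u a = 0" for a
    proof (cases "\<forall>i. block i (\<Phi> a) \<noteq> 0")
      case False
      then obtain i where "block i (\<Phi> a) = 0" by blast
      then have "\<Phi> a $ (i, \<kappa> i) = 0" by (metis block_nth zero_index)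
      then have "u a = 0" unfolding u_def by (meson UNIV_I finite prod_zero)
      then show ?thesis by simp
    qed (use * in simp)
    moreover have "polynomial_fun u" "polynomial_fun (\<lambda>a. f (\<Phi> a))"
      using \<Phi> f unfolding u_def polynomial_map_def multihomogeneous_def
      by (auto intro: polynomial_fun_prod polynomial_fun_compose)
    moreover have "u a0 \<noteq> 0" using \<kappa> by (simp add: u_def)
    ultimately show "f (\<Phi> a) = 0" using polynomial_fun_cancel by blast
  qed auto
  finally show ?thesis .
qed

lemma point_of_mem_param_variety:
  "(\<And>i. block i (\<Phi> a) \<noteq> 0) \<Longrightarrow> point_of (\<Phi> a) \<in> param_variety \<Phi>"
  unfolding param_variety_def by (rule hull_inc) blast

text \<open>
  By \<open>vanishing_on_param_variety\<close> a form vanishes on the closure if and only if its pullback is the zero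
  polynomial, and polynomials have no zero divisors.
\<close>

lemma irreducible_param_variety:
  assumes \<Phi>: "polynomial_map \<Phi>" and a0: "\<And>i. block i (\<Phi> a0) \<noteq> 0"
  shows "irreducible_closed (param_variety \<Phi>)"
  unfolding irreducible_closed_def
proof (intro conjI allI impI)
  show closed: "zariski_closed (param_variety \<Phi>)"
    unfolding param_variety_def by (rule zariski_closed_closure)
  show "param_variety \<Phi> \<noteq> {}" using point_of_mem_param_variety[of \<Phi> a0] a0 by blast
  fix A B assume AB: "zariski_closed A" "zariski_closed B" "param_variety \<Phi> = A \<union> B"
  show "param_variety \<Phi> = A \<or> param_variety \<Phi> = B"
  proof (rule ccontr)
    assume "\<not> ?thesis"
    then obtain p q where p: "p \<in> param_variety \<Phi>" "p \<notin> A" and q: "q \<in> param_variety \<Phi>" "q \<notin> B"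
      using AB(3) by blast
    obtain f where f: "multihomogeneous f" "\<And>p. p \<in> A \<Longrightarrow> f (hom_coords p) = 0" "f (hom_coords p) \<noteq> 0"
      using zariski_closed_separate[OF AB(1) p(2)] by blast
    obtain g where g: "multihomogeneous g" "\<And>p. p \<in> B \<Longrightarrow> g (hom_coords p) = 0" "g (hom_coords q) \<noteq> 0"
      using zariski_closed_separate[OF AB(2) q(2)] by blast
    obtain a b where ab: "f (\<Phi> a) \<noteq> 0" "g (\<Phi> b) \<noteq> 0"
      using vanishing_on_param_variety[OF \<Phi> a0] f g p q by metis
    have "multihomogeneous (\<lambda>x. f x * g x)"
      using f(1) g(1) multiform_mult unfolding multihomogeneous_iff by blast
    moreover have "f (hom_coords q) * g (hom_coords q) = 0" if "q \<in> param_variety \<Phi>" for q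
      using that AB(3) f(2) g(2) by auto
    ultimately have "f (\<Phi> a) * g (\<Phi> a) = 0" for a
      using vanishing_on_param_variety[OF \<Phi> a0, of "\<lambda>x. f x * g x"] by blast
    moreover have "polynomial_fun (\<lambda>a. f (\<Phi> a))" "polynomial_fun (\<lambda>a. g (\<Phi> a))"
      using \<Phi> f g unfolding polynomial_map_def multihomogeneous_def
      by (auto intro: polynomial_fun_compose)
    ultimately show False using polynomial_fun_cancel ab by blast
  qed
qed

lemma param_variety_mono:
  assumes "polynomial_map \<Phi>" "\<And>i. block i (\<Phi> a0) \<noteq> 0"
    and "polynomial_map \<Psi>" "\<And>i. block i (\<Psi> b0) \<noteq> 0"
    and vanish: "\<And>f. multihomogeneous f \<Longrightarrow> (\<And>b. f (\<Psi> b) = 0) \<Longrightarrow> (\<And>a. f (\<Phi> a) = 0)"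
  shows "param_variety \<Phi> \<subseteq> param_variety \<Psi>"
proof
  fix p assume p: "p \<in> param_variety \<Phi>"
  show "p \<in> param_variety \<Psi>"
    unfolding param_variety_def mem_zariski_closure
  proof (intro allI impI)
    fix f :: "complex^('b \<times> 'c) \<Rightarrow> complex"
    assume f: "multihomogeneous f"
      "\<forall>q\<in>{point_of (\<Psi> a) | a. \<forall>i. block i (\<Psi> a) \<noteq> 0}. f (hom_coords q) = 0"
    then have "\<forall>q\<in>param_variety \<Psi>. f (hom_coords q) = 0"
      unfolding param_variety_def by (auto simp: mem_zariski_closure)
    then have "\<forall>a. f (\<Psi> a) = 0"
      using vanishing_on_param_variety[OF assms(3,4) f(1)] by blast
    then have "\<forall>a. f (\<Phi> a) = 0" using vanish f(1) by blast
    then show "f (hom_coords p) = 0"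
      using vanishing_on_param_variety[OF assms(1,2) f(1)] p by blast
  qed
qed

section \<open>Dimension\<close>

text \<open>
  For exponents \<open>js = [j\<^sub>r, \<dots>, j\<^sub>1]\<close> this is the product of the \<open>f i ^ j\<^sub>i\<close>, with one
  factor \<open>f 0 ^ (N - j\<^sub>i)\<close> per entry: if the \<open>f i\<close> have equal degrees, so have all products for lists
  of length \<open>r\<close>.
  The index of a form is read off from the length of the remaining list.
\<close>

fun power_product :: "nat \<Rightarrow> (nat \<Rightarrow> 'x \<Rightarrow> complex) \<Rightarrow> nat list \<Rightarrow> 'x \<Rightarrow> complex" where
  "power_product N f [] x = 1"
| "power_product N f (j # js) x =
     power_product N f js x * (f 0 x ^ (N - j) * f (Suc (length js)) x ^ j)"

definition exponent_lists :: "nat \<Rightarrow> nat \<Rightarrow> nat list set" where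
  "exponent_lists N r = {js. set js \<subseteq> {..N} \<and> length js = r}"

lemma exponent_lists_0: "exponent_lists N 0 = {[]}"
  by (auto simp: exponent_lists_def)

lemma exponent_lists_Suc:
  "exponent_lists N (Suc r) = (\<lambda>(j, js). j # js) ` ({..N} \<times> exponent_lists N r)"
  by (auto simp: exponent_lists_def length_Suc_conv image_iff)

lemma finite_exponent_lists: "finite (exponent_lists N r)"
  unfolding exponent_lists_def by (rule finite_lists_length_eq) simp

lemma card_exponent_lists: "card (exponent_lists N r) = (N + 1) ^ r"
  unfolding exponent_lists_def using card_lists_length_eq[of "{..N}" r] by simp

lemma sum_exponent_lists_Suc:
  "(\<Sum>js\<in>exponent_lists N (Suc r). F js) = (\<Sum>j\<le>N. \<Sum>js\<in>exponent_lists N r. F (j # js))"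
proof -
  have "inj_on (\<lambda>(j, js). j # js) ({..N} \<times> exponent_lists N r)" by (auto simp: inj_on_def)
  then show ?thesis
    unfolding exponent_lists_Suc
    by (simp add: sum.reindex sum.cartesian_product case_prod_unfold)
qed

lemma multiform_power_product:
  assumes "\<And>i. i \<le> r \<Longrightarrow> multiform d (f i)" "js \<in> exponent_lists N r"
  shows "multiform (\<lambda>i. r * N * d i) (power_product N f js)"
  using assms
proof (induction r arbitrary: js)
  case 0
  have "power_product N f [] = (\<lambda>x. 1)" by auto
  with 0 show ?case using multiform_const[of 1] by (simp add: exponent_lists_0)
next
  case (Suc r)
  then obtain j ks where js: "js = j # ks" "j \<le> N" "ks \<in> exponent_lists N r"
    by (auto simp: exponent_lists_Suc)
  have len: "length ks = r" using js(3) by (simp add: exponent_lists_def)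
  have "multiform (\<lambda>i. r * N * d i + ((N - j) * d i + j * d i))
     (\<lambda>x. power_product N f ks x * (f 0 x ^ (N - j) * f (Suc (length ks)) x ^ j))"
    using Suc.IH[OF Suc.prems(1) js(3)] Suc.prems(1)[of 0] Suc.prems(1)[of "Suc r"]
    by (auto simp: len intro!: multiform_mult multiform_power)
  moreover have "(\<lambda>i. r * N * d i + ((N - j) * d i + j * d i)) = (\<lambda>i. Suc r * N * d i)"
  proof
    fix i
    have "(N - j) * d i + j * d i = N * d i" using js(2) by (simp flip: add_mult_distrib)
    then show "r * N * d i + ((N - j) * d i + j * d i) = Suc r * N * d i" by (simp add: algebra_simps)
  qed
  moreover have "power_product N f js = (\<lambda>x. power_product N f ks x * (f 0 x ^ (N - j) * f (Suc (length ks)) x ^ j))"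
    using js by auto
  ultimately show ?case by simp
qed

text \<open>
  If \<open>f i\<close> vanishes on \<open>Z (i - 1)\<close> but not on \<open>Z i\<close>, the products of powers of the \<open>f i\<close> are linearly
  independent on the last member of the chain.  In a nontrivial relation, divide by the smallest
  power of the last form that occurs (there are no zero divisors on the irreducible \<open>Z r\<close>) and
  restrict to \<open>Z (r - 1)\<close>: only the terms with that smallest power survive, and they give a nontrivial
  relation one step down the chain.
\<close>

lemma power_products_independent:
  assumes irr: "\<And>i. i \<le> r \<Longrightarrow> irreducible_closed (Z i)" and chain: "\<And>i. i < r \<Longrightarrow> Z i \<subseteq> Z (Suc i)"
    and forms: "\<And>i. i \<le> r \<Longrightarrow> multiform d (f i)"
    and f0: "\<And>i. i \<le> r \<Longrightarrow> \<exists>q\<in>Z i. f 0 (hom_coords q) \<noteq> 0"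
    and vanish: "\<And>i q. i < r \<Longrightarrow> q \<in> Z i \<Longrightarrow> f (Suc i) (hom_coords q) = 0"
    and nonvanish: "\<And>i. i < r \<Longrightarrow> \<exists>q\<in>Z (Suc i). f (Suc i) (hom_coords q) \<noteq> 0"
    and relation: "\<And>q. q \<in> Z r \<Longrightarrow>
      (\<Sum>js\<in>exponent_lists N r. c js * power_product N f js (hom_coords q)) = 0"
  shows "\<forall>js\<in>exponent_lists N r. c js = 0"
  using assms
proof (induction r arbitrary: c)
  case 0
  then show ?case by (auto simp: exponent_lists_0 irreducible_closed_def)
next
  case (Suc r)
  let ?L = "exponent_lists N r"
  show ?case
  proof (rule ccontr)
    assume "\<not> ?case"
    then have ex: "\<exists>j\<le>N. \<exists>js\<in>?L. c (j # js) \<noteq> 0" by (auto simp: exponent_lists_Suc)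
    define j0 where "j0 = (LEAST j. j \<le> N \<and> (\<exists>js\<in>?L. c (j # js) \<noteq> 0))"
    have j0: "j0 \<le> N" "\<exists>js\<in>?L. c (j0 # js) \<noteq> 0"
      using LeastI_ex[OF ex] by (auto simp: j0_def)
    have below: "c (j # js) = 0" if "j < j0" "js \<in> ?L" for j js
      using not_less_Least[OF that(1)[unfolded j0_def]] that j0(1) by auto
    define P where "P = (\<lambda>j x. \<Sum>js\<in>?L. c (j # js) * power_product N f js x)"
    define G where "G = (\<lambda>x. \<Sum>j\<in>{j0..N}. P j x * (f 0 x ^ (N - j) * f (Suc r) x ^ (j - j0)))"
    have P: "multiform (\<lambda>i. r * N * d i) (P j)" for j
      unfolding P_def using Suc.prems(3)
      by (intro multiform_sum multiform_cmult multiform_power_product) auto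
    have "multiform (\<lambda>i. r * N * d i + (N - j0) * d i)
        (\<lambda>x. P j x * (f 0 x ^ (N - j) * f (Suc r) x ^ (j - j0)))" if "j \<in> {j0..N}" for j
    proof -
      have "multiform (\<lambda>i. r * N * d i + ((N - j) * d i + (j - j0) * d i))
        (\<lambda>x. P j x * (f 0 x ^ (N - j) * f (Suc r) x ^ (j - j0)))"
        using Suc.prems(3)[of 0] Suc.prems(3)[of "Suc r"]
        by (intro multiform_mult multiform_power P) auto
      moreover have "(N - j) * d i + (j - j0) * d i = (N - j0) * d i" for i
        using that by (simp flip: add_mult_distrib)
      ultimately show ?thesis by simp
    qed
    then have G: "multihomogeneous G"
      unfolding G_def multihomogeneous_iff
      by (intro exI[of _ "\<lambda>i. r * N * d i + (N - j0) * d i"] multiform_sum)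
    have split: "(\<Sum>js\<in>exponent_lists N (Suc r). c js * power_product N f js x) = f (Suc r) x ^ j0 * G x" for x
    proof -
      have "(\<Sum>js\<in>exponent_lists N (Suc r). c js * power_product N f js x) =
          (\<Sum>j\<le>N. P j x * (f 0 x ^ (N - j) * f (Suc r) x ^ j))"
        unfolding sum_exponent_lists_Suc P_def sum_distrib_right
        by (intro sum.cong refl) (auto simp: exponent_lists_def)
      also have "\<dots> = (\<Sum>j\<in>{j0..N}. P j x * (f 0 x ^ (N - j) * f (Suc r) x ^ j))"
        using below by (intro sum.mono_neutral_right) (auto simp: P_def)
      also have "\<dots> = f (Suc r) x ^ j0 * G x"
        unfolding G_def sum_distrib_left
        by (intro sum.cong refl) (auto simp flip: power_add)
      finally show ?thesis .
    qed
    have fpow: "multihomogeneous (\<lambda>x. f (Suc r) x ^ j0)" "multihomogeneous (\<lambda>x. f 0 x ^ (N - j0))"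
      using multiform_power Suc.prems(3) unfolding multihomogeneous_iff by blast+
    obtain q where q: "q \<in> Z (Suc r)" "f (Suc r) (hom_coords q) \<noteq> 0"
      using Suc.prems(6)[of r] by blast
    have G0: "G (hom_coords p) = 0" if "p \<in> Z (Suc r)" for p
      by (rule irreducible_closed_no_zero_divisors[OF Suc.prems(1) fpow(1) G _ q(1) _ that])
        (use Suc.prems(7) q(2) in \<open>auto simp: split\<close>)
    obtain q' where q': "q' \<in> Z r" "f 0 (hom_coords q') \<noteq> 0"
      using Suc.prems(4)[of r] by auto
    \<comment> \<open>On the previous member of the chain the last form vanishes, so only the summand \<open>j = j0\<close> of \<open>G\<close> is left.\<close>
    have prod0: "f 0 (hom_coords p) ^ (N - j0) * P j0 (hom_coords p) = 0" if p: "p \<in> Z r" for p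
    proof -
      have "G (hom_coords p) = (\<Sum>j\<in>{j0}. P j (hom_coords p) * (f 0 (hom_coords p) ^ (N - j) * f (Suc r) (hom_coords p) ^ (j - j0)))"
        unfolding G_def using j0(1) Suc.prems(5)[of r, OF _ p]
        by (intro sum.mono_neutral_right) auto
      then show ?thesis using G0 p Suc.prems(2)[of r] by auto
    qed
    have "multihomogeneous (P j0)" using P unfolding multihomogeneous_iff by blast
    then have Pj0: "P j0 (hom_coords p) = 0" if "p \<in> Z r" for p
      using irreducible_closed_no_zero_divisors[OF Suc.prems(1) fpow(2) _ prod0 q'(1) _ that] q'(2)
      by simp
    have "\<forall>js\<in>?L. c (j0 # js) = 0"
    proof (rule Suc.IH)
      show "(\<Sum>js\<in>?L. c (j0 # js) * power_product N f js (hom_coords q)) = 0" if "q \<in> Z r" for q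
        using Pj0[OF that] by (simp add: P_def)
      show "f (Suc i) (hom_coords q) = 0" if "i < r" "q \<in> Z i" for i q
        using Suc.prems(5) that by simp
    qed (use Suc.prems(1-4,6) in simp_all)
    with j0(2) show False by blast
  qed
qed

lemma degree_le_power_product:
  assumes "\<And>i. i \<le> r \<Longrightarrow> degree_le E (g i)" "js \<in> exponent_lists N r"
  shows "degree_le (r * N * E) (power_product N g js)"
  using assms
proof (induction r arbitrary: js)
  case 0
  have "power_product N g [] = (\<lambda>x. 1)" by auto
  with 0 show ?case using degree_le_const[of 0 1] by (simp add: exponent_lists_0)
next
  case (Suc r)
  then obtain j ks where js: "js = j # ks" "j \<le> N" "ks \<in> exponent_lists N r"
    by (auto simp: exponent_lists_Suc)
  have len: "length ks = r" using js(3) by (simp add: exponent_lists_def)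
  have "degree_le (r * N * E + ((N - j) * E + j * E))
     (\<lambda>x. power_product N g ks x * (g 0 x ^ (N - j) * g (Suc (length ks)) x ^ j))"
    using Suc.IH[OF Suc.prems(1) js(3)] Suc.prems(1)[of 0] Suc.prems(1)[of "Suc r"]
    by (auto simp: len intro!: degree_le_mult degree_le_power)
  moreover have "r * N * E + ((N - j) * E + j * E) = Suc r * N * E"
  proof -
    have "(N - j) * E + j * E = N * E" using js(2) by (simp flip: add_mult_distrib)
    then show ?thesis by (simp add: algebra_simps)
  qed
  moreover have "power_product N g js = (\<lambda>x. power_product N g ks x * (g 0 x ^ (N - j) * g (Suc (length ks)) x ^ j))"
    using js by auto
  ultimately show ?case by simp
qed

lemma power_product_comp: "power_product N (\<lambda>i a. f i (\<Phi> a)) js a = power_product N f js (\<Phi> a)"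
  by (induction js) auto

text \<open>
  A chain that is longer than the number of parameters produces, by
  \<open>power_products_independent\<close>, at least \<open>(N + 1) ^ (CARD('p) + 1)\<close> independent forms of degree
  linear in \<open>N\<close>.  Pulled back along \<open>\<Phi>\<close> they are polynomials in \<open>CARD('p)\<close> variables, of which only
  \<open>O(N ^ CARD('p))\<close> can be independent.
\<close>

lemma chain_length_le_parameters:
  fixes \<Phi> :: "complex^'p::finite \<Rightarrow> complex^('m::finite \<times> 'n::finite)"
  assumes \<Phi>: "polynomial_map \<Phi>" and a0: "\<And>i. block i (\<Phi> a0) \<noteq> 0"
    and irr: "\<And>i. i \<le> r \<Longrightarrow> irreducible_closed (Z i)" and sub: "\<And>i. i \<le> r \<Longrightarrow> Z i \<subseteq> param_variety \<Phi>"
    and strict: "\<And>i. i < r \<Longrightarrow> Z i \<subset> Z (Suc i)"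
  shows "r \<le> CARD('p)"
proof (rule ccontr)
  assume "\<not> r \<le> CARD('p)"
  \<comment> \<open>Only the first \<open>CARD('p) + 1\<close> steps of the chain are used.\<close>
  define R where "R = Suc CARD('p)"
  have R: "R \<le> r" using \<open>\<not> r \<le> CARD('p)\<close> by (simp add: R_def)
  have mono: "Z i \<subseteq> Z j" if "i \<le> j" "j \<le> R" for i j
    using that
  proof (induction rule: dec_induct)
    case (step j)
    then show ?case using strict[of j] R by force
  qed simp
  obtain p0 where p0: "p0 \<in> Z 0" using irr[of 0] by (auto simp: irreducible_closed_def)
  obtain \<kappa> where \<kappa>: "\<And>i. hom_coords p0 $ (i, \<kappa> i) \<noteq> 0"
    using nonvanishing_coordinates[of "hom_coords p0"] rep_proj_nonzero by (metis block_hom_coords)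
  have "\<exists>g d. multiform d g \<and> (\<forall>q\<in>Z i. g (hom_coords q) = 0) \<and> (\<exists>q\<in>Z (Suc i). g (hom_coords q) \<noteq> 0)"
    if "i < R" for i
  proof -
    have "Z i \<subset> Z (Suc i)" using strict that R by simp
    then obtain q where q: "q \<in> Z (Suc i)" "q \<notin> Z i" by blast
    have "zariski_closed (Z i)" using irr[of i] that R by (simp add: irreducible_closed_def)
    from zariski_closed_separate[OF this q(2)] obtain g where
      "multihomogeneous g" "\<And>p. p \<in> Z i \<Longrightarrow> g (hom_coords p) = 0" "g (hom_coords q) \<noteq> 0"
      by blast
    then show ?thesis using q(1) unfolding multihomogeneous_iff by blast
  qed
  then have "\<forall>i. \<exists>g d. i < R \<longrightarrow> multiform d g \<and> (\<forall>q\<in>Z i. g (hom_coords q) = 0) \<and>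
      (\<exists>q\<in>Z (Suc i). g (hom_coords q) \<noteq> 0)" by blast
  from choice[OF this] obtain g where "\<forall>i. \<exists>d. i < R \<longrightarrow> multiform d (g i) \<and>
      (\<forall>q\<in>Z i. g i (hom_coords q) = 0) \<and> (\<exists>q\<in>Z (Suc i). g i (hom_coords q) \<noteq> 0)" by blast
  from choice[OF this] obtain d where g: "\<And>i. i < R \<Longrightarrow> multiform (d i) (g i)"
    "\<And>i q. i < R \<Longrightarrow> q \<in> Z i \<Longrightarrow> g i (hom_coords q) = 0"
    "\<And>i. i < R \<Longrightarrow> \<exists>q\<in>Z (Suc i). g i (hom_coords q) \<noteq> 0"
    by blast
  \<comment> \<open>The separating forms are brought to the common multidegree \<open>D\<close> by monomials that do not vanish at
    \<open>p0\<close>, hence vanish identically on no member of the chain.\<close>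
  define D where "D = (\<lambda>j. \<Sum>i<R. d i j)"
  define mon where "mon = (\<lambda>e x. \<Prod>j\<in>UNIV. x $ (j, \<kappa> j) ^ e j :: complex)"
  have mon: "multiform e (mon e)" for e
    unfolding mon_def by (rule multiform_coordinate_powers)
  have mon0: "mon e (hom_coords p0) \<noteq> 0" for e using \<kappa> by (simp add: mon_def)
  define f where "f = (\<lambda>i. case i of 0 \<Rightarrow> mon D | Suc i \<Rightarrow> (\<lambda>x. g i x * mon (\<lambda>j. D j - d i j) x))"
  have d_le: "d i j \<le> D j" if "i < R" for i j
    unfolding D_def using that by (intro member_le_sum) auto
  have f: "multiform D (f i)" if "i \<le> R" for i
  proof (cases i)
    case (Suc k)
    then have "k < R" using that by simp
    have "multiform (\<lambda>j. d k j + (D j - d k j)) (\<lambda>x. g k x * mon (\<lambda>j. D j - d k j) x)"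
      by (intro multiform_mult g mon \<open>k < R\<close>)
    then show ?thesis using d_le[OF \<open>k < R\<close>] Suc by (simp add: f_def)
  qed (simp add: f_def mon)
  have nonvanish: "\<exists>q\<in>Z (Suc i). f (Suc i) (hom_coords q) \<noteq> 0" if i: "i < R" for i
  proof (rule ccontr)
    assume "\<not> ?thesis"
    then have 0: "\<And>q. q \<in> Z (Suc i) \<Longrightarrow> g i (hom_coords q) * mon (\<lambda>j. D j - d i j) (hom_coords q) = 0"
      by (auto simp: f_def)
    obtain q where q: "q \<in> Z (Suc i)" "g i (hom_coords q) \<noteq> 0" using g(3)[OF i] by blast
    have "p0 \<in> Z (Suc i)" using mono[of 0 "Suc i"] p0 i by auto
    moreover have "multihomogeneous (g i)" "multihomogeneous (mon (\<lambda>j. D j - d i j))"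
      using g(1)[OF i] mon unfolding multihomogeneous_iff by blast+
    ultimately have "mon (\<lambda>j. D j - d i j) (hom_coords p0) = 0"
      using irreducible_closed_no_zero_divisors[of "Z (Suc i)" "g i" "mon (\<lambda>j. D j - d i j)" q p0]
        irr[of "Suc i"] 0 q i R by simp
    with mon0 show False by simp
  qed
  have "\<forall>i. \<exists>n. i \<le> R \<longrightarrow> degree_le n (\<lambda>a. f i (\<Phi> a))"
  proof
    fix i show "\<exists>n. i \<le> R \<longrightarrow> degree_le n (\<lambda>a. f i (\<Phi> a))"
    proof (cases "i \<le> R")
      case True
      have "polynomial_fun (\<lambda>a. f i (\<Phi> a))"
        by (rule polynomial_fun_compose[OF multiform_polynomial[OF f[OF True]]])
          (rule polynomial_map_component[OF \<Phi>])
      then obtain n where "degree_le n (\<lambda>a. f i (\<Phi> a))" by (rule polynomial_fun_degree_le)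
      then show ?thesis by blast
    qed simp
  qed
  from choice[OF this] obtain E0 where E0: "\<And>i. i \<le> R \<Longrightarrow> degree_le (E0 i) (\<lambda>a. f i (\<Phi> a))"
    by blast
  define E where "E = Suc (\<Sum>i\<le>R. E0 i)"
  have E: "degree_le E (\<lambda>a. f i (\<Phi> a))" if "i \<le> R" for i
  proof (rule degree_le_mono[OF E0[OF that]])
    have "E0 i \<le> (\<Sum>i\<le>R. E0 i)" using that by (intro member_le_sum) auto
    then show "E0 i \<le> E" by (simp add: E_def)
  qed
  \<comment> \<open>Chosen such that \<open>(R * E * (N + 1)) ^ CARD('p) = N * (N + 1) ^ CARD('p)\<close>, just less than \<open>(N + 1) ^ R\<close>.\<close>
  define N where "N = (R * E) ^ CARD('p)"
  have RE: "1 \<le> R * E" by (simp add: R_def E_def)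
  have "(R * N * E + 1) ^ CARD('p) \<le> (R * E * (N + 1)) ^ CARD('p)"
    using RE by (intro power_mono) (auto simp: algebra_simps)
  also have "\<dots> = N * (N + 1) ^ CARD('p)" by (simp only: power_mult_distrib N_def)
  also have "\<dots> < (N + 1) ^ R" by (simp add: R_def)
  also have "\<dots> = card (exponent_lists N R)" by (rule card_exponent_lists[symmetric])
  finally have card: "(R * N * E + 1) ^ CARD('p) < card (exponent_lists N R)" .
  have deg: "degree_le (R * N * E) (power_product N (\<lambda>i a. f i (\<Phi> a)) js)"
    if "js \<in> exponent_lists N R" for js
    by (rule degree_le_power_product[where g = "\<lambda>i a. f i (\<Phi> a)", OF E that])
  obtain c where c: "\<And>a. (\<Sum>js\<in>exponent_lists N R. c js * power_product N (\<lambda>i a. f i (\<Phi> a)) js a) = 0"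
      "\<exists>js\<in>exponent_lists N R. c js \<noteq> 0"
    using degree_le_linear_dependence[of "exponent_lists N R" "R * N * E"
        "power_product N (\<lambda>i a. f i (\<Phi> a))", OF finite_exponent_lists deg card]
    by blast
  define F where "F = (\<lambda>x. \<Sum>js\<in>exponent_lists N R. c js * power_product N f js x)"
  have "multihomogeneous F"
    unfolding F_def multihomogeneous_iff using f
    by (intro exI[of _ "\<lambda>i. R * N * D i"] multiform_sum multiform_cmult multiform_power_product)
  moreover have "F (\<Phi> a) = 0" for a using c(1) by (simp add: F_def power_product_comp)
  ultimately have "F (hom_coords q) = 0" if "q \<in> Z R" for q
    using vanishing_on_param_variety[OF \<Phi> a0] sub[OF R] that by blast
  then have "\<forall>js\<in>exponent_lists N R. c js = 0"
  proof (intro power_products_independent[of R Z D f])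
    show "\<exists>q\<in>Z i. f 0 (hom_coords q) \<noteq> 0" if "i \<le> R" for i
      using mono[of 0 i] that p0 mon0 by (intro bexI[of _ p0]) (auto simp: f_def)
    show "f (Suc i) (hom_coords q) = 0" if "i < R" "q \<in> Z i" for i q
      using g(2)[OF that] by (simp add: f_def)
    show "irreducible_closed (Z i)" if "i \<le> R" for i using irr that R by simp
    show "Z i \<subseteq> Z (Suc i)" if "i < R" for i using mono that by simp
    show "(\<Sum>js\<in>exponent_lists N R. c js * power_product N f js (hom_coords q)) = 0"
      if "\<And>q. q \<in> Z R \<Longrightarrow> F (hom_coords q) = 0" "q \<in> Z R" for q
      using that by (simp add: F_def)
  qed (use f nonvanish in blast)+
  with c(2) show False by blast
qed

lemma krull_dim_param_variety_le:
  fixes \<Phi> :: "complex^'p::finite \<Rightarrow> complex^('m::finite \<times> 'n::finite)"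
  assumes "polynomial_map \<Phi>" "\<And>i. block i (\<Phi> a0) \<noteq> 0"
  shows "krull_dim (param_variety \<Phi>) \<le> enat CARD('p)"
  unfolding krull_dim_def
proof (rule Sup_least, safe)
  fix r and Z :: "nat \<Rightarrow> ('m \<Rightarrow> 'n proj) set"
  assume "\<forall>i\<le>r. irreducible_closed (Z i) \<and> Z i \<subseteq> param_variety \<Phi>" "\<forall>i<r. Z i \<subset> Z (Suc i)"
  then show "enat r \<le> enat CARD('p)"
    using chain_length_le_parameters[OF assms, of r Z] by simp
qed

lemma krull_dim_ge:
  assumes "\<And>i. i \<le> r \<Longrightarrow> irreducible_closed (Z i)" "\<And>i. i \<le> r \<Longrightarrow> Z i \<subseteq> X"
    and "\<And>i. i < r \<Longrightarrow> Z i \<subset> Z (Suc i)"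
  shows "enat r \<le> krull_dim X"
  unfolding krull_dim_def using assms by (intro Sup_upper) auto

lemma local_dim_irreducible:
  assumes "irreducible_closed X" "p \<in> X"
  shows "local_dim X p = krull_dim X"
proof (rule antisym)
  have "krull_dim Z \<le> krull_dim X" if "Z \<subseteq> X" for Z
    unfolding krull_dim_def using that by (intro Sup_subset_mono) blast
  then show "local_dim X p \<le> krull_dim X"
    unfolding local_dim_def by (intro Sup_least) blast
  show "krull_dim X \<le> local_dim X p"
    unfolding local_dim_def using assms by (intro Sup_upper) blast
qed

section \<open>Tangent spaces\<close>

definition vanishing_forms :: "('m::finite \<Rightarrow> 'n::finite proj) set \<Rightarrow> (complex^('m \<times> 'n) \<Rightarrow> complex) set" where
  "vanishing_forms X = {f. multihomogeneous f \<and> (\<forall>q\<in>X. f (hom_coords q) = 0)}"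

lemma vanishing_forms_polynomial: "f \<in> vanishing_forms X \<Longrightarrow> polynomial_fun f"
  by (simp add: vanishing_forms_def multihomogeneous_def)

lemma cone_tangent_space_eq:
  "cone_tangent_space X p =
     {v. \<forall>f\<in>vanishing_forms X. (\<Sum>k\<in>UNIV. gradient f k (hom_coords p) * v $ k) = 0}"
  unfolding cone_tangent_space_def vanishing_forms_def
  by (auto simp: deriv_eq_gradient multihomogeneous_def)

lemma subspace_cone_tangent_space: "vec.subspace (cone_tangent_space X p)"
proof -
  have "(\<Sum>k\<in>UNIV. g k * (c * v $ k)) = c * (\<Sum>k\<in>UNIV. g k * v $ k)" for g c and v :: "complex^('a \<times> 'b)"
    by (simp add: sum_distrib_left algebra_simps)
  then show ?thesis
    unfolding cone_tangent_space_eq by (auto simp: vec.subspace_def distrib_left sum.distrib)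
qed

text \<open>
  Every form that vanishes along the curve has derivative zero in the direction of its velocity.
\<close>

lemma velocity_in_cone_tangent_space:
  assumes deriv: "\<And>k. ((\<lambda>t. \<gamma> t $ k) has_field_derivative v $ k) (at 0)"
    and start: "\<gamma> 0 = hom_coords p"
    and curve: "\<And>f t. f \<in> vanishing_forms X \<Longrightarrow> f (\<gamma> t) = 0"
  shows "v \<in> cone_tangent_space X p"
  unfolding cone_tangent_space_eq
proof safe
  fix f assume f: "f \<in> vanishing_forms X"
  have "((\<lambda>t. f (\<gamma> t)) has_field_derivative (\<Sum>k\<in>UNIV. gradient f k (\<gamma> 0) * v $ k)) (at 0)"
    by (rule has_field_derivative_gradient[OF vanishing_forms_polynomial[OF f] deriv])
  moreover have "((\<lambda>t. f (\<gamma> t)) has_field_derivative 0) (at 0)"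
    using curve[OF f] by simp
  ultimately show "(\<Sum>k\<in>UNIV. gradient f k (hom_coords p) * v $ k) = 0"
    using DERIV_unique start by metis
qed

lemma gradient_scale_blocks:
  assumes f: "multiform d f"
  shows "t (fst k) * gradient f k (scale_blocks t x) = (\<Prod>i\<in>UNIV. t i ^ d i) * gradient f k x"
proof -
  let ?\<gamma> = "\<lambda>s. scale_blocks t (x + s *s axis k 1)"
  have delta: "(\<Sum>j\<in>UNIV. g j * (a j * axis k 1 $ j)) = a k * g k" for g a :: "'a \<times> 'b \<Rightarrow> complex"
  proof -
    have "(\<Sum>j\<in>UNIV. g j * (a j * axis k 1 $ j)) = (\<Sum>j\<in>UNIV. if j = k then a j * g j else 0)"
      by (intro sum.cong) (auto simp: axis_def)
    then show ?thesis by simp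
  qed
  have "((\<lambda>s. f (?\<gamma> s)) has_field_derivative
      (\<Sum>j\<in>UNIV. gradient f j (?\<gamma> 0) * (scale_blocks t (axis k 1)) $ j)) (at 0)"
    by (rule has_field_derivative_gradient[OF multiform_polynomial[OF f]])
      (auto intro!: derivative_eq_intros)
  then have "((\<lambda>s. f (?\<gamma> s)) has_field_derivative t (fst k) * gradient f k (scale_blocks t x)) (at 0)"
    by (simp add: delta)
  moreover have "((\<lambda>s. f (x + s *s axis k 1)) has_field_derivative
      (\<Sum>j\<in>UNIV. gradient f j (x + 0 *s axis k 1) * axis k 1 $ j)) (at 0)"
    by (rule has_field_derivative_gradient[OF multiform_polynomial[OF f]])
      (auto intro!: derivative_eq_intros)
  then have "((\<lambda>s. f (x + s *s axis k 1)) has_field_derivative gradient f k x) (at 0)"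
    using delta[of "\<lambda>j. gradient f j x" "\<lambda>_. 1"] by simp
  then have "((\<lambda>s. f (?\<gamma> s)) has_field_derivative (\<Prod>i\<in>UNIV. t i ^ d i) * gradient f k x) (at 0)"
    unfolding multiform_scale[OF f] by (rule DERIV_cmult)
  ultimately show ?thesis by (rule DERIV_unique)
qed

text \<open>
  The cone tangent space at \<open>p\<close> is cut out by the gradients at \<open>p\<close> of finitely many forms that
  vanish on \<open>X\<close>; choose them independent and complete them by unit vectors to an invertible matrix
  \<open>A (hom_coords p)\<close>.  Where the determinant of \<open>A x\<close> is nonzero, the same gradients are still independent,
  so the tangent space there is no larger.
\<close>

lemma tangent_dimension_semicontinuous:
  fixes X :: "('m::finite \<Rightarrow> 'n::finite proj) set"
  obtains D where "multihomogeneous D" "D (hom_coords p) \<noteq> 0"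
    "\<And>q. D (hom_coords q) \<noteq> 0 \<Longrightarrow>
       vec.dim (cone_tangent_space X q) \<le> vec.dim (cone_tangent_space X p)"
proof -
  let ?p = "hom_coords p"
  define G where "G = (\<lambda>f. \<chi> k. gradient f k ?p) ` vanishing_forms X"
  obtain B where B: "B \<subseteq> G" "vec.independent B" "G \<subseteq> vec.span B"
    using vec.maximal_independent_subset by blast
  obtain B' where B': "B \<subseteq> B'" "B' \<subseteq> B \<union> cart_basis" "vec.independent B'" "B \<union> cart_basis \<subseteq> vec.span B'"
    using vec.maximal_independent_subset_extend[of B "B \<union> cart_basis"] B(2) by blast
  have span: "vec.span B' = UNIV"
    using B'(4) vec.span_mono[of "cart_basis" "vec.span B'"] by (auto simp: vec.span_span)
  then have "card B' = CARD('m \<times> 'n)"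
    using vec.dim_span_eq_card_independent[OF B'(3)] by (simp add: card_cart_basis)
  then obtain \<beta> :: "'m \<times> 'n \<Rightarrow> complex^('m \<times> 'n)" where \<beta>: "bij_betw \<beta> UNIV B'"
    using vec.finiteI_independent[OF B'(3)] finite_same_card_bij[of "UNIV :: ('m \<times> 'n) set" B'] by auto
  define R where "R = {k. \<beta> k \<in> B}"
  have "\<forall>k. \<exists>f. k \<in> R \<longrightarrow> f \<in> vanishing_forms X \<and> \<beta> k = (\<chi> j. gradient f j ?p)"
    using B(1) unfolding R_def G_def by blast
  from choice[OF this] obtain F where F: "\<And>k. k \<in> R \<Longrightarrow> F k \<in> vanishing_forms X"
    "\<And>k. k \<in> R \<Longrightarrow> \<beta> k = (\<chi> j. gradient (F k) j ?p)" by blast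
  have "\<forall>k. \<exists>d. k \<in> R \<longrightarrow> multiform d (F k)"
    using F(1) unfolding vanishing_forms_def multihomogeneous_iff by blast
  from choice[OF this] obtain d where d: "\<And>k. k \<in> R \<Longrightarrow> multiform (d k) (F k)" by blast
  have "\<forall>k. \<exists>\<kappa>. k \<notin> R \<longrightarrow> \<beta> k = axis \<kappa> 1"
  proof
    fix k show "\<exists>\<kappa>. k \<notin> R \<longrightarrow> \<beta> k = axis \<kappa> 1"
      using bij_betwE[OF \<beta>] B'(2) unfolding R_def cart_basis_def by blast
  qed
  from choice[OF this] obtain \<kappa> where \<kappa>: "\<And>k. k \<notin> R \<Longrightarrow> \<beta> k = axis (\<kappa> k) 1" by blast
  define A :: "complex^('m \<times> 'n) \<Rightarrow> complex^('m \<times> 'n)^('m \<times> 'n)" where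
    "A = (\<lambda>x. \<chi> k j. if k \<in> R then gradient (F k) j x else \<beta> k $ j)"
  define \<rho> where "\<rho> = (\<lambda>t :: 'm \<Rightarrow> complex. \<lambda>k. if k \<in> R then \<Prod>i\<in>UNIV. t i ^ d k i else t (fst (\<kappa> k)))"
  have A_scale: "t (fst j) * A (scale_blocks t x) $ k $ j = \<rho> t k * A x $ k $ j" for t x k j
  proof (cases "k \<in> R")
    case True
    then show ?thesis using gradient_scale_blocks[OF d[OF True], of t j x] by (simp add: A_def \<rho>_def)
  next
    case False
    then show ?thesis by (simp add: A_def \<rho>_def \<kappa> axis_def)
  qed
  \<comment> \<open>Scaling the blocks multiplies the determinant by a monomial in \<open>t\<close>, up to the weights of the
    columns, which appear here on the left.\<close>
  have det_scale: "(\<Prod>k\<in>(UNIV :: ('m \<times> 'n) set). t (fst k)) * det (A (scale_blocks t x)) = (\<Prod>k\<in>UNIV. \<rho> t k) * det (A x)" for t x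
  proof -
    have "(\<Prod>k\<in>(UNIV :: ('m \<times> 'n) set). t (fst k)) * (of_int (sign \<sigma>) * (\<Prod>k\<in>UNIV. A (scale_blocks t x) $ k $ \<sigma> k)) =
        (\<Prod>k\<in>UNIV. \<rho> t k) * (of_int (sign \<sigma>) * (\<Prod>k\<in>UNIV. A x $ k $ \<sigma> k))"
      if \<sigma>: "\<sigma> permutes UNIV" for \<sigma> :: "'m \<times> 'n \<Rightarrow> 'm \<times> 'n"
    proof -
      have "(\<Prod>k\<in>(UNIV :: ('m \<times> 'n) set). t (fst k)) = (\<Prod>k\<in>(UNIV :: ('m \<times> 'n) set). t (fst (\<sigma> k)))"
        using prod.permute[OF \<sigma>, of "\<lambda>k. t (fst k)"] by (simp add: comp_def)
      then have "(\<Prod>k\<in>(UNIV :: ('m \<times> 'n) set). t (fst k)) * (\<Prod>k\<in>UNIV. A (scale_blocks t x) $ k $ \<sigma> k) =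
          (\<Prod>k\<in>UNIV. \<rho> t k * A x $ k $ \<sigma> k)"
        by (simp add: A_scale flip: prod.distrib)
      then show ?thesis by (simp add: prod.distrib)
    qed
    then show ?thesis
      unfolding det_def sum_distrib_left by (intro sum.cong) auto
  qed
  have det_poly: "polynomial_fun (\<lambda>x. det (A x))"
  proof -
    have "polynomial_fun (\<lambda>x. A x $ k $ j)" for k j
      unfolding A_def using polynomial_fun_gradient[OF vanishing_forms_polynomial[OF F(1)]]
      by (cases "k \<in> R") (auto intro: polynomial_fun.const)
    then show ?thesis unfolding det_def
      by (intro polynomial_fun_sum polynomial_fun.mult polynomial_fun.const polynomial_fun_prod)
  qed
  obtain \<mu> where \<mu>: "\<And>i. ?p $ (i, \<mu> i) \<noteq> 0"
    using nonvanishing_coordinates[of ?p] rep_proj_nonzero by (metis block_hom_coords)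
  \<comment> \<open>The extra coordinates absorb the weights of the columns, which makes \<open>D\<close> multihomogeneous.\<close>
  define D where "D = (\<lambda>x. det (A x) * (\<Prod>k\<in>UNIV. x $ (fst (k :: 'm \<times> 'n), \<mu> (fst k))))"
  have inj_iff: "inj ((*v) (A x)) \<longleftrightarrow> det (A x) \<noteq> 0" for x
    using det_nz_iff_inj_gen[OF matrix_vector_mul_linear_gen[of "A x"]]
    by (simp add: matrix_of_matrix_vector_mul)
  have A_p: "A ?p $ k = \<beta> k" for k
    using F(2) by (simp add: A_def vec_eq_iff)
  have "inj ((*v) (A ?p))"
    unfolding vec.inj_iff_eq_0
  proof safe
    fix v assume "A ?p *v v = 0"
    then have orth: "(\<Sum>j\<in>UNIV. b $ j * v $ j) = 0" if "b \<in> B'" for b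
      using that \<beta> A_p unfolding bij_betw_def matrix_vector_mult_def by (auto simp: vec_eq_iff)
    have "vec.subspace {b. (\<Sum>j\<in>UNIV. b $ j * v $ j) = 0}"
      by (auto simp: vec.subspace_def distrib_right sum.distrib mult.assoc simp flip: sum_distrib_left)
    then have "vec.span B' \<subseteq> {b. (\<Sum>j\<in>UNIV. b $ j * v $ j) = 0}"
      using orth by (intro vec.span_minimal) auto
    then have "(\<Sum>j\<in>UNIV. axis i 1 $ j * v $ j) = 0" for i using span by blast
    moreover have "(\<Sum>j\<in>UNIV. axis i 1 $ j * v $ j) = (\<Sum>j\<in>UNIV. if j = i then v $ j else 0)" for i
      by (intro sum.cong) (auto simp: axis_def)
    ultimately show "v = 0" by (simp add: vec_eq_iff)
  qed
  then have det_p: "det (A ?p) \<noteq> 0" using inj_iff by blast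
  define Y :: "(complex^('m \<times> 'n)) set" where "Y = {y. \<forall>k\<in>R. y $ k = 0}"
  have dim_q: "vec.dim (cone_tangent_space X q) \<le> vec.dim Y" if q: "det (A (hom_coords q)) \<noteq> 0" for q
  proof -
    let ?A = "A (hom_coords q)"
    have "vec.dim ((*v) ?A ` cone_tangent_space X q) = vec.dim (cone_tangent_space X q)"
      using inj_iff q by (intro vec.dim_image_eq) (auto intro: inj_on_subset)
    moreover have "(*v) ?A ` cone_tangent_space X q \<subseteq> Y"
      using F(1) by (auto simp: Y_def cone_tangent_space_eq matrix_vector_mult_def A_def)
    ultimately show ?thesis using vec.dim_subset by metis
  qed
  have "Y \<subseteq> (*v) (A ?p) ` cone_tangent_space X p"
  proof
    fix y assume y: "y \<in> Y"
    obtain A' where A': "A ?p ** A' = mat 1"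
      using det_p invertible_det_nz unfolding invertible_def by blast
    define v where "v = A' *v y"
    have v: "A ?p *v v = y" by (simp add: v_def matrix_vector_mul_assoc A')
    have "(\<Sum>j\<in>UNIV. b $ j * v $ j) = 0" if "b \<in> B" for b
    proof -
      have "b \<in> range \<beta>" using that B'(1) \<beta> unfolding bij_betw_def by blast
      then obtain k where k: "\<beta> k = b" by blast
      then have "k \<in> R" using that by (simp add: R_def)
      then have "y $ k = 0" using y unfolding Y_def by blast
      then show ?thesis using k A_p[of k] v by (auto simp: matrix_vector_mult_def)
    qed
    moreover have "vec.subspace {b. (\<Sum>j\<in>UNIV. b $ j * v $ j) = 0}"
      by (auto simp: vec.subspace_def distrib_right sum.distrib mult.assoc simp flip: sum_distrib_left)
    ultimately have "vec.span B \<subseteq> {b. (\<Sum>j\<in>UNIV. b $ j * v $ j) = 0}"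
      by (intro vec.span_minimal) auto
    then have ann: "(\<Sum>j\<in>UNIV. b $ j * v $ j) = 0" if "b \<in> G" for b using B(3) that by blast
    have "v \<in> cone_tangent_space X p"
      unfolding cone_tangent_space_eq
    proof safe
      fix f assume "f \<in> vanishing_forms X"
      then have "(\<chi> k. gradient f k ?p) \<in> G" unfolding G_def by blast
      from ann[OF this] show "(\<Sum>k\<in>UNIV. gradient f k ?p * v $ k) = 0" by simp
    qed
    with v show "y \<in> (*v) (A ?p) ` cone_tangent_space X p" by blast
  qed
  then have dim_p: "vec.dim Y \<le> vec.dim (cone_tangent_space X p)"
    using vec.dim_subset vec.dim_image_le[OF matrix_vector_mul_linear_gen] le_trans by blast
  show ?thesis
  proof
    have "D (scale_blocks t x) = (\<Prod>k\<in>UNIV. \<rho> t k) * D x" for t x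
      using det_scale[of t x] by (simp add: D_def prod.distrib algebra_simps)
    moreover have "\<exists>e. \<forall>t. (\<Prod>k\<in>UNIV. \<rho> t k) = (\<Prod>i\<in>UNIV. t i ^ e i)"
    proof -
      define e where "e = (\<lambda>k i. if k \<in> R then d k i else if i = fst (\<kappa> k) then 1 else 0)"
      have "\<rho> t k = (\<Prod>i\<in>UNIV. t i ^ e k i)" for t k
      proof (cases "k \<in> R")
        case False
        have "(\<Prod>i\<in>UNIV. t i ^ e k i) = (\<Prod>i\<in>UNIV. if i = fst (\<kappa> k) then t i else 1)"
          using False by (intro prod.cong) (auto simp: e_def)
        then show ?thesis using False by (simp add: \<rho>_def)
      qed (simp add: \<rho>_def e_def)
      then have "(\<Prod>k\<in>UNIV. \<rho> t k) = (\<Prod>i\<in>UNIV. t i ^ (\<Sum>k\<in>UNIV. e k i))" for t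
        by (simp add: power_sum prod.swap[of _ "UNIV :: 'm set"])
      then show ?thesis by (intro exI[of _ "\<lambda>i. \<Sum>k\<in>UNIV. e k i"]) blast
    qed
    moreover have "polynomial_fun D"
      unfolding D_def using det_poly
      by (intro polynomial_fun.mult polynomial_fun_prod polynomial_fun.coordinate)
    ultimately show "multihomogeneous D" unfolding multihomogeneous_def by metis
    show "D ?p \<noteq> 0" using det_p \<mu> by (simp add: D_def)
    show "vec.dim (cone_tangent_space X q) \<le> vec.dim (cone_tangent_space X p)"
      if "D (hom_coords q) \<noteq> 0" for q
      using dim_q[of q] dim_p that by (auto simp: D_def)
  qed
qed

lemma vec_linearI:
  assumes "\<And>x y. f (x + y) = f x + f y" "\<And>c x. f (c *s x) = c *s f x"
  shows "Vector_Spaces.linear (*s) (*s) (f :: complex^'a::finite \<Rightarrow> complex^'b::finite)"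
  using assms by unfold_locales auto

lemma dim_le_functionals:
  fixes K :: "(complex^'k::finite) set" and \<psi> :: "complex^'k \<Rightarrow> complex^'b::finite"
  assumes K: "vec.subspace K" and lin: "Vector_Spaces.linear (*s) (*s) \<psi>"
    and ker: "\<And>v. v \<in> K \<Longrightarrow> \<psi> v = 0 \<Longrightarrow> v = 0"
  shows "vec.dim K \<le> CARD('b)"
proof -
  interpret \<psi>: Vector_Spaces.linear "(*s)" "(*s)" \<psi> by (rule lin)
  have "inj_on \<psi> (vec.span K)"
  proof (rule inj_onI)
    fix x y assume xy: "x \<in> vec.span K" "y \<in> vec.span K" "\<psi> x = \<psi> y"
    then have "x - y \<in> K" using K vec.span_eq_iff vec.subspace_diff by metis
    moreover have "\<psi> (x - y) = 0" using xy by (simp add: \<psi>.diff)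
    ultimately show "x = y" using ker by force
  qed
  then have "vec.dim K = vec.dim (\<psi> ` K)" using vec.dim_image_eq[OF lin] by metis
  also have "\<dots> \<le> vec.dim (UNIV :: (complex^'b) set)" by (rule vec.dim_subset) simp
  also have "\<dots> = CARD('b)" by (simp add: card_cart_basis)
  finally show ?thesis .
qed

lemma dim_ge_injective:
  fixes K :: "(complex^'k::finite) set" and \<psi> :: "complex^'b::finite \<Rightarrow> complex^'k"
  assumes lin: "Vector_Spaces.linear (*s) (*s) \<psi>"
    and K: "\<And>v. \<psi> v \<in> K" and ker: "\<And>v. \<psi> v = 0 \<Longrightarrow> v = 0"
  shows "CARD('b) \<le> vec.dim K"
proof -
  have "inj \<psi>" using vec.linear_inj_iff_eq_0[OF lin] ker by blast
  then have "vec.dim (range \<psi>) = vec.dim (UNIV :: (complex^'b) set)"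
    using vec.dim_image_eq[OF lin] by (metis vec.span_UNIV)
  then have "CARD('b) = vec.dim (range \<psi>)" by (simp add: card_cart_basis)
  also have "\<dots> \<le> vec.dim K" using K by (intro vec.dim_subset) auto
  finally show ?thesis .
qed

section \<open>Vectors and matrices in low dimensions\<close>

definition cross :: "complex^3 \<Rightarrow> complex^3 \<Rightarrow> complex^3" where
  "cross u v = vector [u$2 * v$3 - u$3 * v$2, u$3 * v$1 - u$1 * v$3, u$1 * v$2 - u$2 * v$1]"

lemma cross_nth [simp]:
  "cross u v $ 1 = u$2 * v$3 - u$3 * v$2"
  "cross u v $ 2 = u$3 * v$1 - u$1 * v$3"
  "cross u v $ 3 = u$1 * v$2 - u$2 * v$1"
  by (simp_all add: cross_def)

lemma scalar_product_3: "scalar_product u v = u$1 * v$1 + u$2 * v$2 + u$3 * v$3" for u v :: "complex^3"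
  by (simp add: scalar_product_def sum_3)

lemma scalar_product_linear:
  fixes u v w :: "complex^'n::finite"
  shows "scalar_product u (v + w) = scalar_product u v + scalar_product u w"
    "scalar_product (u + v) w = scalar_product u w + scalar_product v w"
    "scalar_product u (c *s v) = c * scalar_product u v"
    "scalar_product (c *s u) v = c * scalar_product u v"
    "scalar_product u (v - w) = scalar_product u v - scalar_product u w"
    "scalar_product (u - v) w = scalar_product u w - scalar_product v w"
    "scalar_product 0 v = 0" "scalar_product v 0 = 0"
  by (simp_all add: scalar_product_def algebra_simps sum.distrib sum_subtractf sum_distrib_left)

lemma cross_linear:
  "cross (u + v) w = cross u w + cross v w" "cross w (u + v) = cross w u + cross w v"
  "cross (c *s u) w = c *s cross u w" "cross w (c *s u) = c *s cross w u"
  "cross 0 w = 0" "cross w 0 = 0"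
  by (simp_all add: vec_eq_iff forall_3 algebra_simps)

lemma cross_self [simp]: "cross u u = 0"
  by (simp add: vec_eq_iff forall_3)

lemma cross_orthogonal [simp]:
  "scalar_product (cross u v) u = 0" "scalar_product (cross u v) v = 0"
  by (simp_all add: scalar_product_3 algebra_simps)

lemma cross_cross: "cross u (cross v w) = scalar_product u w *s v - scalar_product u v *s w"
  by (simp add: vec_eq_iff forall_3 scalar_product_3 algebra_simps)

lemma scalar_product_nondegenerate:
  fixes u :: "complex^'n::finite"
  shows "(\<And>w. scalar_product u w = 0) \<Longrightarrow> u = 0"
proof -
  assume *: "\<And>w. scalar_product u w = 0"
  have "u $ i = 0" for i
  proof -
    have "scalar_product u (axis i 1) = (\<Sum>j\<in>UNIV. if j = i then u $ j else 0)"
      unfolding scalar_product_def by (intro sum.cong) (auto simp: axis_def)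
    with * show ?thesis by simp
  qed
  then show ?thesis by (simp add: vec_eq_iff)
qed

lemma cross_eq_0D:
  assumes "cross u v = 0" "u \<noteq> 0"
  shows "\<exists>s. v = s *s u"
proof -
  obtain w where w: "scalar_product u w \<noteq> 0"
    using scalar_product_nondegenerate assms(2) by blast
  have "cross w (cross u v) = 0" by (simp add: assms(1) cross_linear)
  then have "scalar_product w u *s v = scalar_product w v *s u"
    by (simp add: cross_cross)
  moreover have "scalar_product w u \<noteq> 0" using w by (simp add: scalar_product_def mult.commute)
  ultimately have "v = (scalar_product w v / scalar_product w u) *s u"
    by (simp add: vec_eq_iff field_simps)
  then show ?thesis by blast
qed

lemma cross_parallel:
  assumes "p \<noteq> 0" "scalar_product p a = 0" "scalar_product p b = 0"
  shows "\<exists>s. cross a b = s *s p"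
  using assms by (intro cross_eq_0D) (simp_all add: cross_cross)

lemma orthogonal_imp_cross:
  assumes "u \<noteq> 0" "scalar_product q u = 0"
  shows "\<exists>y. q = cross u y"
proof -
  obtain w where w: "scalar_product u w \<noteq> 0"
    using scalar_product_nondegenerate assms(1) by blast
  have "scalar_product u q = 0" using assms(2) by (simp add: scalar_product_def mult.commute)
  then have "q = cross u ((1 / scalar_product u w) *s cross q w)"
    using w by (simp add: cross_linear cross_cross vec_eq_iff)
  then show ?thesis by blast
qed

lemma same_plane_imp_parallel:
  fixes n n' :: "complex^3"
  assumes "n \<noteq> 0" "\<And>u. scalar_product u n = 0 \<Longrightarrow> scalar_product u n' = 0"
  shows "\<exists>s. n' = s *s n"
proof (rule cross_eq_0D)
  show "n \<noteq> 0" by (rule assms(1))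
  have "scalar_product (cross n n') w = scalar_product (cross w n) n'" for w
    by (simp add: scalar_product_3 algebra_simps)
  then show "cross n n' = 0"
    using assms(2) by (intro scalar_product_nondegenerate) simp
qed

text \<open>
  Cramer's rule in the basis \<open>p, q, w\<close>, for any \<open>w\<close> that completes \<open>p\<close> and \<open>q\<close> to a basis.
\<close>

lemma orthogonal_to_cross:
  assumes "cross p q \<noteq> 0" "scalar_product u (cross p q) = 0"
  shows "\<exists>a b. u = a *s p + b *s q"
proof -
  obtain w where w: "scalar_product (cross p q) w \<noteq> 0"
    using scalar_product_nondegenerate assms(1) by blast
  let ?d = "scalar_product (cross p q) w"
  have "?d *s u = scalar_product (cross u q) w *s p + scalar_product (cross p u) w *s q
      + scalar_product u (cross p q) *s w"
    by (simp add: vec_eq_iff forall_3 scalar_product_3 algebra_simps)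
  then have "u = (scalar_product (cross u q) w / ?d) *s p + (scalar_product (cross p u) w / ?d) *s q"
    using w assms(2) by (simp add: vec_eq_iff field_simps)
  then show ?thesis by blast
qed

lemma ex_cross_scalar_product_nonzero:
  assumes "w \<noteq> 0" shows "\<exists>u v. scalar_product (cross u v) w \<noteq> 0"
proof (rule ccontr)
  assume "\<not> ?thesis"
  then have *: "scalar_product (cross u v) w = 0" for u v by blast
  have "scalar_product w (cross u v) = 0" for u v
    using *[of u v] by (simp add: scalar_product_def mult.commute)
  moreover have "cross (axis 2 1) (axis 3 1) = axis 1 1" "cross (axis 3 1) (axis 1 1) = axis 2 1"
    "cross (axis 1 1) (axis 2 1) = axis 3 1"
    by (simp_all add: vec_eq_iff forall_3 axis_def)
  ultimately have "scalar_product w (axis 1 1) = 0" "scalar_product w (axis 2 1) = 0"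
    "scalar_product w (axis 3 1) = 0" by metis+
  then have "w = 0" by (simp add: scalar_product_3 axis_def vec_eq_iff forall_3)
  with assms show False by simp
qed

text \<open>
  An injective linear endomorphism of \<open>complex^4\<close> is surjective.
\<close>

lemma independent_four_span:
  fixes x :: "complex^4"
  assumes "\<And>a b c d. a *s x1 + b *s x2 + c *s x3 + d *s x4 = 0 \<Longrightarrow> a = 0 \<and> b = 0 \<and> c = 0 \<and> d = 0"
  shows "\<exists>a b c d. x = a *s x1 + b *s x2 + c *s x3 + d *s x4"
proof -
  define h :: "complex^4 \<Rightarrow> complex^4" where
    "h = (\<lambda>a. a$1 *s x1 + a$2 *s x2 + a$3 *s x3 + a$4 *s x4)"
  have lin: "Vector_Spaces.linear (*s) (*s) h"
    by (rule vec_linearI) (simp_all add: h_def vec_eq_iff algebra_simps)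
  have "inj h"
    unfolding vec.linear_inj_iff_eq_0[OF lin]
  proof (intro allI impI)
    fix a assume "h a = 0"
    then have "a$1 = 0 \<and> a$2 = 0 \<and> a$3 = 0 \<and> a$4 = 0" unfolding h_def by (rule assms)
    then show "a = 0" by (simp add: vec_eq_iff forall_4)
  qed
  then have "surj h" using vec.linear_injective_imp_surjective[OF lin] by simp
  then obtain a where "x = h a" by (metis surjD)
  then show ?thesis by (auto simp: h_def)
qed

lemma vector_4:
  "(vector [w, x, y, z] :: 'a::zero^4) $ 1 = w" "(vector [w, x, y, z] :: 'a::zero^4) $ 2 = x"
  "(vector [w, x, y, z] :: 'a::zero^4) $ 3 = y" "(vector [w, x, y, z] :: 'a::zero^4) $ 4 = z"
  by (simp_all add: vector_def)

lemma matrix_vector_linear: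
  fixes A :: "complex^'n::finite^'m::finite"
  shows "A *v (x + y) = A *v x + A *v y" "A *v (c *s x) = c *s (A *v x)" "A *v (x - y) = A *v x - A *v y"
  by (simp_all add: matrix_vector_mult_def vec_eq_iff algebra_simps sum.distrib sum_subtractf sum_distrib_left)

text \<open>
  The rank counts independent rows, whereas the back-projected planes are columns; for rank one
  the two points of view are matched by writing the matrix as a column times a row.
\<close>

lemma rank_one_iff:
  fixes A :: "complex^'m::finite^4"
  assumes "\<And>i. \<exists>r. A $ r $ i \<noteq> 0"
  shows "rank A = 1 \<longleftrightarrow> (\<forall>i j. \<exists>s. \<forall>r. A $ r $ j = s * A $ r $ i)"
proof
  assume "rank A = 1"
  then have dim: "vec.dim (rows A) = 1" by (simp add: row_rank_def_gen)
  obtain B where B: "B \<subseteq> rows A" "vec.independent B" "rows A \<subseteq> vec.span B" "card B = 1"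
    using vec.basis_exists[of "rows A"] dim by auto
  then obtain \<rho> where \<rho>: "B = {\<rho>}" by (auto simp: card_1_singleton_iff)
  have "\<forall>r. \<exists>t. A $ r = t *s \<rho>"
  proof
    fix r
    have "row r A \<in> rows A" by (auto simp: rows_def)
    then have "A $ r \<in> rows A" by (simp add: row_def vec_nth_inverse)
    then show "\<exists>t. A $ r = t *s \<rho>" using B(3) \<rho> by (auto simp: vec.span_singleton)
  qed
  from choice[OF this] obtain t where t: "\<And>r. A $ r = t r *s \<rho>" by blast
  show "\<forall>i j. \<exists>s. \<forall>r. A $ r $ j = s * A $ r $ i"
  proof (intro allI)
    fix i j
    have "\<rho> $ i \<noteq> 0" using assms[of i] by (auto simp: t)
    then show "\<exists>s. \<forall>r. A $ r $ j = s * A $ r $ i"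
      by (intro exI[of _ "\<rho> $ j / \<rho> $ i"]) (simp add: t)
  qed
next
  assume par: "\<forall>i j. \<exists>s. \<forall>r. A $ r $ j = s * A $ r $ i"
  obtain i :: 'm where True by blast
  have "\<forall>j. \<exists>s. \<forall>r. A $ r $ j = s * A $ r $ i" using par by blast
  from choice[OF this] obtain s where s: "\<And>j r. A $ r $ j = s j * A $ r $ i" by blast
  have "rows A \<subseteq> vec.span {\<chi> j. s j}"
  proof
    fix u assume "u \<in> rows A"
    then obtain r where "u = A $ r" by (auto simp: rows_def row_def vec_nth_inverse)
    moreover have "A $ r $ j = A $ r $ i * s j" for j by (subst s) (rule mult.commute)
    then have "A $ r = (A $ r $ i) *s (\<chi> j. s j)"
      unfolding vec_eq_iff vector_smult_component vec_lambda_beta by (rule allI)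
    ultimately have "u = (A $ r $ i) *s (\<chi> j. s j)" by simp
    then show "u \<in> vec.span {\<chi> j. s j}" by (auto simp: vec.span_singleton)
  qed
  then have "vec.dim (rows A) \<le> 1" using vec.dim_le_card[of "rows A" "{\<chi> j. s j}"] by simp
  moreover have "vec.dim (rows A) \<noteq> 0"
  proof
    assume "vec.dim (rows A) = 0"
    then have "rows A \<subseteq> {0}" by simp
    moreover obtain r where "A $ r $ i \<noteq> 0" using assms by blast
    moreover have "A $ r \<in> rows A" by (auto simp: rows_def row_def vec_nth_inverse)
    ultimately show False by auto
  qed
  ultimately show "rank A = 1" unfolding row_rank_def_gen by linarith
qed

lemma scalar_product_transpose:
  fixes A :: "complex^'n::finite^'m::finite"
  shows "scalar_product u (A *v w) = scalar_product (transpose A *v u) w"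
proof -
  have "(\<Sum>i\<in>UNIV. u $ i * (\<Sum>j\<in>UNIV. A $ i $ j * w $ j)) = (\<Sum>j\<in>UNIV. (\<Sum>i\<in>UNIV. A $ i $ j * u $ i) * w $ j)"
    unfolding sum_distrib_left sum_distrib_right
    by (subst sum.swap) (simp add: mult_ac)
  then show ?thesis by (simp add: scalar_product_def matrix_vector_mult_def transpose_def)
qed

section \<open>The lines of space and their images\<close>

text \<open>
  The line through two points of the plane has their cross product as its equation, so this is a
  lift of the joint camera map to homogeneous coordinates, bilinear in two points that span the
  line.  A block vanishes exactly if the line passes through the corresponding center or \<open>x\<close> and \<open>y\<close>
  are dependent.
\<close>

definition view_lines ::
  "('m::finite \<Rightarrow> complex^4^3) \<Rightarrow> complex^4 \<Rightarrow> complex^4 \<Rightarrow> complex^('m \<times> 3)" where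
  "view_lines C x y = (\<chi> k. cross (C (fst k) *v x) (C (fst k) *v y) $ snd k)"

lemma block_view_lines [simp]: "block i (view_lines C x y) = cross (C i *v x) (C i *v y)"
  by (simp add: view_lines_def vec_eq_iff)

lemma block_eqI: "(\<And>i. block i x = block i y) \<Longrightarrow> x = y"
  by (auto simp: vec_eq_iff)

lemma block_linear [simp]:
  "block i (x + y) = block i x + block i y" "block i (c *s x) = c *s block i x" "block i 0 = 0"
  by (simp_all add: vec_eq_iff)

lemma multiform_block_functional:
  "multiform (\<lambda>j. if j = i then 1 else 0) (\<lambda>x. scalar_product (block i x) w)"
proof -
  have "multiform (\<lambda>j. if j = i then 1 else 0) (\<lambda>x. \<Sum>r\<in>UNIV. w $ r * x $ (i, r))"
    using multiform_coordinate[of "(i, _)"] by (intro multiform_sum multiform_cmult) simp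
  then show ?thesis by (simp add: scalar_product_def mult.commute)
qed

lemma view_lines_change_basis:
  "view_lines C (a *s x + b *s y) (c *s x + d *s y) = scale_blocks (\<lambda>_. a * d - b * c) (view_lines C x y)"
  by (rule block_eqI)
    (simp add: block_scale_blocks matrix_vector_linear vec_eq_iff forall_3 algebra_simps)

lemma polynomial_map_view_lines:
  assumes "\<And>k. polynomial_fun (\<lambda>a. X a $ k)" "\<And>k. polynomial_fun (\<lambda>a. Y a $ k)"
  shows "polynomial_map (\<lambda>a. view_lines C (X a) (Y a))"
  unfolding polynomial_map_def
proof
  fix k :: "'b \<times> 3"
  have U: "polynomial_fun (\<lambda>a. (C (fst k) *v X a) $ j)" "polynomial_fun (\<lambda>a. (C (fst k) *v Y a) $ j)" for j
    unfolding matrix_vector_mult_def using assms by (auto intro!: polynomial_fun_intros)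
  show "polynomial_fun (\<lambda>a. view_lines C (X a) (Y a) $ k)"
    unfolding view_lines_def using exhaust_3[of "snd k"] U
    by (auto intro!: polynomial_fun_diff polynomial_fun.mult)
qed

lemma line_image_eq:
  assumes L: "L = vec.span {x, y}" and n: "cross (C *v x) (C *v y) \<noteq> 0"
  shows "line_image C L = abs_proj (cross (C *v x) (C *v y))"
proof -
  let ?n = "cross (C *v x) (C *v y)"
  have img: "(*v) C ` L = {u. scalar_product u ?n = 0}"
  proof safe
    fix w assume "w \<in> L"
    then obtain a b where "w = a *s x + b *s y"
      unfolding L vec.span_insert vec.span_singleton by (auto simp: algebra_simps)
    then show "scalar_product (C *v w) ?n = 0"
      by (simp add: matrix_vector_linear scalar_product_3 algebra_simps)
  next
    fix u assume "scalar_product u ?n = 0"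
    then obtain a b where "u = a *s (C *v x) + b *s (C *v y)"
      using orthogonal_to_cross[OF n] by blast
    then have "u = C *v (a *s x + b *s y)" by (simp add: matrix_vector_linear)
    moreover have "a *s x + b *s y \<in> L"
      unfolding L by (intro vec.span_add vec.span_scale vec.span_base) auto
    ultimately show "u \<in> (*v) C ` L" by blast
  qed
  obtain s where s: "s \<noteq> 0" "rep_proj (abs_proj ?n) = s *s ?n" using rep_abs_proj[OF n] by blast
  show ?thesis
    unfolding line_image_def
  proof (rule the_equality)
    show "{u. scalar_product u (rep_proj (abs_proj ?n)) = 0} = (*v) C ` L"
      using s by (simp add: img scalar_product_linear)
    fix l assume l: "{u. scalar_product u (rep_proj l) = 0} = (*v) C ` L"
    then have "\<exists>s. rep_proj l = s *s ?n"
      by (intro same_plane_imp_parallel[OF n]) (auto simp: img)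
    then obtain r where r: "rep_proj l = r *s ?n" by blast
    then have "r \<noteq> 0" using rep_proj_nonzero[of l] by auto
    then show "l = abs_proj ?n" using abs_proj_eqI[OF n] r abs_rep_proj by metis
  qed
qed

section \<open>Cameras\<close>

text \<open>
  The hypotheses on the cameras, restated in terms of a vector \<open>c i\<close> that spans the center of \<open>C i\<close>.
\<close>

locale cameras =
  fixes C :: "'m::finite \<Rightarrow> complex^4^3" and c :: "'m \<Rightarrow> complex^4"
  assumes camera_surj: "\<exists>x. C i *v x = u"
    and camera_kernel: "C i *v x = 0 \<longleftrightarrow> (\<exists>s. x = s *s c i)"
    and center_nonzero: "c i \<noteq> 0"
    and distinct_centers: "i \<noteq> j \<Longrightarrow> C i *v c j \<noteq> 0"
begin

lemma camera_center [simp]: "C i *v c i = 0"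
  unfolding camera_kernel by (rule exI[of _ 1]) simp

lemma center_eq: "center (C i) = vec.span {c i}"
  by (auto simp: center_def camera_kernel vec.span_singleton)

lemma cross_image_zero_iff:
  assumes "vec.independent {x, y}" "x \<noteq> y"
  shows "cross (C i *v x) (C i *v y) = 0 \<longleftrightarrow> c i \<in> vec.span {x, y}"
proof
  have comb: "w \<in> vec.span {x, y}" if "w = a *s x + b *s y" for w a b
    unfolding that by (intro vec.span_add vec.span_scale vec.span_base) auto
  assume 0: "cross (C i *v x) (C i *v y) = 0"
  have nz: "x \<noteq> 0" "y \<noteq> 0" "\<And>s. y \<noteq> s *s x"
  proof -
    show "x \<noteq> 0" "y \<noteq> 0" using assms vec.dependent_zero by blast+
    have "vec.independent (insert y {x})" using assms(1) by (simp add: insert_commute)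
    then have "y \<notin> vec.span {x}" using vec.independent_insert[of y "{x}"] assms(2) by simp
    then show "\<And>s. y \<noteq> s *s x" by (auto simp: vec.span_singleton)
  qed
  show "c i \<in> vec.span {x, y}"
  proof (cases "C i *v x = 0")
    case True
    then obtain s where s: "x = s *s c i" using camera_kernel by blast
    then have "s \<noteq> 0" using nz by auto
    then have "c i = (1 / s) *s x + 0 *s y" using s by (simp add: vec_eq_iff)
    then show ?thesis using comb by blast
  next
    case False
    then obtain r where r: "C i *v y = r *s (C i *v x)" using cross_eq_0D[OF 0] by blast
    then have "C i *v (y - r *s x) = 0" by (simp add: matrix_vector_linear)
    then obtain s where s: "y - r *s x = s *s c i" using camera_kernel by blast
    then have "s \<noteq> 0" using nz(3)[of r] by auto
    then have "c i = (- r / s) *s x + (1 / s) *s y"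
      using s by (simp add: vec_eq_iff field_simps)
    then show ?thesis using comb by blast
  qed
next
  assume "c i \<in> vec.span {x, y}"
  then obtain a b where ab: "c i = a *s x + b *s y"
    unfolding vec.span_insert vec.span_singleton by (auto simp: algebra_simps)
  then have 0: "a *s (C i *v x) + b *s (C i *v y) = 0"
    using camera_center[of i] by (simp add: matrix_vector_linear)
  have "b *s cross (C i *v x) (C i *v y) = cross (C i *v x) (a *s (C i *v x) + b *s (C i *v y))"
    by (simp add: cross_linear)
  also have "\<dots> = 0" by (simp only: 0 cross_linear)
  finally have "b *s cross (C i *v x) (C i *v y) = 0" .
  moreover have "a *s cross (C i *v x) (C i *v y) = cross (a *s (C i *v x) + b *s (C i *v y)) (C i *v y)"
    by (simp add: cross_linear)
  then have "a *s cross (C i *v x) (C i *v y) = 0" by (simp only: 0 cross_linear)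
  moreover have "a \<noteq> 0 \<or> b \<noteq> 0" using ab center_nonzero[of i] by auto
  ultimately show "cross (C i *v x) (C i *v y) = 0" by auto
qed

lemma image_of_joint_camera_map:
  "joint_camera_map C ` {L. is_line L \<and> (\<forall>i. \<not> center (C i) \<subseteq> L)} =
     {point_of (view_lines C x y) | x y. \<forall>i. block i (view_lines C x y) \<noteq> 0}"
proof -
  have eq: "joint_camera_map C (vec.span {x, y}) = point_of (view_lines C x y)"
    if "\<forall>i. cross (C i *v x) (C i *v y) \<noteq> 0" for x y
    using that by (simp add: joint_camera_map_def point_of_def line_image_eq[OF refl])
  have center_in: "center (C i) \<subseteq> vec.span {x, y} \<longleftrightarrow> c i \<in> vec.span {x, y}" for i x y
    unfolding center_eq using vec.span_minimal[of "{c i}" "vec.span {x, y}"] vec.span_base[of "c i" "{c i}"]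
    by (auto simp: vec.subspace_span)
  show ?thesis
  proof (intro equalityI subsetI)
    fix p assume "p \<in> joint_camera_map C ` {L. is_line L \<and> (\<forall>i. \<not> center (C i) \<subseteq> L)}"
    then obtain L where L: "is_line L" "\<forall>i. \<not> center (C i) \<subseteq> L" "p = joint_camera_map C L" by blast
    obtain B where B: "B \<subseteq> L" "vec.independent B" "L \<subseteq> vec.span B" "card B = 2"
      using vec.basis_exists[of L] L(1) by (auto simp: is_line_def)
    obtain x y where xy: "B = {x, y}" "x \<noteq> y" using B(4) by (auto simp: card_2_iff)
    have Lxy: "L = vec.span {x, y}"
      using B xy L(1) vec.span_minimal[of B L] by (auto simp: is_line_def)
    then have "\<forall>i. cross (C i *v x) (C i *v y) \<noteq> 0"
      using L(2) cross_image_zero_iff[of x y] B(2) xy center_in by auto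
    then show "p \<in> {point_of (view_lines C x y) | x y. \<forall>i. block i (view_lines C x y) \<noteq> 0}"
      using eq[of x y] L(3) Lxy by auto
  next
    fix p assume "p \<in> {point_of (view_lines C x y) | x y. \<forall>i. block i (view_lines C x y) \<noteq> 0}"
    then obtain x y where p: "p = point_of (view_lines C x y)" "\<forall>i. cross (C i *v x) (C i *v y) \<noteq> 0"
      by auto
    have ind: "vec.independent {x, y}" "x \<noteq> y"
    proof -
      show "x \<noteq> y" using p(2) by auto
      have "x \<notin> vec.span {y}"
      proof
        assume "x \<in> vec.span {y}"
        then obtain s where "x = s *s y" by (auto simp: vec.span_singleton)
        then show False using p(2) by (auto simp: matrix_vector_linear cross_linear)
      qed
      moreover have "y \<noteq> 0" using p(2) by (auto simp: cross_linear)
      ultimately show "vec.independent {x, y}"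
        by (simp add: vec.independent_insert)
    qed
    then have "is_line (vec.span {x, y})"
      using vec.dim_span_eq_card_independent[OF ind(1)] by (simp add: is_line_def vec.subspace_span)
    moreover have "\<forall>i. \<not> center (C i) \<subseteq> vec.span {x, y}"
      using p(2) cross_image_zero_iff[OF ind] center_in by blast
    ultimately show "p \<in> joint_camera_map C ` {L. is_line L \<and> (\<forall>i. \<not> center (C i) \<subseteq> L)}"
      using eq[OF p(2)] p(1) by (intro image_eqI[of _ _ "vec.span {x, y}"]) auto
  qed
qed

text \<open>
  \<open>view_lines\<close> as a map of a single vector of parameters, the eight coordinates of two points.
\<close>

definition all_lines :: "complex^(4 + 4) \<Rightarrow> complex^('m \<times> 3)" where
  "all_lines z = view_lines C (\<chi> r. z $ Inl r) (\<chi> r. z $ Inr r)"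

lemma all_lines_surj: "\<exists>z. view_lines C x y = all_lines z"
  by (rule exI[of _ "\<chi> k. case k of Inl r \<Rightarrow> x $ r | Inr r \<Rightarrow> y $ r"]) (simp add: all_lines_def)

lemma line_multiview_variety_eq: "line_multiview_variety C = param_variety all_lines"
proof -
  have "{point_of (view_lines C x y) | x y. \<forall>i. block i (view_lines C x y) \<noteq> 0} =
      {point_of (all_lines z) | z. \<forall>i. block i (all_lines z) \<noteq> 0}"
  proof safe
    fix x y assume "\<forall>i. block i (view_lines C x y) \<noteq> 0"
    then show "\<exists>z. point_of (view_lines C x y) = point_of (all_lines z) \<and> (\<forall>i. block i (all_lines z) \<noteq> 0)"
      using all_lines_surj[of x y] by metis
  next
    fix z assume "\<forall>i. block i (all_lines z) \<noteq> 0"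
    then show "\<exists>x y. point_of (all_lines z) = point_of (view_lines C x y) \<and> (\<forall>i. block i (view_lines C x y) \<noteq> 0)"
      unfolding all_lines_def by blast
  qed
  then show ?thesis
    unfolding line_multiview_variety_def image_of_joint_camera_map param_variety_def by simp
qed

lemma polynomial_map_all_lines: "polynomial_map all_lines"
  unfolding all_lines_def by (rule polynomial_map_view_lines) (auto intro: polynomial_fun.coordinate)

text \<open>
  Each condition is that a polynomial in the eight parameters is nonzero, and finitely many nonzero
  polynomials have a common point where none vanishes.
\<close>

lemma generic_line:
  assumes "\<And>i. w i \<noteq> 0"
  shows "\<exists>x y. \<forall>i. scalar_product (cross (C i *v x) (C i *v y)) (w i) \<noteq> 0"
proof -
  define f where "f = (\<lambda>i z. scalar_product (block i (all_lines z)) (w i))"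
  have "\<exists>z. \<forall>i\<in>UNIV. f i z \<noteq> 0"
  proof (rule polynomial_fun_common_nonzero)
    show "polynomial_fun (f i)" for i
      unfolding f_def scalar_product_def using polynomial_map_component[OF polynomial_map_all_lines]
      by (auto intro!: polynomial_fun_sum polynomial_fun.mult polynomial_fun.const)
    show "\<exists>z. f i z \<noteq> 0" for i
    proof -
      obtain u v where uv: "scalar_product (cross u v) (w i) \<noteq> 0"
        using ex_cross_scalar_product_nonzero[OF assms] by blast
      obtain x y where "C i *v x = u" "C i *v y = v" using camera_surj by metis
      moreover obtain z where "view_lines C x y = all_lines z" using all_lines_surj by blast
      ultimately have "f i z \<noteq> 0" using uv block_view_lines[of i C x y] by (simp add: f_def)
      then show ?thesis by blast
    qed
  qed simp
  then show ?thesis unfolding f_def all_lines_def by auto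
qed

end

section \<open>An affine chart of the line multiview variety\<close>

text \<open>
  A generic pair \<open>b1, b2\<close> spans a line that avoids all centers and is skew to the line joining the
  two centers \<open>c i1\<close> and \<open>c i2\<close>.  The lines that do not meet the latter are then parametrised by
  \<open>complex^4\<close>: they are spanned by \<open>b1\<close> and \<open>b2\<close>, each moved by a combination of the two centers.
\<close>

locale camera_chart = cameras C c for C :: "'m::finite \<Rightarrow> complex^4^3" and c +
  fixes i1 i2 :: 'm and b1 b2 :: "complex^4"
  assumes i1_neq_i2: "i1 \<noteq> i2"
    and base_1: "scalar_product (cross (C i1 *v b1) (C i1 *v b2)) (C i1 *v c i2) \<noteq> 0"
    and base_2: "scalar_product (cross (C i2 *v b1) (C i2 *v b2)) (C i2 *v c i1) \<noteq> 0"
    and base_line: "cross (C i *v b1) (C i *v b2) \<noteq> 0"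
begin

definition chart_x :: "complex^4 \<Rightarrow> complex^4" where
  "chart_x a = b1 + a$1 *s c i1 + a$2 *s c i2"

definition chart_y :: "complex^4 \<Rightarrow> complex^4" where
  "chart_y a = b2 + a$3 *s c i1 + a$4 *s c i2"

definition chart :: "complex^4 \<Rightarrow> complex^('m \<times> 3)" where
  "chart a = view_lines C (chart_x a) (chart_y a)"

lemma block_chart: "block i (chart a) = cross (C i *v chart_x a) (C i *v chart_y a)"
  by (simp add: chart_def)

lemma polynomial_map_chart: "polynomial_map chart"
proof -
  have "polynomial_fun (\<lambda>a. chart_x a $ k)" "polynomial_fun (\<lambda>a. chart_y a $ k)" for k
    unfolding chart_x_def chart_y_def
    by (auto intro!: polynomial_fun.add polynomial_fun.mult polynomial_fun.const polynomial_fun.coordinate)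
  then show ?thesis unfolding chart_def by (rule polynomial_map_view_lines)
qed

lemma chart_0: "block i (chart 0) \<noteq> 0"
  by (simp add: block_chart chart_x_def chart_y_def base_line)

lemma frame_independent:
  assumes "p *s b1 + q *s b2 + r *s c i1 + s *s c i2 = 0"
  shows "p = 0 \<and> q = 0 \<and> r = 0 \<and> s = 0"
proof -
  have "C i1 *v (p *s b1 + q *s b2 + r *s c i1 + s *s c i2) = 0" by (simp add: assms)
  then have 0: "p *s (C i1 *v b1) + q *s (C i1 *v b2) + s *s (C i1 *v c i2) = 0"
    by (simp add: matrix_vector_linear)
  let ?u = "C i1 *v b1" and ?v = "C i1 *v b2" and ?w = "C i1 *v c i2"
  have tp: "scalar_product (cross ?u ?v) ?w \<noteq> 0" by (rule base_1)
  have "s * scalar_product (cross ?u ?v) ?w = scalar_product (cross ?u ?v) (p *s ?u + q *s ?v + s *s ?w)"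
    "q * scalar_product (cross ?u ?v) ?w = - scalar_product (cross ?u ?w) (p *s ?u + q *s ?v + s *s ?w)"
    "p * scalar_product (cross ?u ?v) ?w = scalar_product (cross ?v ?w) (p *s ?u + q *s ?v + s *s ?w)"
    by (simp_all add: scalar_product_3 algebra_simps)
  then have "s * scalar_product (cross ?u ?v) ?w = 0" "q * scalar_product (cross ?u ?v) ?w = 0"
    "p * scalar_product (cross ?u ?v) ?w = 0"
    unfolding 0 by (simp_all only: scalar_product_linear minus_zero)
  then have pqs: "p = 0" "q = 0" "s = 0" using tp by simp_all
  then have "r *s c i1 = 0" using assms by simp
  then show ?thesis using pqs center_nonzero[of i1] by simp
qed

lemma frame_span: "\<exists>p q r s. x = p *s b1 + q *s b2 + r *s c i1 + s *s c i2"
  using frame_independent by (rule independent_four_span)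

text \<open>
  For a generic line the coefficients of \<open>b1\<close> and \<open>b2\<close> in a spanning pair form an invertible matrix; a
  change of the spanning pair then brings the line into the form of the chart.  The determinant \<open>\<delta>\<close> of
  that matrix is a nonzero polynomial and can be cancelled, so a form that vanishes on the chart
  vanishes on all lines.
\<close>

lemma chart_dense:
  assumes f: "multihomogeneous f" and chart0: "\<And>a. f (chart a) = 0"
  shows "f (view_lines C x y) = 0"
proof -
  define X where "X = (\<lambda>z :: complex^(4 + 4). z$Inl 1 *s b1 + z$Inl 2 *s b2 + z$Inl 3 *s c i1 + z$Inl 4 *s c i2)"
  define Y where "Y = (\<lambda>z :: complex^(4 + 4). z$Inr 1 *s b1 + z$Inr 2 *s b2 + z$Inr 3 *s c i1 + z$Inr 4 *s c i2)"
  define \<delta> where "\<delta> = (\<lambda>z :: complex^(4 + 4). z$Inl 1 * z$Inr 2 - z$Inl 2 * z$Inr 1)"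
  have poly: "polynomial_fun (\<lambda>z. f (view_lines C (X z) (Y z)))"
  proof (rule polynomial_fun_compose)
    show "polynomial_fun f" using f by (simp add: multihomogeneous_def)
    have "polynomial_map (\<lambda>z. view_lines C (X z) (Y z))"
      by (rule polynomial_map_view_lines)
        (auto simp: X_def Y_def intro!: polynomial_fun.add polynomial_fun.mult polynomial_fun.const polynomial_fun.coordinate)
    then show "polynomial_fun (\<lambda>z. view_lines C (X z) (Y z) $ k)" for k
      by (rule polynomial_map_component)
  qed
  have zero: "f (view_lines C (X z) (Y z)) * \<delta> z = 0" for z
  proof (cases "\<delta> z = 0")
    case False
    define a :: "complex^4" where "a = vector [
      (z$Inr 2 * z$Inl 3 - z$Inl 2 * z$Inr 3) / \<delta> z, (z$Inr 2 * z$Inl 4 - z$Inl 2 * z$Inr 4) / \<delta> z,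
      (z$Inl 1 * z$Inr 3 - z$Inr 1 * z$Inl 3) / \<delta> z, (z$Inl 1 * z$Inr 4 - z$Inr 1 * z$Inl 4) / \<delta> z]"
    have a: "a$1 * \<delta> z = z$Inr 2 * z$Inl 3 - z$Inl 2 * z$Inr 3" "a$2 * \<delta> z = z$Inr 2 * z$Inl 4 - z$Inl 2 * z$Inr 4"
      "a$3 * \<delta> z = z$Inl 1 * z$Inr 3 - z$Inr 1 * z$Inl 3" "a$4 * \<delta> z = z$Inl 1 * z$Inr 4 - z$Inr 1 * z$Inl 4"
      using False by (simp_all add: a_def vector_4)
    have cramer: "\<delta> z * (z$Inl 1 * a$1 + z$Inl 2 * a$3) = \<delta> z * z$Inl 3"
      "\<delta> z * (z$Inl 1 * a$2 + z$Inl 2 * a$4) = \<delta> z * z$Inl 4"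
      "\<delta> z * (z$Inr 1 * a$1 + z$Inr 2 * a$3) = \<delta> z * z$Inr 3"
      "\<delta> z * (z$Inr 1 * a$2 + z$Inr 2 * a$4) = \<delta> z * z$Inr 4"
    proof -
      have e: "\<delta> z * (p * s + q * t) = p * (s * \<delta> z) + q * (t * \<delta> z)" for p q s t
        by (simp add: algebra_simps)
      show "\<delta> z * (z$Inl 1 * a$1 + z$Inl 2 * a$3) = \<delta> z * z$Inl 3"
        "\<delta> z * (z$Inl 1 * a$2 + z$Inl 2 * a$4) = \<delta> z * z$Inl 4"
        "\<delta> z * (z$Inr 1 * a$1 + z$Inr 2 * a$3) = \<delta> z * z$Inr 3"
        "\<delta> z * (z$Inr 1 * a$2 + z$Inr 2 * a$4) = \<delta> z * z$Inr 4"
        unfolding e a by (simp_all add: \<delta>_def algebra_simps)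
    qed
    then have coeffs: "z$Inl 1 * a$1 + z$Inl 2 * a$3 = z$Inl 3" "z$Inl 1 * a$2 + z$Inl 2 * a$4 = z$Inl 4"
      "z$Inr 1 * a$1 + z$Inr 2 * a$3 = z$Inr 3" "z$Inr 1 * a$2 + z$Inr 2 * a$4 = z$Inr 4"
      using False by (simp_all only: mult_cancel_left) blast+
    have "X z = z$Inl 1 *s chart_x a + z$Inl 2 *s chart_y a" "Y z = z$Inr 1 *s chart_x a + z$Inr 2 *s chart_y a"
      by (simp_all add: X_def Y_def chart_x_def chart_y_def coeffs[symmetric] vec_eq_iff algebra_simps)
    then have "view_lines C (X z) (Y z) = scale_blocks (\<lambda>_. \<delta> z) (chart a)"
      by (simp add: view_lines_change_basis chart_def \<delta>_def)
    moreover have "f (scale_blocks t (chart a)) = 0" for t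
      using f chart0 by (auto simp: multihomogeneous_def)
    ultimately show ?thesis by simp
  qed simp
  have "polynomial_fun \<delta>"
    unfolding \<delta>_def by (intro polynomial_fun_diff polynomial_fun.mult polynomial_fun.coordinate)
  moreover have "\<delta> (\<chi> k. if k = Inl 1 \<or> k = Inr 2 then 1 else 0) \<noteq> 0" by (simp add: \<delta>_def)
  ultimately have 0: "f (view_lines C (X z) (Y z)) = 0" for z
    using polynomial_fun_cancel[OF poly _ _ zero] by blast
  obtain p q r s where x: "x = p *s b1 + q *s b2 + r *s c i1 + s *s c i2" using frame_span by blast
  obtain p' q' r' s' where y: "y = p' *s b1 + q' *s b2 + r' *s c i1 + s' *s c i2" using frame_span by blast
  show ?thesis
    using 0[of "\<chi> k. case k of Inl j \<Rightarrow> vector [p, q, r, s] $ j | Inr j \<Rightarrow> vector [p', q', r', s'] $ j"]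
    by (simp add: X_def Y_def vector_4 x y)
qed

lemma all_lines_nondegenerate: "\<exists>z. \<forall>i. block i (all_lines z) \<noteq> 0"
  using all_lines_surj[of b1 b2] base_line by (metis block_view_lines)

lemma line_multiview_variety_chart: "line_multiview_variety C = param_variety chart"
proof -
  obtain z0 where z0: "\<And>i. block i (all_lines z0) \<noteq> 0" using all_lines_nondegenerate by blast
  have "param_variety chart \<subseteq> param_variety all_lines"
  proof (rule param_variety_mono[OF polynomial_map_chart chart_0 polynomial_map_all_lines z0])
    fix f a assume "\<And>b. f (all_lines b) = (0 :: complex)"
    then show "f (chart a) = 0" using all_lines_surj unfolding chart_def by metis
  qed
  moreover have "param_variety all_lines \<subseteq> param_variety chart"
  proof (rule param_variety_mono[OF polynomial_map_all_lines z0 polynomial_map_chart chart_0])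
    fix f a assume "multihomogeneous f" "\<And>b. f (chart b) = (0 :: complex)"
    then show "f (all_lines a) = 0" using chart_dense unfolding all_lines_def by blast
  qed
  ultimately show ?thesis unfolding line_multiview_variety_eq by blast
qed

lemma vanishing_forms_iff:
  "f \<in> vanishing_forms (line_multiview_variety C) \<longleftrightarrow> multihomogeneous f \<and> (\<forall>a. f (chart a) = 0)"
  unfolding vanishing_forms_def line_multiview_variety_chart
  using vanishing_on_param_variety[OF polynomial_map_chart chart_0] by blast

lemma vanishing_forms_lines:
  "f \<in> vanishing_forms (line_multiview_variety C) \<Longrightarrow> f (view_lines C x y) = 0"
  unfolding vanishing_forms_iff by (blast intro: chart_dense)

lemma irreducible_line_multiview_variety: "irreducible_closed (line_multiview_variety C)"
  unfolding line_multiview_variety_chart by (rule irreducible_param_variety[OF polynomial_map_chart chart_0])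

text \<open>
  Adding a multiple of \<open>c i1\<close> to a point does not change its image in the view \<open>i1\<close>.  Therefore the
  \<open>i1\<close>-th block of the chart depends only on the coefficients of \<open>c i2\<close>, and these can be read off by
  pairing the block with the images of \<open>b1\<close> and \<open>b2\<close>.  The view \<open>i2\<close> yields the other two.
\<close>

lemma chart_coordinate_form:
  obtains g e where "multihomogeneous g" "e \<noteq> 0" "\<And>a. g (chart a) = e * a $ j"
proof -
  have C1: "C i1 *v chart_x a = C i1 *v b1 + a$2 *s (C i1 *v c i2)"
    "C i1 *v chart_y a = C i1 *v b2 + a$4 *s (C i1 *v c i2)" for a
    by (simp_all add: chart_x_def chart_y_def matrix_vector_linear)
  have C2: "C i2 *v chart_x a = C i2 *v b1 + a$1 *s (C i2 *v c i1)"
    "C i2 *v chart_y a = C i2 *v b2 + a$3 *s (C i2 *v c i1)" for a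
    by (simp_all add: chart_x_def chart_y_def matrix_vector_linear)
  let ?t1 = "scalar_product (cross (C i1 *v b1) (C i1 *v b2)) (C i1 *v c i2)"
  let ?t2 = "scalar_product (cross (C i2 *v b1) (C i2 *v b2)) (C i2 *v c i1)"
  have "scalar_product (block i2 (chart a)) (C i2 *v b1) = - ?t2 * a$1"
    "scalar_product (block i1 (chart a)) (C i1 *v b1) = - ?t1 * a$2"
    "scalar_product (block i2 (chart a)) (C i2 *v b2) = - ?t2 * a$3"
    "scalar_product (block i1 (chart a)) (C i1 *v b2) = - ?t1 * a$4" for a
    by (simp_all add: block_chart C1 C2 scalar_product_3 algebra_simps)
  moreover have "multihomogeneous (\<lambda>x. scalar_product (block i x) w)" for i :: 'm and w :: "complex^3"
    using multiform_block_functional unfolding multihomogeneous_iff by blast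
  moreover have "- ?t1 \<noteq> 0" "- ?t2 \<noteq> 0" using base_1 base_2 by simp_all
  ultimately show ?thesis using exhaust_4[of j] that by metis
qed

text \<open>
  The upper bound is the number of parameters of the chart.  For the lower bound, the images of a flag
  of coordinate subspaces form a chain; the forms of \<open>chart_coordinate_form\<close> separate its members.
\<close>

lemma krull_dim_line_multiview_variety: "krull_dim (line_multiview_variety C) = 4"
proof (rule antisym)
  have "krull_dim (line_multiview_variety C) \<le> enat CARD(4)"
    unfolding line_multiview_variety_chart by (rule krull_dim_param_variety_le[OF polynomial_map_chart chart_0])
  then show "krull_dim (line_multiview_variety C) \<le> 4" by (simp add: numeral_eq_enat)
next
  define pos :: "4 \<Rightarrow> nat" where "pos j = (if j = 1 then 0 else if j = 2 then 1 else if j = 3 then 2 else 3)" for j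
  define flag :: "nat \<Rightarrow> complex^4 \<Rightarrow> complex^('m \<times> 3)" where
    "flag k a = chart (\<chi> j. if pos j < k then a $ j else 0)" for k a
  have poly: "polynomial_map (flag k)" for k
    unfolding polynomial_map_def flag_def
  proof
    fix l
    have mask: "polynomial_fun (\<lambda>a. (\<chi> j. if pos j < k then a $ j else 0) $ i)" for i
      by (cases "pos i < k") (auto intro: polynomial_fun.const polynomial_fun.coordinate)
    show "polynomial_fun (\<lambda>a. chart (\<chi> j. if pos j < k then a $ j else 0) $ l)"
      by (rule polynomial_fun_compose[OF polynomial_map_component[OF polynomial_map_chart] mask])
  qed
  have flag_0: "block i (flag k 0) \<noteq> 0" for i k
  proof -
    have "(\<chi> j. if pos j < k then (0 :: complex^4) $ j else 0) = 0" by (simp add: vec_eq_iff)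
    then show ?thesis using chart_0 by (simp add: flag_def)
  qed
  have "enat 4 \<le> krull_dim (line_multiview_variety C)"
  proof (rule krull_dim_ge[of 4 "\<lambda>k. param_variety (flag k)"])
    show "irreducible_closed (param_variety (flag k))" for k
      by (rule irreducible_param_variety[OF poly flag_0])
    show "param_variety (flag k) \<subseteq> line_multiview_variety C" for k
      unfolding line_multiview_variety_chart
      by (rule param_variety_mono[OF poly flag_0 polynomial_map_chart chart_0]) (simp add: flag_def)
    show "param_variety (flag k) \<subset> param_variety (flag (Suc k))" if "k < 4" for k
    proof
      show "param_variety (flag k) \<subseteq> param_variety (flag (Suc k))"
      proof (rule param_variety_mono[OF poly flag_0 poly flag_0])
        fix f a assume 0: "\<And>b. f (flag (Suc k) b) = (0 :: complex)"
        have "flag k a = flag (Suc k) (\<chi> j. if pos j < k then a $ j else 0)"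
          unfolding flag_def by (rule arg_cong[of _ _ chart]) (auto simp: vec_eq_iff)
        then show "f (flag k a) = 0" using 0 by simp
      qed
      have "\<exists>j. pos j = k"
      proof -
        have "k \<in> {0, 1, 2, 3}" using that by auto
        moreover have "pos 1 = 0" "pos 2 = 1" "pos 3 = 2" "pos 4 = 3" by (simp_all add: pos_def)
        ultimately show ?thesis by auto
      qed
      then obtain j where j: "pos j = k" by blast
      obtain g e where g: "multihomogeneous g" "e \<noteq> 0" "\<And>a. g (chart a) = e * a $ j"
        using chart_coordinate_form by blast
      have "\<forall>a. g (flag k a) = 0" using j by (simp add: flag_def g)
      moreover have "g (flag (Suc k) 1) \<noteq> 0" using j g(2) by (simp add: flag_def g)
      ultimately show "param_variety (flag k) \<noteq> param_variety (flag (Suc k))"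
        using vanishing_on_param_variety[OF poly flag_0 g(1)] by metis
    qed
  qed
  then show "4 \<le> krull_dim (line_multiview_variety C)" by (simp add: numeral_eq_enat)
qed

text \<open>
  The curves \<open>a + t \<alpha>\<close> in the chart, combined with independent scalings \<open>1 + t \<beta>\<^sub>i\<close> of the blocks, have
  velocities in the tangent space, which gives a linear map from \<open>complex^('m + 4)\<close>.  It is injective:
  if a velocity vanishes, pairing its blocks \<open>i1\<close> and \<open>i2\<close> with the images of the two points that
  span the line gives \<open>\<alpha> = 0\<close>, and then \<open>\<beta> = 0\<close> since no block of the chart point is zero.
\<close>

lemma tangent_dimension_at_chart:
  assumes nd: "\<And>i. block i (chart a) \<noteq> 0"
  shows "CARD('m) + 4 \<le> vec.dim (cone_tangent_space (line_multiview_variety C) (point_of (chart a)))"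
proof -
  let ?q = "point_of (chart a)"
  obtain s where s: "\<And>i. s i \<noteq> 0" "hom_coords ?q = scale_blocks s (chart a)"
    using hom_coords_point_of[OF nd] by blast
  let ?x = "chart_x a" and ?y = "chart_y a"
  define dx where "dx = (\<lambda>v :: complex^('m + 4). v$Inr 1 *s c i1 + v$Inr 2 *s c i2)"
  define dy where "dy = (\<lambda>v :: complex^('m + 4). v$Inr 3 *s c i1 + v$Inr 4 *s c i2)"
  define \<psi> where "\<psi> = (\<lambda>v. scale_blocks s (scale_blocks (\<lambda>i. v$Inl i) (chart a) +
      (view_lines C (dx v) ?y + view_lines C ?x (dy v))))"
  have \<psi>_block: "block i (\<psi> v) = s i *s (v$Inl i *s cross (C i *v ?x) (C i *v ?y) +
      (cross (C i *v dx v) (C i *v ?y) + cross (C i *v ?x) (C i *v dy v)))" for i v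
    by (simp add: \<psi>_def block_scale_blocks block_chart)
  have "CARD('m + 4) \<le> vec.dim (cone_tangent_space (line_multiview_variety C) ?q)"
  proof (rule dim_ge_injective)
    show "Vector_Spaces.linear (*s) (*s) \<psi>"
    proof (rule vec_linearI; rule block_eqI)
      show "block i (\<psi> (v + w)) = block i (\<psi> v + \<psi> w)" for v w i
        by (simp add: \<psi>_block dx_def dy_def matrix_vector_linear cross_linear vec_eq_iff algebra_simps)
      show "block i (\<psi> (r *s v)) = block i (r *s \<psi> v)" for r v i
        by (simp add: \<psi>_block dx_def dy_def matrix_vector_linear cross_linear vec_eq_iff algebra_simps)
    qed
    \<comment> \<open>The factor \<open>s\<close> carries the chart point to the chosen homogeneous coordinates of its projective point.\<close>
    show "\<psi> v \<in> cone_tangent_space (line_multiview_variety C) ?q" for v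
    proof (rule velocity_in_cone_tangent_space)
      define \<gamma> where "\<gamma> = (\<lambda>t. scale_blocks (\<lambda>i. s i * (1 + t * v$Inl i))
          (view_lines C (?x + t *s dx v) (?y + t *s dy v)))"
      have \<gamma>_chart: "\<gamma> t = scale_blocks (\<lambda>i. s i * (1 + t * v$Inl i)) (chart (a + t *s (\<chi> j. v$Inr j)))" for t
        unfolding \<gamma>_def chart_def
        by (rule arg_cong2[of _ _ _ _ scale_blocks] arg_cong2[of _ _ _ _ "view_lines C"] refl)+
          (simp_all add: chart_x_def chart_y_def dx_def dy_def vec_eq_iff algebra_simps)
      show "\<gamma> 0 = hom_coords ?q" by (simp add: \<gamma>_chart s)
      show "f (\<gamma> t) = 0" if "f \<in> vanishing_forms (line_multiview_variety C)" for f t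
        using that unfolding vanishing_forms_iff \<gamma>_chart by (auto simp: multihomogeneous_def)
      show "((\<lambda>t. \<gamma> t $ k) has_field_derivative \<psi> v $ k) (at 0)" for k
      proof -
        obtain i j where k: "k = (i, j)" by (cases k)
        let ?E = "cross (C i *v dx v) (C i *v dy v)"
        have "\<gamma> t $ k = s i * ((1 + t * v$Inl i) * (cross (C i *v ?x) (C i *v ?y) $ j +
            t * (cross (C i *v dx v) (C i *v ?y) $ j + cross (C i *v ?x) (C i *v dy v) $ j) + t^2 * ?E $ j))" for t
          by (simp add: \<gamma>_def k view_lines_def matrix_vector_linear cross_linear power2_eq_square algebra_simps)
        moreover have "\<psi> v $ k = s i * (v$Inl i * cross (C i *v ?x) (C i *v ?y) $ j +
            (cross (C i *v dx v) (C i *v ?y) $ j + cross (C i *v ?x) (C i *v dy v) $ j))"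
          using arg_cong[OF \<psi>_block[of i v], of "\<lambda>u. u $ j"] by (simp add: k distrib_left)
        ultimately show ?thesis
          by (auto intro!: derivative_eq_intros)
      qed
    qed
    show "v = 0" if 0: "\<psi> v = 0" for v
    proof -
      have eq: "v$Inl i *s cross (C i *v ?x) (C i *v ?y) +
          (cross (C i *v dx v) (C i *v ?y) + cross (C i *v ?x) (C i *v dy v)) = 0" for i
      proof -
        have "block i (\<psi> v) = 0" using 0 by simp
        then show ?thesis using s(1)[of i] unfolding \<psi>_block vector_mul_eq_0 by blast
      qed
      have X: "scalar_product (cross (C i *v dx v) (C i *v ?y)) (C i *v ?x) = 0"
        and Y: "scalar_product (cross (C i *v ?x) (C i *v dy v)) (C i *v ?y) = 0" for i
        using arg_cong[OF eq[of i], of "\<lambda>u. scalar_product u (C i *v ?x)"]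
          arg_cong[OF eq[of i], of "\<lambda>u. scalar_product u (C i *v ?y)"]
        by (simp_all add: scalar_product_linear)
      let ?t1 = "scalar_product (cross (C i1 *v b1) (C i1 *v b2)) (C i1 *v c i2)"
      let ?t2 = "scalar_product (cross (C i2 *v b1) (C i2 *v b2)) (C i2 *v c i1)"
      have "- (v$Inr 2 * ?t1) = scalar_product (cross (C i1 *v dx v) (C i1 *v ?y)) (C i1 *v ?x)"
        "- (v$Inr 4 * ?t1) = scalar_product (cross (C i1 *v ?x) (C i1 *v dy v)) (C i1 *v ?y)"
        "- (v$Inr 1 * ?t2) = scalar_product (cross (C i2 *v dx v) (C i2 *v ?y)) (C i2 *v ?x)"
        "- (v$Inr 3 * ?t2) = scalar_product (cross (C i2 *v ?x) (C i2 *v dy v)) (C i2 *v ?y)"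
        by (simp_all add: dx_def dy_def chart_x_def chart_y_def matrix_vector_linear scalar_product_3 algebra_simps)
      then have r: "v$Inr 1 = 0" "v$Inr 2 = 0" "v$Inr 3 = 0" "v$Inr 4 = 0"
        using X Y base_1 base_2 by auto
      then have "dx v = 0" "dy v = 0" by (simp_all add: dx_def dy_def)
      then have "v$Inl i *s cross (C i *v ?x) (C i *v ?y) = 0" for i
        using eq[of i] by (simp add: cross_linear)
      then have "v$Inl i = 0" for i using nd[of i] by (metis block_chart vector_mul_eq_0)
      moreover have "v$Inr j = 0" for j using exhaust_4[of j] r by auto
      ultimately show "v = 0" by (metis (no_types) sum.exhaust vec_eq_iff zero_index)
    qed
  qed
  then show ?thesis by simp
qed

text \<open>
  The bound passes from the chart to its closure, because a form that is nonzero at a point of the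
  closure is nonzero at some point of the chart.
\<close>

lemma tangent_dimension_ge:
  assumes p: "p \<in> line_multiview_variety C"
  shows "CARD('m) + 4 \<le> vec.dim (cone_tangent_space (line_multiview_variety C) p)"
proof -
  obtain D where D: "multihomogeneous D" "D (hom_coords p) \<noteq> 0" "\<And>q. D (hom_coords q) \<noteq> 0 \<Longrightarrow>
       vec.dim (cone_tangent_space (line_multiview_variety C) q) \<le>
       vec.dim (cone_tangent_space (line_multiview_variety C) p)"
    using tangent_dimension_semicontinuous by blast
  obtain a where "\<forall>i. block i (chart a) \<noteq> 0" "D (hom_coords (point_of (chart a))) \<noteq> 0"
    using p D(1,2) unfolding line_multiview_variety_chart param_variety_def mem_zariski_closure by blast
  then show ?thesis using tangent_dimension_at_chart[of a] D(3) le_trans by blast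
qed

end

lemma (in cameras) camera_chart_exists:
  assumes "i1 \<noteq> i2"
  obtains b1 b2 where "camera_chart C c i1 i2 b1 b2"
proof -
  define w where "w = (\<lambda>i. if i = i1 then C i1 *v c i2 else if i = i2 then C i2 *v c i1 else axis 1 1)"
  have "w i \<noteq> 0" for i
    using distinct_centers[of i1 i2] distinct_centers[of i2 i1] assms
    by (auto simp: w_def axis_eq_0_iff)
  then obtain x y where xy: "\<And>i. scalar_product (cross (C i *v x) (C i *v y)) (w i) \<noteq> 0"
    using generic_line by blast
  have "camera_chart C c i1 i2 x y"
  proof unfold_locales
    show "cross (C i *v x) (C i *v y) \<noteq> 0" for i
      using xy[of i] by (auto simp: scalar_product_linear)
  qed (use xy[of i1] xy[of i2] assms in \<open>auto simp: w_def\<close>)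
  then show ?thesis using that by blast
qed

section \<open>Equations of the tangent space\<close>

context cameras
begin

text \<open>
  The back-projected plane of the \<open>k\<close>-th block, as a linear form.  It is linear in the block too, so the
  same notation serves for tangent vectors.
\<close>

definition plane :: "'m \<Rightarrow> complex^('m \<times> 3) \<Rightarrow> complex^4 \<Rightarrow> complex" where
  "plane k x w = scalar_product (block k x) (C k *v w)"

lemma plane_linear:
  "plane k x (w + w') = plane k x w + plane k x w'" "plane k x (w - w') = plane k x w - plane k x w'"
  "plane k x (s *s w) = s * plane k x w"
  "plane k (x + y) w = plane k x w + plane k y w" "plane k (s *s x) w = s * plane k x w"
  by (simp_all add: plane_def matrix_vector_linear scalar_product_linear)

lemma plane_center [simp]: "plane k x (c k) = 0"
  by (simp add: plane_def scalar_product_linear)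

lemma plane_eq_0: "(\<And>w. plane k x w = 0) \<Longrightarrow> block k x = 0"
  using camera_surj scalar_product_nondegenerate unfolding plane_def by metis

lemma plane_hom_coords_nonzero: "\<exists>w. plane k (hom_coords p) w \<noteq> 0"
  using plane_eq_0 rep_proj_nonzero by (metis block_hom_coords)

text \<open>
  The determinant of the matrix of the values of the planes \<open>i, j, k\<close> at \<open>z1, z2, z3\<close>, a combination of
  \<open>3 \<times> 3\<close> minors of the matrix of back-projected planes.
\<close>

definition minor :: "'m \<Rightarrow> 'm \<Rightarrow> 'm \<Rightarrow> complex^4 \<Rightarrow> complex^4 \<Rightarrow> complex^4 \<Rightarrow> complex^('m \<times> 3) \<Rightarrow> complex" where
  "minor i j k z1 z2 z3 x =
     plane i x z1 * (plane j x z2 * plane k x z3) - plane i x z1 * (plane j x z3 * plane k x z2)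
   + (plane i x z2 * (plane j x z3 * plane k x z1) - plane i x z2 * (plane j x z1 * plane k x z3))
   + (plane i x z3 * (plane j x z1 * plane k x z2) - plane i x z3 * (plane j x z2 * plane k x z1))"

lemma multihomogeneous_minor: "multihomogeneous (minor i j k z1 z2 z3)"
proof -
  let ?d = "\<lambda>i l. if l = i then 1 else 0 :: nat"
  have plane: "multiform (?d k) (\<lambda>x. plane k x w)" for k w
    unfolding plane_def by (rule multiform_block_functional)
  have prod: "multiform (\<lambda>l. ?d i l + (?d j l + ?d k l)) (\<lambda>x. plane i x u * (plane j x v * plane k x w))" for u v w
    by (intro multiform_mult plane)
  have diff: "multiform (\<lambda>l. ?d i l + (?d j l + ?d k l)) (\<lambda>x. plane i x u * (plane j x v * plane k x w) -
      plane i x u' * (plane j x v' * plane k x w'))" for u v w u' v' w'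
    using multiform_add[OF prod multiform_cmult[OF prod, of "-1"]] by simp
  show ?thesis
    unfolding multihomogeneous_iff minor_def
    by (intro exI[of _ "\<lambda>l. ?d i l + (?d j l + ?d k l)"] multiform_add diff)
qed

end

context camera_chart
begin

text \<open>
  The planes of a line \<open>L\<close> all vanish on \<open>L\<close>.  Modulo \<open>L\<close> every vector is a combination of two fixed
  ones, so the matrix of values is a sum of two products of a column and a row.
\<close>

lemma minor_vanishes: "minor i j k z1 z2 z3 \<in> vanishing_forms (line_multiview_variety C)"
  unfolding vanishing_forms_iff
proof (intro conjI allI multihomogeneous_minor)
  fix a
  have vanish: "plane l (chart a) (chart_x a) = 0" "plane l (chart a) (chart_y a) = 0" for l
    by (simp_all add: plane_def block_chart)
  have "\<exists>s t. \<forall>l. plane l (chart a) z = s * plane l (chart a) (c i1) + t * plane l (chart a) (c i2)" for z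
  proof -
    obtain p q r s where z: "z = p *s b1 + q *s b2 + r *s c i1 + s *s c i2" using frame_span by blast
    have "z = p *s chart_x a + q *s chart_y a + (r - p * a$1 - q * a$3) *s c i1 + (s - p * a$2 - q * a$4) *s c i2"
      by (simp add: z chart_x_def chart_y_def vec_eq_iff algebra_simps)
    then have "plane l (chart a) z = (r - p * a$1 - q * a$3) * plane l (chart a) (c i1)
        + (s - p * a$2 - q * a$4) * plane l (chart a) (c i2)" for l
      by (simp only: plane_linear vanish) simp
    then show ?thesis by blast
  qed
  then obtain s t where st: "\<And>l z. plane l (chart a) z = s z * plane l (chart a) (c i1) + t z * plane l (chart a) (c i2)"
    by metis
  show "minor i j k z1 z2 z3 (chart a) = 0"
    unfolding minor_def st[of _ z1] st[of _ z2] st[of _ z3] by algebra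
qed

text \<open>
  With \<open>z1, z2\<close> dual to the planes \<open>i\<close> and \<open>j\<close>, and \<open>w\<close> on the common line, the third column of
  the matrix of \<open>minor\<close> vanishes at \<open>p\<close>.  Hence only this column needs to be differentiated, and the
  derivative of the determinant in direction \<open>v\<close> is the difference of the two sides.
\<close>

lemma tangent_relation:
  assumes v: "v \<in> cone_tangent_space (line_multiview_variety C) p"
    and z1: "plane i (hom_coords p) z1 = 1" "plane j (hom_coords p) z1 = 0"
    and z2: "plane i (hom_coords p) z2 = 0" "plane j (hom_coords p) z2 = 1"
    and w: "\<And>l. plane l (hom_coords p) w = 0"
  shows "plane k v w = plane k (hom_coords p) z1 * plane i v w + plane k (hom_coords p) z2 * plane j v w"
proof -
  let ?h = "hom_coords p"
  let ?f = "minor i j k z1 z2 w"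
  have "\<exists>E2 E3. \<forall>t. ?f (?h + t *s v) =
      (plane k v w - plane k ?h z1 * plane i v w - plane k ?h z2 * plane j v w) * t + E2 * t^2 + E3 * t^3"
  proof (intro exI allI)
    fix t
    let ?a1 = "plane i v z1" and ?a2 = "plane i v z2" and ?a3 = "plane i v w"
    let ?b1 = "plane j v z1" and ?b2 = "plane j v z2" and ?b3 = "plane j v w"
    let ?c1 = "plane k v z1" and ?c2 = "plane k v z2" and ?c3 = "plane k v w"
    let ?\<alpha> = "plane k ?h z1" and ?\<beta> = "plane k ?h z2"
    show "?f (?h + t *s v) = (?c3 - ?\<alpha> * ?a3 - ?\<beta> * ?b3) * t
      + (?a1 * (?c3 - ?b3 * ?\<beta>) + ?b2 * ?c3 - ?b3 * ?c2 + ?a2 * ?b3 * ?\<alpha> + ?a3 * (?b1 * ?\<beta> - ?b2 * ?\<alpha> - ?c1)) * t^2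
      + (?a1 * (?b2 * ?c3 - ?b3 * ?c2) + ?a2 * (?b3 * ?c1 - ?b1 * ?c3) + ?a3 * (?b1 * ?c2 - ?b2 * ?c1)) * t^3"
      unfolding minor_def plane_linear z1 z2 w by algebra
  qed
  then obtain E2 E3 where "\<And>t. ?f (?h + t *s v) =
      (plane k v w - plane k ?h z1 * plane i v w - plane k ?h z2 * plane j v w) * t + E2 * t^2 + E3 * t^3"
    by blast
  then have "((\<lambda>t. ?f (?h + t *s v)) has_field_derivative
      plane k v w - plane k ?h z1 * plane i v w - plane k ?h z2 * plane j v w) (at 0)"
    by (auto intro!: derivative_eq_intros)
  moreover have "deriv (\<lambda>t. ?f (?h + t *s v)) 0 = 0"
    using v minor_vanishes[of i j k z1 z2 w] unfolding cone_tangent_space_def vanishing_forms_def by blast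
  ultimately show ?thesis by (auto dest: DERIV_imp_deriv simp: algebra_simps)
qed

text \<open>
  The vanishing of \<open>minor\<close> itself, expanded along the dual vectors \<open>z1, z2\<close>.
\<close>

lemma rank_two_relation:
  assumes p: "p \<in> line_multiview_variety C"
    and z1: "plane i (hom_coords p) z1 = 1" "plane j (hom_coords p) z1 = 0"
    and z2: "plane i (hom_coords p) z2 = 0" "plane j (hom_coords p) z2 = 1"
  shows "plane k (hom_coords p) w = plane k (hom_coords p) z1 * plane i (hom_coords p) w
      + plane k (hom_coords p) z2 * plane j (hom_coords p) w"
proof -
  have "minor i j k z1 z2 w (hom_coords p) = 0"
    using minor_vanishes p unfolding vanishing_forms_def by blast
  then show ?thesis unfolding minor_def z1 z2 by (simp add: algebra_simps)
qed

end

locale noncollinear_chart = camera_chart C c i1 i2 b1 b2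
  for C :: "'m::finite \<Rightarrow> complex^4^3" and c i1 i2 b1 b2 +
  assumes noncollinear:
    "\<And>i j k. i \<noteq> j \<Longrightarrow> i \<noteq> k \<Longrightarrow> j \<noteq> k \<Longrightarrow> cross (C i *v c j) (C i *v c k) \<noteq> 0"
begin

text \<open>
  Let \<open>L\<close> be the common line of the back-projected planes and \<open>S\<close> the set of cameras with center on
  \<open>L\<close>.  The goal is a list of \<open>m + 4\<close> linear functionals whose only common zero in the tangent space is
  the zero vector.

  If \<open>S \<subseteq> {i, j}\<close> with planes \<open>i, j\<close> independent, take the six coordinates of the blocks \<open>i\<close> and \<open>j\<close>.  If
  these vanish, every other plane form of \<open>v\<close> is zero on \<open>L\<close> by \<open>tangent_relation\<close> and on its center, hence
  on the three-dimensional kernel of \<open>plane k\<close>, and its value at one further vector \<open>\<zeta> k\<close> decides.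

  Otherwise \<open>S = {i, l}\<close> consists of two cameras with the same plane; \<open>tangent_relation\<close> then has
  \<open>\<beta> = 0\<close> for \<open>l\<close> and at \<open>c l\<close> it says that the form of \<open>v\<close> in block \<open>i\<close> vanishes at \<open>c l\<close>.  As \<open>L\<close> is spanned
  by \<open>c i\<close> and \<open>c l\<close>, two functionals suffice for each of the blocks \<open>i\<close> and \<open>l\<close>, and three for a
  block \<open>j\<close> with an independent plane.
\<close>

lemma tangent_dimension_le:
  assumes p: "p \<in> line_multiview_variety C"
    and rank: "\<And>i. \<exists>j. \<not> (\<exists>s. \<forall>w. plane j (hom_coords p) w = s * plane i (hom_coords p) w)"
  shows "vec.dim (cone_tangent_space (line_multiview_variety C) p) \<le> CARD('m) + 4"
proof -
  let ?h = "hom_coords p"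
  let ?T = "cone_tangent_space (line_multiview_variety C) p"
  define L where "L = {w. \<forall>k. plane k ?h w = 0}"
  define S where "S = {k. c k \<in> L}"
  have "\<forall>k. \<exists>w. plane k ?h w \<noteq> 0" using plane_hom_coords_nonzero by blast
  from choice[OF this] obtain \<zeta> where \<zeta>: "\<And>k. plane k ?h (\<zeta> k) \<noteq> 0" by blast
  have dual_basis: "\<exists>z1 z2. plane i ?h z1 = 1 \<and> plane j ?h z1 = 0 \<and> plane i ?h z2 = 0 \<and> plane j ?h z2 = 1"
    if ij: "\<not> (\<exists>s. \<forall>w. plane j ?h w = s * plane i ?h w)" for i j
  proof -
    define z where "z = (1 / plane i ?h (\<zeta> i)) *s \<zeta> i"
    have z: "plane i ?h z = 1" using \<zeta>[of i] by (simp add: z_def plane_linear)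
    obtain y where y: "plane j ?h y \<noteq> plane j ?h z * plane i ?h y" using ij by blast
    define d where "d = plane j ?h y - plane j ?h z * plane i ?h y"
    define z2 where "z2 = (1 / d) *s (y - plane i ?h y *s z)"
    have d: "d \<noteq> 0" using y by (simp add: d_def)
    have "plane i ?h (y - plane i ?h y *s z) = 0" "plane j ?h (y - plane i ?h y *s z) = d"
      using z by (simp_all add: plane_linear d_def)
    then have z2: "plane i ?h z2 = 0" "plane j ?h z2 = 1"
      using d unfolding z2_def plane_linear(3) by simp_all
    show ?thesis
      by (intro exI[of _ "z - plane j ?h z *s z2"] exI[of _ z2]) (simp add: plane_linear z z2)
  qed
  \<comment> \<open>The vectors dual to two independent planes are a complement of \<open>L\<close>, so \<open>L\<close> is two-dimensional.\<close>
  have L_span: "\<exists>s t. w = s *s u1 + t *s u2"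
    if L: "u1 \<in> L" "u2 \<in> L" "w \<in> L" and ind: "\<And>s t. s *s u1 + t *s u2 = 0 \<Longrightarrow> s = 0 \<and> t = 0" for u1 u2 w
  proof -
    obtain i j where "\<not> (\<exists>s. \<forall>w. plane j ?h w = s * plane i ?h w)" using rank by blast
    from dual_basis[OF this] obtain z1 z2 where z: "plane i ?h z1 = 1" "plane j ?h z1 = 0"
      "plane i ?h z2 = 0" "plane j ?h z2 = 1" by blast
    have "\<exists>a b s t. w = a *s z1 + b *s z2 + s *s u1 + t *s u2"
    proof (rule independent_four_span)
      fix a b s t assume 0: "a *s z1 + b *s z2 + s *s u1 + t *s u2 = 0"
      have lin: "plane l ?h (a *s z1 + b *s z2 + s *s u1 + t *s u2) = a * plane l ?h z1 + b * plane l ?h z2" for l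
        using L by (simp add: plane_linear L_def)
      have "a = 0" "b = 0" using lin[of i] lin[of j] z unfolding 0 by (simp_all add: plane_def scalar_product_linear)
      then show "a = 0 \<and> b = 0 \<and> s = 0 \<and> t = 0" using 0 ind by simp
    qed
    then obtain a b s t where w: "w = a *s z1 + b *s z2 + s *s u1 + t *s u2" by blast
    have lin: "plane l ?h w = a * plane l ?h z1 + b * plane l ?h z2" for l
      using L(1,2) unfolding w by (simp add: plane_linear L_def)
    have "plane l ?h w = 0" for l using L(3) by (simp add: L_def)
    then have "a = 0" "b = 0" using lin[of i] lin[of j] z by simp_all
    then show ?thesis using w by auto
  qed
  have centers_independent: "s = 0 \<and> t = 0" if "k \<noteq> l" "s *s c k + t *s c l = 0" for k l s t
  proof -
    have "C k *v (s *s c k + t *s c l) = 0" "C l *v (s *s c k + t *s c l) = 0" by (simp_all add: that(2))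
    then show ?thesis
      using distinct_centers[of k l] distinct_centers[of l k] that(1) by (simp add: matrix_vector_linear)
  qed
  have two: "k = l \<or> k = r \<or> l = r" if "k \<in> S" "l \<in> S" "r \<in> S" for k l r
  proof (rule ccontr)
    assume *: "\<not> ?thesis"
    have "c k \<in> L" "c l \<in> L" "c r \<in> L" using that by (simp_all add: S_def)
    then obtain s t where "c r = s *s c k + t *s c l"
      using L_span[of "c k" "c l" "c r"] centers_independent[of k l] * by blast
    then have "C k *v c r = t *s (C k *v c l)" by (simp add: matrix_vector_linear)
    then have "cross (C k *v c l) (C k *v c r) = 0" by (simp add: cross_linear)
    then show False using noncollinear[of k l r] * by auto
  qed
  have sub: "vec.subspace ?T" by (rule subspace_cone_tangent_space)
  have plane_lin: "plane k (v + v') w = plane k v w + plane k v' w" "plane k (s *s v) w = s * plane k v w" for k v v' w s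
    by (simp_all add: plane_linear)
  \<comment> \<open>If \<open>c k\<close> is not on \<open>L\<close>, then \<open>L\<close> and \<open>c k\<close> span the plane \<open>k\<close>, and \<open>\<zeta> k\<close> lies outside that plane.\<close>
  have block_zero: "block k v = 0"
    if z: "plane i ?h z1 = 1" "plane j ?h z1 = 0" "plane i ?h z2 = 0" "plane j ?h z2 = 1"
      and k: "k \<notin> S" and L0: "\<And>w. w \<in> L \<Longrightarrow> plane k v w = 0" and \<zeta>0: "plane k v (\<zeta> k) = 0" for i j z1 z2 k v
  proof (rule plane_eq_0)
    fix w
    let ?A = "plane i ?h (c k)" and ?B = "plane j ?h (c k)"
    let ?\<alpha> = "plane k ?h z1" and ?\<beta> = "plane k ?h z2"
    note rel = rank_two_relation[OF p z]
    have in_L: "u \<in> L \<longleftrightarrow> plane i ?h u = 0 \<and> plane j ?h u = 0" for u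
    proof
      assume 0: "plane i ?h u = 0 \<and> plane j ?h u = 0"
      have "plane l ?h u = 0" for l using rel[of l u] 0 by simp
      then show "u \<in> L" by (simp add: L_def)
    qed (simp add: L_def)
    define w' where "w' = w - (plane k ?h w / plane k ?h (\<zeta> k)) *s \<zeta> k"
    have w': "plane k ?h w' = 0" "plane k v w' = plane k v w"
      using \<zeta>[of k] \<zeta>0 by (simp_all add: w'_def plane_linear)
    have "\<exists>s. w' - s *s c k \<in> L"
    proof (cases "?A = 0")
      case False
      define u where "u = w' - (plane i ?h w' / ?A) *s c k"
      have u: "plane i ?h u = 0" "plane k ?h u = 0" using False w' by (simp_all add: u_def plane_linear)
      have "?\<beta> \<noteq> 0"
      proof
        assume "?\<beta> = 0"
        then have "?\<alpha> = 0" using rel[of k "c k"] False by simp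
        then show False using rel[of k "\<zeta> k"] \<open>?\<beta> = 0\<close> \<zeta>[of k] by simp
      qed
      then have "plane j ?h u = 0" using rel[of k u] u by simp
      then show ?thesis using u in_L unfolding u_def by blast
    next
      case True
      then have B: "?B \<noteq> 0" using k in_L by (simp add: S_def)
      define u where "u = w' - (plane j ?h w' / ?B) *s c k"
      have u: "plane j ?h u = 0" "plane k ?h u = 0" using B w' by (simp_all add: u_def plane_linear)
      have "?\<alpha> \<noteq> 0"
      proof
        assume "?\<alpha> = 0"
        then have "?\<beta> = 0" using rel[of k "c k"] B by simp
        then show False using rel[of k "\<zeta> k"] \<open>?\<alpha> = 0\<close> \<zeta>[of k] by simp
      qed
      then have "plane i ?h u = 0" using rel[of k u] u by simp
      then show ?thesis using u in_L unfolding u_def by blast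
    qed
    then obtain s where "w' - s *s c k \<in> L" by blast
    then have "plane k v (w' - s *s c k) = 0" by (rule L0)
    then show "plane k v w = 0" using w'(2) by (simp add: plane_linear)
  qed
  have block_0: "block k v = 0 \<longleftrightarrow> v$(k, 1) = 0 \<and> v$(k, 2) = 0 \<and> v$(k, 3) = 0" for k and v :: "complex^('m \<times> 3)"
    by (simp add: vec_eq_iff forall_3)
  have blocks_0: "v = 0" if "\<And>k. block k v = 0" for v :: "complex^('m \<times> 3)"
    using that by (intro block_eqI) simp
  consider i j where "\<not> (\<exists>s. \<forall>w. plane j ?h w = s * plane i ?h w)" "S \<subseteq> {i, j}"
    | i j l where "\<not> (\<exists>s. \<forall>w. plane j ?h w = s * plane i ?h w)" "i \<noteq> l" "i \<in> S" "l \<in> S" "j \<noteq> l"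
        "S \<subseteq> {i, l}" "\<exists>s. \<forall>w. plane l ?h w = s * plane i ?h w"
  proof (cases "\<exists>i. S \<subseteq> {i}")
    case True
    then show ?thesis using rank that(1) by blast
  next
    case False
    then obtain i where "i \<in> S" by blast
    with False obtain l where il: "i \<in> S" "l \<in> S" "i \<noteq> l" by blast
    then have S: "S \<subseteq> {i, l}" using two by blast
    show ?thesis
    proof (cases "\<exists>s. \<forall>w. plane l ?h w = s * plane i ?h w")
      case True
      obtain j where "\<not> (\<exists>s. \<forall>w. plane j ?h w = s * plane i ?h w)" using rank by blast
      then show ?thesis using that(2)[of j i l] il S True by blast
    qed (use that(1)[of l i] S in blast)
  qed
  then have "vec.dim ?T \<le> CARD('m + 4)"
  proof cases
    case 1
    from dual_basis[OF 1(1)] obtain z1 z2 where z: "plane i ?h z1 = 1" "plane j ?h z1 = 0"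
      "plane i ?h z2 = 0" "plane j ?h z2 = 1" by blast
    define \<phi> where "\<phi> = (\<lambda>v b. case b of
        Inl k \<Rightarrow> if k = i then v$(i, 1) else if k = j then v$(j, 1) else plane k v (\<zeta> k)
      | Inr n \<Rightarrow> if n = (1::4) then v$(i, 2) else if n = 2 then v$(i, 3) else if n = 3 then v$(j, 2) else v$(j, 3))"
    show ?thesis
    proof (rule dim_le_functionals[OF sub])
      show "Vector_Spaces.linear (*s) (*s) (\<lambda>v. \<chi> b. \<phi> v b)"
        by (rule vec_linearI) (auto simp: vec_eq_iff \<phi>_def plane_lin split: sum.split)
      fix v assume v: "v \<in> ?T" and "(\<chi> b. \<phi> v b) = 0"
      then have 0: "\<phi> v b = 0" for b by (simp add: vec_eq_iff)
      have "i \<noteq> j" using z by auto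
      have ij: "block i v = 0" "block j v = 0"
        unfolding block_0 using 0[of "Inl i"] 0[of "Inl j"] 0[of "Inr 1"] 0[of "Inr 2"] 0[of "Inr 3"] 0[of "Inr 4"] \<open>i \<noteq> j\<close>
        by (simp_all add: \<phi>_def)
      then have pij: "plane i v w = 0" "plane j v w = 0" for w by (simp_all add: plane_def scalar_product_linear)
      have "block k v = 0" if "k \<noteq> i" "k \<noteq> j" for k
      proof (rule block_zero[OF z])
        show "k \<notin> S" using 1(2) that by blast
        show "plane k v w = 0" if "w \<in> L" for w
          using tangent_relation[OF v z, of w k] that pij by (simp add: L_def)
        show "plane k v (\<zeta> k) = 0" using 0[of "Inl k"] that by (simp add: \<phi>_def)
      qed
      then show "v = 0" using ij blocks_0 by metis
    qed
  next
    case 2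
    from dual_basis[OF 2(1)] obtain z1 z2 where z: "plane i ?h z1 = 1" "plane j ?h z1 = 0"
      "plane i ?h z2 = 0" "plane j ?h z2 = 1" by blast
    note rel = rank_two_relation[OF p z]
    have lz: "plane l ?h z2 = 0" using 2(7) z by auto
    then have lz1: "plane l ?h z1 \<noteq> 0" using \<zeta>[of l] rel[of l "\<zeta> l"] by auto
    define \<phi> where "\<phi> = (\<lambda>v b. case b of
        Inl k \<Rightarrow> if k = i then plane i v z1 else if k = j then v$(j, 1)
          else if k = l then plane l v z1 else plane k v (\<zeta> k)
      | Inr n \<Rightarrow> if n = (1::4) then plane i v z2 else if n = 2 then plane l v z2
          else if n = 3 then v$(j, 2) else v$(j, 3))"
    show ?thesis
    proof (rule dim_le_functionals[OF sub])
      show "Vector_Spaces.linear (*s) (*s) (\<lambda>v. \<chi> b. \<phi> v b)"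
        by (rule vec_linearI) (auto simp: vec_eq_iff \<phi>_def plane_lin split: sum.split)
      fix v assume v: "v \<in> ?T" and "(\<chi> b. \<phi> v b) = 0"
      then have 0: "\<phi> v b = 0" for b by (simp add: vec_eq_iff)
      have "i \<noteq> j" using z by auto
      have from_L: "block k v = 0"
        if "plane k v z1 = 0" "plane k v z2 = 0" "\<And>w. w \<in> L \<Longrightarrow> plane k v w = 0" for k
      proof (rule plane_eq_0)
        fix w
        have "w - plane i ?h w *s z1 - plane j ?h w *s z2 \<in> L"
        proof -
          have "plane r ?h (w - plane i ?h w *s z1 - plane j ?h w *s z2) = 0" for r
            using rel[of r w] by (simp add: plane_linear)
          then show ?thesis by (simp add: L_def)
        qed
        then have "plane k v (w - plane i ?h w *s z1 - plane j ?h w *s z2) = 0" by (rule that(3))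
        then show "plane k v w = 0" using that(1,2) by (simp add: plane_linear)
      qed
      have j: "block j v = 0"
        unfolding block_0 using 0[of "Inl j"] 0[of "Inr 3"] 0[of "Inr 4"] \<open>i \<noteq> j\<close> by (simp add: \<phi>_def)
      then have pj: "plane j v w = 0" for w by (simp add: plane_def scalar_product_linear)
      have "plane i v (c l) = 0"
        using tangent_relation[OF v z, of "c l" l] 2(4) lz lz1 by (simp add: S_def L_def)
      then have iL: "plane i v w = 0" if w: "w \<in> L" for w
      proof -
        have "c i \<in> L" "c l \<in> L" using 2(3,4) by (simp_all add: S_def)
        then obtain s t where "w = s *s c i + t *s c l"
          using L_span[of "c i" "c l" w] centers_independent[of i l] 2(2) w by blast
        then show ?thesis using \<open>plane i v (c l) = 0\<close> by (simp add: plane_linear)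
      qed
      have i: "block i v = 0"
        using from_L[of i] iL 0[of "Inl i"] 0[of "Inr 1"] by (simp add: \<phi>_def)
      then have pi: "plane i v w = 0" for w by (simp add: plane_def scalar_product_linear)
      have onL: "plane k v w = 0" if "w \<in> L" for k w
        using tangent_relation[OF v z, of w k] that pi pj by (simp add: L_def)
      have l: "block l v = 0"
        using from_L[of l] onL 0[of "Inl l"] 0[of "Inr 2"] 2(2,5) by (simp add: \<phi>_def)
      have "block k v = 0" if "k \<noteq> i" "k \<noteq> j" "k \<noteq> l" for k
      proof (rule block_zero[OF z])
        show "k \<notin> S" using 2(6) that by blast
        show "plane k v w = 0" if "w \<in> L" for w using onL that by blast
        show "plane k v (\<zeta> k) = 0" using 0[of "Inl k"] that by (simp add: \<phi>_def)
      qed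
      then show "v = 0" using i j l blocks_0 by metis
    qed
  qed
  then show ?thesis by simp
qed

section \<open>Points of rank one\<close>

text \<open>
  All planes are one plane \<open>P\<close>, which contains all centers.  Let \<open>x\<close> be a point of \<open>P\<close> and \<open>y\<close> arbitrary.
  The lines through \<open>x\<close> and \<open>c j + \<epsilon> y\<close> tend to a line of \<open>P\<close> through \<open>c j\<close> as \<open>\<epsilon>\<close> tends to 0; their images
  in the views other than \<open>j\<close> tend to those of \<open>p\<close>, while the \<open>j\<close>-th image, rescaled by \<open>1 / \<epsilon>\<close>, is
  the line through the images of \<open>x\<close> and \<open>y\<close>.  So the forms vanishing on the variety vanish at \<open>p\<close> with
  its \<open>j\<close>-th block replaced by any line through the image of \<open>x\<close>.  Varying \<open>x\<close> on the line joining two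
  other centers shows that every vector supported in block \<open>j\<close> is tangent.
\<close>

lemma tangent_space_rank_one:
  assumes card: "3 \<le> CARD('m)"
    and rank: "\<And>i j. \<exists>s. \<forall>w. plane j (hom_coords p) w = s * plane i (hom_coords p) w"
  shows "cone_tangent_space (line_multiview_variety C) p = UNIV"
proof -
  let ?h = "hom_coords p"
  let ?T = "cone_tangent_space (line_multiview_variety C) p"
  have center_plane: "plane k ?h (c l) = 0" for k l
  proof -
    obtain s where "\<And>w. plane k ?h w = s * plane l ?h w" using rank by blast
    then show ?thesis by simp
  qed
  define in_block :: "'m \<Rightarrow> complex^3 \<Rightarrow> complex^('m \<times> 3)" where
    "in_block j u = (\<chi> k. if fst k = j then u $ snd k else 0)" for j u
  have block_in_block: "block i (in_block j u) = (if i = j then u else 0)" for i j u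
    by (simp add: in_block_def vec_eq_iff)
  have "in_block j v \<in> ?T" for j v
  proof -
    have "card {j} < CARD('m)" using card by simp
    then obtain a where a: "a \<noteq> j" by (metis (full_types) UNIV_eq_I card.empty card_insert_disjoint empty_iff finite.emptyI insert_iff less_irrefl)
    have "card {j, a} \<noteq> CARD('m)" using card a by simp
    then have "{j, a} \<noteq> UNIV" by metis
    then obtain b where b: "b \<noteq> j" "b \<noteq> a" by blast
    define x :: "complex^2 \<Rightarrow> complex^4" where "x z = z$1 *s c a + z$2 *s c b" for z
    have plane_x: "plane k ?h (x z) = 0" for k z
      by (simp add: x_def plane_linear center_plane)
    have rep_nz: "rep_proj (p k) \<noteq> 0" for k by (rule rep_proj_nonzero)
    have "\<forall>k. \<exists>r. rep_proj (p k) $ r \<noteq> 0" using rep_nz by (metis vec_eq_iff zero_index)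
    from choice[OF this] obtain r where r: "\<And>k. rep_proj (p k) $ r k \<noteq> 0" by blast
    \<comment> \<open>The scalar by which the limit image in view \<open>k\<close> differs from the representative of \<open>p k\<close>; it is a
      polynomial in \<open>z\<close>.\<close>
    define s where "s k z = (if k = j then 1 else cross (C k *v x z) (C k *v c j) $ r k / rep_proj (p k) $ r k)" for k z
    have s: "cross (C k *v x z) (C k *v c j) = s k z *s rep_proj (p k)" if "k \<noteq> j" for k z
    proof -
      have "\<exists>t. cross (C k *v x z) (C k *v c j) = t *s rep_proj (p k)"
        using plane_x[of k z] center_plane[of k j] by (intro cross_parallel[OF rep_nz]) (simp_all add: plane_def)
      then obtain t where t: "cross (C k *v x z) (C k *v c j) = t *s rep_proj (p k)" by blast
      then have "s k z = t" using r[of k] that by (simp add: s_def)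
      with t show ?thesis by simp
    qed
    have poly_x: "polynomial_fun (\<lambda>z. x z $ k)" for k
      unfolding x_def
      by (auto intro!: polynomial_fun.add polynomial_fun.mult polynomial_fun.const polynomial_fun.coordinate)
    have poly_s: "polynomial_fun (s k)" for k
    proof (cases "k = j")
      case False
      have "polynomial_fun (\<lambda>z. view_lines C (x z) (c j) $ (k, r k))"
        by (intro polynomial_map_component[OF polynomial_map_view_lines[OF poly_x]] polynomial_fun.const)
      then have "polynomial_fun (\<lambda>z. (1 / rep_proj (p k) $ r k) * (view_lines C (x z) (c j) $ (k, r k)))"
        by (intro polynomial_fun.mult polynomial_fun.const)
      moreover have "s k = (\<lambda>z. (1 / rep_proj (p k) $ r k) * (view_lines C (x z) (c j) $ (k, r k)))"
        using False by (auto simp: s_def view_lines_def)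
      ultimately show ?thesis by simp
    next
      case True
      then have "s k = (\<lambda>z. 1)" by (auto simp: s_def)
      then show ?thesis by (simp add: polynomial_fun.const)
    qed
    have s_nz: "\<exists>z. s k z \<noteq> 0" for k
    proof (cases "k = j")
      case False
      have "\<exists>z. cross (C k *v x z) (C k *v c j) \<noteq> 0"
      proof (cases "k = a")
        case True
        show ?thesis
          by (rule exI[of _ "axis 2 1"])
            (use True a b noncollinear[of a b j] in \<open>simp add: x_def axis_def\<close>)
      next
        case ka: False
        show ?thesis
          by (rule exI[of _ "axis 1 1"])
            (use ka False a noncollinear[of k a j] in \<open>simp add: x_def axis_def\<close>)
      qed
      then show ?thesis using s[OF False] by (metis vector_smult_lzero)
    qed (simp add: s_def)
    define M where "M z y = (\<chi> k. if fst k = j then cross (C j *v x z) (C j *v y) $ snd k else rep_proj (p (fst k)) $ snd k)" for z y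
    have block_M: "block k (M z y) = (if k = j then cross (C j *v x z) (C j *v y) else rep_proj (p k))" for k z y
      by (simp add: M_def vec_eq_iff)
    have M0: "f (M z y) = 0" if f: "f \<in> vanishing_forms (line_multiview_variety C)" for f z y
    proof -
      obtain d where d: "multiform d f" using f by (auto simp: vanishing_forms_def multihomogeneous_iff)
      define N where "N z \<epsilon> = (\<chi> k. if fst k = j then cross (C j *v x z) (C j *v y) $ snd k
         else cross (C (fst k) *v x z) (C (fst k) *v (c j + \<epsilon> *s y)) $ snd k)" for z \<epsilon>
      \<comment> \<open>The limit \<open>\<epsilon> \<longlongrightarrow> 0\<close>, taken by cancelling the power of \<open>\<epsilon>\<close> from a polynomial identity.\<close>
      have N0: "f (N z 0) = 0" for z
      proof -
        let ?g = "\<lambda>e :: complex^1. \<Prod>i\<in>UNIV. (if i = j then e$1 else 1) ^ d i"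
        have "view_lines C (x z) (c j + \<epsilon> *s y) = scale_blocks (\<lambda>i. if i = j then \<epsilon> else 1) (N z \<epsilon>)" for \<epsilon>
          by (auto simp: vec_eq_iff N_def view_lines_def matrix_vector_linear cross_linear)
        then have "(\<Prod>i\<in>UNIV. (if i = j then \<epsilon> else 1) ^ d i) * f (N z \<epsilon>) = 0" for \<epsilon>
          using multiform_scale[OF d] vanishing_forms_lines[OF f] by metis
        then have "f (N z (e$1)) * ?g e = 0" for e :: "complex^1" by (simp add: mult.commute)
        moreover have "polynomial_fun (\<lambda>e :: complex^1. f (N z (e$1)))"
        proof (rule polynomial_fun_compose[OF multiform_polynomial[OF d]])
          fix k :: "'m \<times> 3"
          have "polynomial_fun (\<lambda>e :: complex^1. view_lines C (x z) (c j + (e$1) *s y) $ k)"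
          proof (rule polynomial_map_component[OF polynomial_map_view_lines])
            show "polynomial_fun (\<lambda>e :: complex^1. (c j + (e$1) *s y) $ l)" for l
              by (auto intro!: polynomial_fun.add polynomial_fun.mult polynomial_fun.const polynomial_fun.coordinate)
          qed (rule polynomial_fun.const)
          then show "polynomial_fun (\<lambda>e :: complex^1. N z (e$1) $ k)"
            by (cases "fst k = j") (auto simp: N_def view_lines_def intro: polynomial_fun.const)
        qed
        moreover have "polynomial_fun ?g"
        proof (intro polynomial_fun_prod polynomial_fun_power)
          show "polynomial_fun (\<lambda>e :: complex^1. if i = j then e$1 else 1)" for i
            by (cases "i = j") (auto intro: polynomial_fun.const polynomial_fun.coordinate)
        qed
        moreover have "?g 1 \<noteq> 0" by simp
        ultimately have "f (N z ((0 :: complex^1)$1)) = 0" by (intro polynomial_fun_cancel)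
        then show ?thesis by simp
      qed
      let ?P = "\<lambda>z. \<Prod>k\<in>UNIV. s k z ^ d k"
      have "f (M z y) * ?P z = 0" for z
      proof -
        have "N z 0 = scale_blocks (\<lambda>k. s k z) (M z y)"
        proof (rule block_eqI)
          fix k
          have "block k (N z 0) = (if k = j then cross (C j *v x z) (C j *v y) else cross (C k *v x z) (C k *v c j))"
            by (simp add: N_def vec_eq_iff)
          also have "\<dots> = block k (scale_blocks (\<lambda>k. s k z) (M z y))"
            unfolding block_scale_blocks block_M using s[of k z] by (auto simp: s_def)
          finally show "block k (N z 0) = block k (scale_blocks (\<lambda>k. s k z) (M z y))" .
        qed
        then show ?thesis using N0[of z] multiform_scale[OF d, of "\<lambda>k. s k z" "M z y"] by (simp add: mult.commute)
      qed
      moreover have "polynomial_fun (\<lambda>z. f (M z y))"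
      proof (rule polynomial_fun_compose[OF multiform_polynomial[OF d]])
        fix k :: "'m \<times> 3"
        have "polynomial_fun (\<lambda>z. view_lines C (x z) y $ k)"
          by (intro polynomial_map_component[OF polynomial_map_view_lines[OF poly_x]] polynomial_fun.const)
        then show "polynomial_fun (\<lambda>z. M z y $ k)"
          by (cases "fst k = j") (auto simp: M_def view_lines_def intro: polynomial_fun.const)
      qed
      moreover have "polynomial_fun ?P" by (intro polynomial_fun_prod polynomial_fun_power poly_s)
      moreover obtain z0 where "\<forall>k\<in>UNIV. s k z0 \<noteq> 0"
        using polynomial_fun_common_nonzero[of UNIV s] poly_s s_nz by auto
      then have "?P z0 \<noteq> 0" by simp
      ultimately show ?thesis using polynomial_fun_cancel by blast
    qed
    let ?A = "scalar_product v (C j *v c a)" and ?B = "scalar_product v (C j *v c b)"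
    \<comment> \<open>The parameters of a point \<open>x z\<close> whose \<open>j\<close>-th image lies on the line with equation \<open>v\<close>.\<close>
    define z :: "complex^2" where "z = (if ?A = 0 \<and> ?B = 0 then vector [1, 0] else vector [?B, - ?A])"
    have v: "scalar_product v (C j *v x z) = 0"
      by (simp add: x_def z_def matrix_vector_linear scalar_product_linear)
    have z: "z$1 \<noteq> 0 \<or> z$2 \<noteq> 0" by (auto simp: z_def)
    have "C j *v x z \<noteq> 0"
    proof
      assume "C j *v x z = 0"
      then have 0: "z$1 *s (C j *v c a) + z$2 *s (C j *v c b) = 0" by (simp add: x_def matrix_vector_linear)
      have "z$1 *s cross (C j *v c a) (C j *v c b) = cross (z$1 *s (C j *v c a) + z$2 *s (C j *v c b)) (C j *v c b)"
        by (simp add: cross_linear)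
      moreover have "z$2 *s cross (C j *v c a) (C j *v c b) = cross (C j *v c a) (z$1 *s (C j *v c a) + z$2 *s (C j *v c b))"
        by (simp add: cross_linear)
      ultimately show False
        using z noncollinear[of j a b] a b unfolding 0 by (auto simp: cross_linear)
    qed
    show ?thesis
    proof (rule velocity_in_cone_tangent_space)
      show "((\<lambda>t. (?h + t *s in_block j v) $ k) has_field_derivative in_block j v $ k) (at 0)" for k
        by (auto intro!: derivative_eq_intros)
      show "f (?h + t *s in_block j v) = 0" if f: "f \<in> vanishing_forms (line_multiview_variety C)" for f t
      proof -
        have "scalar_product (rep_proj (p j)) (C j *v x z) = 0"
          using plane_x[of j z] by (simp add: plane_def)
        then have "scalar_product (rep_proj (p j) + t *s v) (C j *v x z) = 0"
          using v by (simp add: scalar_product_linear)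
        then obtain u where "rep_proj (p j) + t *s v = cross (C j *v x z) u"
          using orthogonal_imp_cross[OF \<open>C j *v x z \<noteq> 0\<close>] by blast
        moreover obtain y where "C j *v y = u" using camera_surj by blast
        ultimately have "?h + t *s in_block j v = M z y"
          by (intro block_eqI) (simp add: block_M block_in_block)
        then show ?thesis using M0[OF f] by simp
      qed
    qed simp
  qed
  then have "(\<Sum>j\<in>UNIV. in_block j (block j v)) \<in> ?T" for v
    by (intro vec.subspace_sum[OF subspace_cone_tangent_space])
  moreover have "(\<Sum>j\<in>UNIV. in_block j (block j v)) = v" for v
  proof -
    have "(\<Sum>j\<in>UNIV. in_block j (block j v) $ k) = v $ k" for k
    proof -
      have "(\<Sum>j\<in>UNIV. in_block j (block j v) $ k) = (\<Sum>j\<in>UNIV. if fst k = j then v $ k else 0)"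
        by (intro sum.cong) (auto simp: in_block_def)
      then show ?thesis by simp
    qed
    then show ?thesis unfolding vec_eq_iff sum_component by (rule allI)
  qed
  ultimately show ?thesis by (metis UNIV_eq_I)
qed

end

section \<open>The singular locus\<close>

context cameras
begin

lemma back_projection_rank_one_iff:
  "rank (back_projection_matrix C p) = 1 \<longleftrightarrow>
     (\<forall>i j. \<exists>s. \<forall>w. plane j (hom_coords p) w = s * plane i (hom_coords p) w)"
proof -
  let ?A = "back_projection_matrix C p"
  have plane: "plane k (hom_coords p) w = (\<Sum>r\<in>UNIV. ?A $ r $ k * w $ r)" for k w
    by (simp add: plane_def scalar_product_transpose) (simp add: scalar_product_def back_projection_matrix_def)
  have entry: "?A $ r $ k = plane k (hom_coords p) (axis r 1)" for k r
  proof -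
    have "(\<Sum>q\<in>UNIV. ?A $ q $ k * axis r 1 $ q) = (\<Sum>q\<in>UNIV. if q = r then ?A $ q $ k else 0)"
      by (intro sum.cong) (auto simp: axis_def)
    then show ?thesis by (simp add: plane)
  qed
  have "\<exists>r. ?A $ r $ i \<noteq> 0" for i
  proof (rule ccontr)
    assume "\<not> ?thesis"
    then have "plane i (hom_coords p) w = 0" for w by (simp add: plane)
    then show False using plane_hom_coords_nonzero by blast
  qed
  then have "rank ?A = 1 \<longleftrightarrow> (\<forall>i j. \<exists>s. \<forall>r. ?A $ r $ j = s * ?A $ r $ i)" by (rule rank_one_iff)
  also have "\<dots> \<longleftrightarrow> (\<forall>i j. \<exists>s. \<forall>w. plane j (hom_coords p) w = s * plane i (hom_coords p) w)"
  proof -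
    have "(\<forall>r. ?A $ r $ j = s * ?A $ r $ i) \<longleftrightarrow>
        (\<forall>w. plane j (hom_coords p) w = s * plane i (hom_coords p) w)" for i j s
    proof
      assume "\<forall>r. ?A $ r $ j = s * ?A $ r $ i"
      then show "\<forall>w. plane j (hom_coords p) w = s * plane i (hom_coords p) w"
        by (simp add: plane sum_distrib_left mult.assoc)
    qed (simp add: entry)
    then show ?thesis by simp
  qed
  finally show ?thesis .
qed

end

text \<open>
  A full-rank \<open>3 \<times> 4\<close> matrix has independent rows, hence is surjective; preimages of the unit vectors
  together with a kernel vector form a basis of \<open>complex^4\<close>, so the kernel is a line.
\<close>

lemma camera_setup:
  fixes C :: "'m::finite \<Rightarrow> complex^4^3"
  assumes camera: "\<And>i. pinhole_camera (C i)" and distinct: "\<And>i j. i \<noteq> j \<Longrightarrow> center (C i) \<noteq> center (C j)"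
  obtains c where "cameras C c"
proof -
  have surj: "\<exists>x. C i *v x = u" for i u
  proof -
    have dim: "vec.dim (rows (C i)) = 3" using camera[of i] by (simp add: pinhole_camera_def row_rank_def_gen)
    have rows: "rows (C i) = range (\<lambda>r. row r (C i))" by (auto simp: rows_def)
    have fin: "finite (rows (C i))" unfolding rows by simp
    have le: "card (rows (C i)) \<le> 3" unfolding rows using card_image_le[of "UNIV :: 3 set"] by simp
    have ind: "vec.independent (rows (C i))"
      using vec.card_le_dim_spanning[OF subset_refl vec.span_superset fin] le dim by simp
    then have "card (rows (C i)) = card (UNIV :: 3 set)" using vec.dim_eq_card_independent[OF ind] dim by simp
    then have inj: "inj (\<lambda>r. row r (C i))" unfolding rows by (intro eq_card_imp_inj_on) auto
    have "\<exists>B. C i ** B = mat 1"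
      unfolding matrix_right_invertible_independent_rows
    proof (intro allI impI)
      fix d r assume "(\<Sum>r\<in>UNIV. d r *s row r (C i)) = 0"
      then have "(\<Sum>v\<in>rows (C i). d (the_inv (\<lambda>r. row r (C i)) v) *s v) = 0"
        unfolding rows by (simp add: sum.reindex[OF inj] the_inv_f_f[OF inj])
      then have "d (the_inv (\<lambda>r. row r (C i)) (row r (C i))) = 0"
        using vec.independentD[OF ind fin subset_refl, of "\<lambda>v. d (the_inv (\<lambda>r. row r (C i)) v)"] by (auto simp: rows)
      then show "d r = 0" by (simp add: the_inv_f_f[OF inj])
    qed
    then obtain B where "C i ** B = mat 1" by blast
    then have "C i *v (B *v u) = u" by (simp add: matrix_vector_mul_assoc)
    then show ?thesis by blast
  qed
  have "\<exists>c. c \<noteq> 0 \<and> (\<forall>x. C i *v x = 0 \<longleftrightarrow> (\<exists>s. x = s *s c))" for i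
  proof -
    have "\<not> inj ((*v) (C i))"
    proof
      assume "inj ((*v) (C i))"
      then have "vec.dim (range ((*v) (C i))) = vec.dim (UNIV :: (complex^4) set)"
        by (intro vec.dim_image_eq matrix_vector_mul_linear_gen) simp
      moreover have "vec.dim (range ((*v) (C i))) \<le> vec.dim (UNIV :: (complex^3) set)"
        by (rule vec.dim_subset) simp
      ultimately show False by (simp add: card_cart_basis)
    qed
    then obtain e where e: "e \<noteq> 0" "C i *v e = 0" unfolding vec.inj_iff_eq_0 by blast
    obtain y1 y2 y3 where y: "C i *v y1 = axis 1 1" "C i *v y2 = axis 2 1" "C i *v y3 = axis 3 1"
      using surj by metis
    have comb: "C i *v (a *s y1 + b *s y2 + d *s y3 + s *s e) = vector [a, b, d]" for a b d s
      by (simp add: matrix_vector_linear y e vec_eq_iff forall_3 axis_def)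
    have "\<exists>s. x = s *s e" if x: "C i *v x = 0" for x
    proof -
      have "\<exists>a b d s. x = a *s y1 + b *s y2 + d *s y3 + s *s e"
      proof (rule independent_four_span)
        fix a b d s assume 0: "a *s y1 + b *s y2 + d *s y3 + s *s e = 0"
        then have "vector [a, b, d] = (0 :: complex^3)" using comb[of a b d s] by simp
        then have "a = 0" "b = 0" "d = 0" by (simp_all add: vec_eq_iff forall_3)
        with 0 e show "a = 0 \<and> b = 0 \<and> d = 0 \<and> s = 0" by simp
      qed
      then obtain a b d s where abds: "x = a *s y1 + b *s y2 + d *s y3 + s *s e" by blast
      then have "vector [a, b, d] = (0 :: complex^3)" using comb[of a b d s] x by simp
      then have "a = 0" "b = 0" "d = 0" by (simp_all add: vec_eq_iff forall_3)
      then show ?thesis using abds by auto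
    qed
    then show ?thesis using e by (intro exI[of _ e]) (auto simp: matrix_vector_linear)
  qed
  then obtain c where c: "\<And>i. c i \<noteq> 0" "\<And>i x. C i *v x = 0 \<longleftrightarrow> (\<exists>s. x = s *s c i)" by metis
  have "cameras C c"
  proof
    show "C i *v c j \<noteq> 0" if "i \<noteq> j" for i j
    proof
      assume "C i *v c j = 0"
      then obtain s where s: "c j = s *s c i" using c(2) by blast
      then have "s \<noteq> 0" using c(1)[of j] by auto
      have "center (C i) = center (C j)"
      proof (intro equalityI subsetI)
        fix x assume "x \<in> center (C i)"
        then obtain r where "x = r *s c i" by (auto simp: center_def c(2))
        then have "x = (r / s) *s c j" using s \<open>s \<noteq> 0\<close> by (simp add: vec_eq_iff)
        then show "x \<in> center (C j)" unfolding center_def mem_Collect_eq c(2) by blast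
      next
        fix x assume "x \<in> center (C j)"
        then obtain r where "x = r *s c j" by (auto simp: center_def c(2))
        then have "x = (r * s) *s c i" using s by (simp add: vec_eq_iff)
        then show "x \<in> center (C i)" unfolding center_def mem_Collect_eq c(2) by blast
      qed
      then show False using distinct that by blast
    qed
  qed (use surj c in blast)+
  then show ?thesis using that by blast
qed

text \<open>
  The view from \<open>c i\<close> is the projection away from \<open>c i\<close>, and it identifies two points exactly if they are
  collinear with \<open>c i\<close>.
\<close>

lemma (in cameras) noncollinear_images:
  assumes nc: "\<not> collinear_points (center (C i)) (center (C j)) (center (C k))" and "i \<noteq> j"
  shows "cross (C i *v c j) (C i *v c k) \<noteq> 0"
proof
  assume "cross (C i *v c j) (C i *v c k) = 0"
  then obtain s where "C i *v c k = s *s (C i *v c j)"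
    using cross_eq_0D distinct_centers[OF \<open>i \<noteq> j\<close>] by blast
  then have "C i *v (c k - s *s c j) = 0" by (simp add: matrix_vector_linear)
  then obtain t where "c k - s *s c j = t *s c i" using camera_kernel by blast
  then have ck: "c k = t *s c i + s *s c j" by (simp add: algebra_simps)
  let ?L = "vec.span {c i, c j}"
  have "c i \<notin> vec.span {c j}"
  proof
    assume "c i \<in> vec.span {c j}"
    then obtain r where "c i = r *s c j" by (auto simp: vec.span_singleton)
    then have "C j *v c i = 0" by (simp add: matrix_vector_linear)
    then show False using distinct_centers[of j i] \<open>i \<noteq> j\<close> by simp
  qed
  moreover have "c i \<noteq> c j" using calculation vec.span_base[of "c j" "{c j}"] by auto
  ultimately have "vec.dim ?L = 2"
    using vec.dim_span_eq_card_independent[of "{c i, c j}"] center_nonzero[of j]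
    by (simp add: vec.independent_insert)
  then have "is_line ?L" by (simp add: is_line_def vec.subspace_span)
  moreover have "c i \<in> ?L" "c j \<in> ?L" by (auto intro: vec.span_base)
  moreover have "c k \<in> ?L" unfolding ck by (intro vec.span_add vec.span_scale vec.span_base) auto
  ultimately show False
    using nc unfolding collinear_points_def center_eq
    by (meson empty_subsetI insert_subset vec.span_minimal vec.subspace_span)
qed

theorem theorem3p1:
  fixes C :: "'m::finite \<Rightarrow> complex^4^3"
  assumes "CARD('m) \<ge> 3"
    and "\<And>i. pinhole_camera (C i)"
    and "\<And>i j. i \<noteq> j \<Longrightarrow> center (C i) \<noteq> center (C j)"
    and "\<And>i j k. i \<noteq> j \<Longrightarrow> i \<noteq> k \<Longrightarrow> j \<noteq> k \<Longrightarrow>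
           \<not> collinear_points (center (C i)) (center (C j)) (center (C k))"
  shows "singular_locus (line_multiview_variety C) =
           {l \<in> line_multiview_variety C. rank (back_projection_matrix C l) = 1}"
proof -
  let ?X = "line_multiview_variety C"
  have "\<exists>c. cameras C c"
    by (rule camera_setup[of C]) (use assms(2,3) in blast)+
  then obtain c where "cameras C c" by blast
  then interpret cameras C c .
  obtain i1 i2 :: 'm where i12: "i1 \<noteq> i2"
  proof -
    have "\<not> is_singleton (UNIV :: 'm set)" using assms(1) by (simp add: is_singleton_altdef)
    then show ?thesis using that by (metis UNIV_I is_singletonI' UNIV_not_empty)
  qed
  obtain b1 b2 where "camera_chart C c i1 i2 b1 b2" using camera_chart_exists[OF i12] by blast
  then interpret camera_chart C c i1 i2 b1 b2 .
  interpret noncollinear_chart C c i1 i2 b1 b2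
    by unfold_locales (use noncollinear_images assms(4) in blast)
  have local_dim: "local_dim ?X p = enat 4" if "p \<in> ?X" for p
    using local_dim_irreducible[OF irreducible_line_multiview_variety that] krull_dim_line_multiview_variety
    by (simp add: numeral_eq_enat)
  have "smooth_at ?X p \<longleftrightarrow> rank (back_projection_matrix C p) \<noteq> 1" if p: "p \<in> ?X" for p
  proof (cases "rank (back_projection_matrix C p) = 1")
    case True
    then have "cone_tangent_space ?X p = UNIV"
      using tangent_space_rank_one[OF assms(1)] back_projection_rank_one_iff by blast
    then have "vec.dim (cone_tangent_space ?X p) = 3 * CARD('m)" by (simp add: card_cart_basis)
    then have "vec.dim (cone_tangent_space ?X p) \<noteq> 4 + CARD('m)" using assms(1) by simp
    then show ?thesis using True by (simp add: smooth_at_def local_dim[OF p])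
  next
    case False
    define parallel where "parallel i j \<longleftrightarrow> (\<exists>s. \<forall>w. plane j (hom_coords p) w = s * plane i (hom_coords p) w)" for i j
    have "\<exists>j. \<not> parallel i j" for i
    proof (rule ccontr)
      assume "\<not> ?thesis"
      then have par: "\<forall>j. \<exists>s. \<forall>w. plane j (hom_coords p) w = s * plane i (hom_coords p) w" by (simp add: parallel_def)
      from choice[OF this] obtain s where s: "\<And>j w. plane j (hom_coords p) w = s j * plane i (hom_coords p) w" by blast
      have "s j \<noteq> 0" for j using plane_hom_coords_nonzero[of j p] s[of j] by auto
      then have "plane j (hom_coords p) w = (s j / s k) * plane k (hom_coords p) w" for j k w
        using s[of k w] s[of j w] by simp
      then show False using False back_projection_rank_one_iff by blast
    qed
    then have "vec.dim (cone_tangent_space ?X p) \<le> CARD('m) + 4"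
      unfolding parallel_def by (intro tangent_dimension_le[OF p])
    then have "vec.dim (cone_tangent_space ?X p) = 4 + CARD('m)"
      using tangent_dimension_ge[OF p] by simp
    then show ?thesis using False by (simp add: smooth_at_def local_dim[OF p])
  qed
  then show ?thesis by (auto simp: singular_locus_def)
qed

end
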